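(* Let $F_b(x,y)$ be a family of real polynomials depending also polynomially on a real parameter $b$, and let $\Omega\subset\mathbb{R}^2$ be an open connected subset having a boundary $\partial\Omega$ formed by finitely many algebraic curves. Suppose that there exists an open interval $I\subset\mathbb{R}$ such that: (i) For some $b_0\in I$, $F_{b_0}(x,y)>0$ on $\Omega$. (ii) For all $b\in I$, $\triangle^2(F_b)\neq 0$. (iii) For all $b\in I$, all points of $F_b=0$ at infinity which are also in $\Omega$ do not depend on $b$ and are uniformly isolated. (iv) For all $b\in I$, $\{F_b=0\}\cap\partial\Omega=\emptyset$. Then for all $b\in I$, $F_b(x,y)>0$ on $\Omega$.
   Context: Discriminant: for a polynomial $P(x)=a_nx^n+\cdots+a_1x+a_0$, $\triangle_x(P)=(-1)^{n(n-1)/2}\frac1{a_n}\operatorname{Res}(P,P')$, where $\operatorname{Res}$ denotes the resultant; for polynomials in several variables, $\triangle_x$ (resp. $\triangle_y$) is the discriminant with respect to $x$ (resp. $y$), the other variables and the parameter being treated as coefficients. Put $\triangle^2_{y,x}(F_b)=\triangle_x(\triangle_y(F_b))$ and $\triangle^2_{x,y}(F_b)=\triangle_y(\triangle_x(F_b))$, which are polynomials in $b$. The double discriminant of the family is $\triangle^2(F_b):=\gcd\big(\triangle^2_{x,y}(F_b),\triangle^2_{y,x}(F_b)\big)$, a polynomial in $b$. Points at infinity: for a real polynomial $F=F^0+F^1+\cdots+F^n$ of degree $n$, with $F^i$ homogeneous of degree $i$ in $(x,y)$, let $\widetilde F(x,y,z)=z^nF^0(x,y)+z^{n-1}F^1(x,y)+\cdots+F^n(x,y)$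 be its homogenization. A point at infinity of $F=0$ is a point $[x^*:y^*:0]\in\mathbb{RP}^2$ with $F^n(x^*,y^* )=0$. It is said to be "also in $\Omega$" if it belongs to the closure of $\Omega$ in $\mathbb{RP}^2$ (with $\mathbb{R}^2$ embedded by $(x,y)\mapsto[x:y:1]$). Uniformly isolated: a point ${\bf p}$ on a real algebraic curve is isolated if it has an open neighborhood that meets the curve only at ${\bf p}$. For a one-parameter family of real algebraic curves $G_b(x,y)=0$, $b\in I$, depending polynomially on $b$, a point $(x_0,y_0)\in\mathbb{R}^2$ that is an isolated point of $\{G_b=0\}\subset\mathbb{R}^2$ for all $b\in I$ is uniformly isolated if for each $b\in I$ there exist neighborhoods $\mathcal V\subset I$ of $b$ and $\mathcal W\subset\mathbb{R}^2$ of $(x_0,y_0)$ such that for all $b'\in\mathcal V$, $\{(x,y)\in\mathbb{R}^2: G_{b'}(x,y)=0\}\cap\mathcal W=\{(x_0,y_0)\}$. For a point at infinity this is understood for the curve $\widetilde F_b=0$ written in an affine chart of $\mathbb{RP}^2$ containing the point, i.e. for $\widetilde F_b(x,1,z)=0$ in the $(x,z)$-plane or $\widetilde F_b(1,y,z)=0$ in the $(y,z)$-plane. *)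

theory Defs
  imports
    "HOL-Analysis.Analysis"
    "HOL-Computational_Algebra.Computational_Algebra"
    "HOL-Computational_Algebra.Field_as_Ring"
    "Subresultants.Resultant_Prelim"
begin

text \<open>
  A real polynomial in \<open>(x,y)\<close> is an element of \<open>real poly poly\<close>, read as \<open>\<real>[x][y]\<close>; a family
  \<open>F\<^sub>b(x,y)\<close> depending polynomially on \<open>b\<close> is an element of \<open>real poly poly poly\<close>, read as
  \<open>\<real>[b][x][y]\<close>.  In both cases the outermost variable is \<open>y\<close>.
\<close>

definition eval2 :: "real poly poly \<Rightarrow> real \<Rightarrow> real \<Rightarrow> real" where
  "eval2 G x y = poly (poly G [:y:]) x"

definition family_at :: "real poly poly poly \<Rightarrow> real \<Rightarrow> real poly poly" where
  "family_at F b = map_poly (map_poly (\<lambda>c. poly c b)) F"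

definition zero_locus :: "real poly poly \<Rightarrow> (real \<times> real) set" where
  "zero_locus G = {(x, y). eval2 G x y = 0}"


section \<open>The double discriminant\<close>

text \<open>
  For positive degree the division by the leading coefficient is exact.  A constant \<open>c\<close> has an
  empty Sylvester matrix, hence resultant \<open>1\<close> with its derivative, so its discriminant is
  \<open>1 div c\<close>: the inverse of \<open>c\<close> if \<open>c\<close> is a unit of the coefficient ring, and \<open>0\<close> otherwise.
\<close>

definition discriminant ::
    "'a :: {idom_divide, semiring_char_0} poly \<Rightarrow> 'a" where
  "discriminant P =
     (-1) ^ (degree P * (degree P - 1) div 2) * (resultant P (pderiv P) div lead_coeff P)"

text \<open>Exchange of the two outermost variables, \<open>A[x][y] \<rightarrow> A[y][x]\<close>.\<close>

definition swap_vars :: "'a :: comm_monoid_add poly poly \<Rightarrow> 'a poly poly" where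
  "swap_vars P = (\<Sum>j\<le>degree P. map_poly (\<lambda>c. monom c j) (coeff P j))"

lemma coeff_swap_vars: "coeff (coeff (swap_vars P) i) j = coeff (coeff P j) i"
proof -
  have "coeff (coeff (swap_vars P) i) j
      = (\<Sum>k\<le>degree P. if k = j then coeff (coeff P k) i else 0)"
    by (simp add: swap_vars_def coeff_sum coeff_map_poly)
  also have "\<dots> = coeff (coeff P j) i"
    by (cases "j \<le> degree P") (auto simp: coeff_eq_0)
  finally show ?thesis .
qed

definition discr_y :: "real poly poly poly \<Rightarrow> real poly poly"  \<comment> \<open>in \<open>\<real>[b][x]\<close>\<close> where
  "discr_y F = discriminant F"

definition discr_x :: "real poly poly poly \<Rightarrow> real poly poly"  \<comment> \<open>in \<open>\<real>[b][y]\<close>\<close> where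
  "discr_x F = discriminant (swap_vars F)"

definition double_discriminant :: "real poly poly poly \<Rightarrow> real poly" where
  "double_discriminant F = gcd (discriminant (discr_x F)) (discriminant (discr_y F))"


section \<open>Homogenization\<close>

definition total_degree :: "real poly poly \<Rightarrow> nat" where
  "total_degree G = Max (insert 0 {i + j | i j. coeff (coeff G j) i \<noteq> 0})"

lemma finite_total_degree_set:
  "finite {i + j | i j. coeff (coeff G j) i \<noteq> (0 :: 'a :: zero)}"
proof (rule finite_subset)
  show "{i + j | i j. coeff (coeff G j) i \<noteq> 0}
      \<subseteq> (\<Union>j\<le>degree G. (\<lambda>i. i + j) ` {..degree (coeff G j)})"
  proof
    fix n assume "n \<in> {i + j | i j. coeff (coeff G j) i \<noteq> 0}"
    then obtain i j where n: "n = i + j" and nz: "coeff (coeff G j) i \<noteq> 0"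
      by blast
    have i: "i \<le> degree (coeff G j)"
      using nz by (rule le_degree)
    have "coeff G j \<noteq> 0"
      using nz by auto
    then have "j \<le> degree G"
      by (rule le_degree)
    then show "n \<in> (\<Union>j\<le>degree G. (\<lambda>i. i + j) ` {..degree (coeff G j)})"
      using n i by blast
  qed
qed simp

definition homogeneous_part :: "real poly poly \<Rightarrow> nat \<Rightarrow> real \<Rightarrow> real \<Rightarrow> real" where
  "homogeneous_part G k x y = (\<Sum>j\<le>k. coeff (coeff G j) (k - j) * x ^ (k - j) * y ^ j)"

definition homogenization :: "real poly poly \<Rightarrow> real \<Rightarrow> real \<Rightarrow> real \<Rightarrow> real" where
  "homogenization G x y z =
     (\<Sum>k\<le>total_degree G. z ^ (total_degree G - k) * homogeneous_part G k x y)"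


section \<open>The real projective plane\<close>

text \<open>
  The point \<open>[x : y : z]\<close> is the line spanned by \<open>(x, y, z) \<noteq> 0\<close>, and \<open>\<real>\<P>\<^sup>2\<close> carries the
  quotient topology of \<open>\<real>\<^sup>3 - {0}\<close>.
\<close>

definition proj_pt :: "real \<times> real \<times> real \<Rightarrow> (real \<times> real \<times> real) set" where
  "proj_pt v = span {v}"

definition proj_open :: "(real \<times> real \<times> real) set set \<Rightarrow> bool" where
  "proj_open U \<longleftrightarrow> U \<subseteq> proj_pt ` (- {0}) \<and> open {v. v \<noteq> 0 \<and> proj_pt v \<in> U}"

lemma istopology_proj_open: "istopology proj_open"
  unfolding istopology_def
proof (intro conjI allI impI)
  fix S T assume "proj_open S" "proj_open T"
  moreover have "{v. v \<noteq> 0 \<and> proj_pt v \<in> S \<inter> T}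
      = {v. v \<noteq> 0 \<and> proj_pt v \<in> S} \<inter> {v. v \<noteq> 0 \<and> proj_pt v \<in> T}"
    by auto
  ultimately show "proj_open (S \<inter> T)"
    by (auto simp: proj_open_def)
next
  fix \<K> assume *: "\<forall>K\<in>\<K>. proj_open K"
  have "{v. v \<noteq> 0 \<and> proj_pt v \<in> \<Union>\<K>} = (\<Union>K\<in>\<K>. {v. v \<noteq> 0 \<and> proj_pt v \<in> K})"
    by auto
  moreover have "open (\<Union>K\<in>\<K>. {v. v \<noteq> 0 \<and> proj_pt v \<in> K})"
    using * by (auto simp: proj_open_def)
  ultimately show "proj_open (\<Union>\<K>)"
    using * by (simp add: proj_open_def Sup_le_iff)
qed

definition RP2 :: "(real \<times> real \<times> real) set topology" where
  "RP2 = topology proj_open"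

lemma openin_RP2: "openin RP2 U \<longleftrightarrow> proj_open U"
  by (simp add: RP2_def istopology_proj_open topology_inverse')

lemma topspace_RP2: "topspace RP2 = proj_pt ` (- {0})"
proof -
  have "{v. v \<noteq> 0 \<and> proj_pt v \<in> proj_pt ` (- {0})} = - {0}"
    by auto
  then have "proj_open (proj_pt ` (- {0}))"
    by (simp add: proj_open_def open_Compl)
  then show ?thesis
    unfolding topspace_def openin_RP2 by (auto simp: proj_open_def)
qed

definition affine_embed :: "real \<times> real \<Rightarrow> (real \<times> real \<times> real) set" where
  "affine_embed = (\<lambda>(x, y). proj_pt (x, y, 1))"

definition points_at_infinity :: "real poly poly \<Rightarrow> (real \<times> real \<times> real) set set" where
  "points_at_infinity G =
     {proj_pt (x, y, 0) | x y. (x, y) \<noteq> (0, 0) \<and> homogeneous_part G (total_degree G) x y = 0}"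

definition points_at_infinity_in ::
    "(real \<times> real) set \<Rightarrow> real poly poly \<Rightarrow> (real \<times> real \<times> real) set set" where
  "points_at_infinity_in \<Omega> G = points_at_infinity G \<inter> RP2 closure_of (affine_embed ` \<Omega>)"


section \<open>Uniformly isolated points\<close>

definition uniformly_isolated ::
    "real set \<Rightarrow> (real \<Rightarrow> real \<Rightarrow> real \<Rightarrow> real) \<Rightarrow> real \<times> real \<Rightarrow> bool" where
  "uniformly_isolated I G p \<longleftrightarrow>
     (\<forall>b\<in>I. p isolated_in {(x, y). G b x y = 0}) \<and>
     (\<forall>b\<in>I. \<exists>V W. open V \<and> b \<in> V \<and> V \<subseteq> I \<and> open W \<and> p \<in> W \<and>
        (\<forall>b'\<in>V. {(x, y). G b' x y = 0} \<inter> W = {p}))"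

text \<open>
  Each member of the family is homogenized with its own degree, so the power of \<open>z\<close> involved may
  change at parameters where the degree in \<open>(x,y)\<close> drops.
\<close>

definition uniformly_isolated_at_infinity ::
    "real set \<Rightarrow> real poly poly poly \<Rightarrow> (real \<times> real \<times> real) set \<Rightarrow> bool" where
  "uniformly_isolated_at_infinity I F P \<longleftrightarrow>
     (\<exists>x. P = proj_pt (x, 1, 0) \<and>
        uniformly_isolated I (\<lambda>b x z. homogenization (family_at F b) x 1 z) (x, 0)) \<or>
     (\<exists>y. P = proj_pt (1, y, 0) \<and>
        uniformly_isolated I (\<lambda>b y z. homogenization (family_at F b) 1 y z) (y, 0))"


section \<open>Boundaries formed by algebraic curves\<close>

definition algebraic_curve :: "(real \<times> real) set \<Rightarrow> bool" where
  "algebraic_curve C \<longleftrightarrow> (\<exists>G. total_degree G > 0 \<and> C = zero_locus G)"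

text \<open>
  Pieces of curves are allowed, so that for instance a quadrant, bounded by two half-lines,
  qualifies.  The empty set (the boundary of the whole plane) is the case of no curve.
\<close>

definition formed_by_algebraic_curves :: "(real \<times> real) set \<Rightarrow> bool" where
  "formed_by_algebraic_curves S \<longleftrightarrow>
     (\<exists>\<A>. finite \<A> \<and> S = \<Union>\<A> \<and> (\<forall>A\<in>\<A>. connected A \<and> (\<exists>C. algebraic_curve C \<and> A \<subseteq> C)))"

end

theory Submission
  imports Defs "HOL-Complex_Analysis.Complex_Analysis"
begin

text \<open>
  Write \<open>Z\<^sub>b\<close> for the zero set of \<open>F\<^sub>b\<close> in \<open>\<Omega>\<close>.  By (iv) it is closed in the plane, and by the isolation
  part of (iii) it cannot run off to infinity, so \<open>Z\<^sub>b\<close> is compact for every \<open>b \<in> I\<close>; in particular it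
  contains no vertical line.  The set of \<open>b\<close> with \<open>F\<^sub>b > 0\<close> on \<open>\<Omega>\<close> is shown to be open and closed in
  \<open>I\<close>.  By (ii) one of the two iterated discriminants is nonzero at the limit parameter \<open>b\<^sub>1\<close>; exchanging
  the variables if necessary, let it be the discriminant of \<open>D = \<triangle>\<^sub>y F\<close> with respect to \<open>x\<close>.

  Open: if \<open>Z\<^sub>b\<close> is nonempty for \<open>b\<close> near \<open>b\<^sub>1\<close> while \<open>Z\<^sub>b\<^sub>1\<close> is empty, then \<open>Z\<^sub>b\<close> leaves every
  bounded set.  Its rightmost point is a fold lying over a root of \<open>D\<close>, and up to the preceding root of
  \<open>D\<close> there are two points of \<open>Z\<^sub>b\<close> over each \<open>x\<close>.  These two roots cannot merge in the limit, finitely or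
  at infinity, so they enclose a fixed interval of \<open>x\<close>, over which two \<open>y\<close>-roots tend to infinity;
  then \<open>D\<close> vanishes on that interval at \<open>b = b\<^sub>1\<close>, a contradiction.

  Closed: if \<open>F\<^sub>b > 0\<close> for \<open>b\<close> near \<open>b\<^sub>1\<close>, a zero of the limit is a singular point, hence a double root
  of \<open>D\<close> at \<open>b\<^sub>1\<close>.  This is absurd unless \<open>D\<close> has formal degree 1 in \<open>x\<close>, where its discriminant is
  the constant 1 and says nothing if \<open>D\<close> vanishes identically at \<open>b\<^sub>1\<close>.  In that case, for \<open>b \<noteq> b\<^sub>1\<close>, the
  complex roots of \<open>F\<^sub>b(x,\<cdot>)\<close> near a rightmost point \<open>(x\<^sub>0,y\<^sub>0)\<close> of \<open>Z\<^sub>b\<^sub>1\<close> are simple and form a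
  covering of a disc around \<open>x\<^sub>0\<close>, so they are given by holomorphic functions \<open>g\<close>.  The difference of \<open>g\<close>
  and its complex conjugate has no zero and tends to 0 at \<open>x\<^sub>0\<close>, so by Hurwitz its limit vanishes
  identically: the limit of \<open>g\<close> is real on the real axis and continues \<open>Z\<^sub>b\<^sub>1\<close> to the right of \<open>x\<^sub>0\<close>.
\<close>

unbundle no vec_syntax
no_notation fps_nth (infixl "$" 75)

section \<open>Discriminants as determinants\<close>


text \<open>
  The Sylvester matrix of \<open>P = \<Sum>k\<le>m. c k * y ^ k\<close> and \<open>P'\<close> with the leading coefficient divided out of
  the first column.  Its determinant specializes correctly even where the leading coefficient vanishes.
\<close>

definition disc_mat :: "nat \<Rightarrow> (nat \<Rightarrow> 'a::comm_ring_1) \<Rightarrow> 'a mat" where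
  "disc_mat m c = mat (2*m-1) (2*m-1) (\<lambda>(i,j).
     if j = 0 then (if i = 0 then 1 else if i = m - 1 then of_nat m else 0)
     else if i < m - 1 then (if i \<le> j \<and> j - i \<le> m then c (m + i - j) else 0)
     else (if i - (m - 1) \<le> j \<and> j \<le> i then of_nat (Suc (i - j)) * c (Suc (i - j)) else 0))"

lemma disc_mat_carrier [simp]: "disc_mat m c \<in> carrier_mat (2*m-1) (2*m-1)"
  by (simp add: disc_mat_def)

text \<open>
  With \<open>\<mu> k = y ^ k\<close> the product with this vector evaluates all rows at \<open>y\<close>; derivatives and divided
  differences of powers give the other functionals needed.
\<close>

definition disc_vec :: "nat \<Rightarrow> (nat \<Rightarrow> 'a::comm_ring_1) \<Rightarrow> (nat \<Rightarrow> 'a) \<Rightarrow> 'a Matrix.vec" where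
  "disc_vec m c \<mu> = Matrix.vec (2*m-1) (\<lambda>j. if j = 0 then c m * \<mu> (2*m-2) else \<mu> (2*m-2-j))"

lemma disc_vec_carrier [simp]: "disc_vec m c \<mu> \<in> carrier_vec (2*m-1)"
  by (simp add: disc_vec_def)

text \<open>The factor \<open>c m\<close> in the first entry of \<open>disc_vec\<close> puts back
  the leading coefficient removed from column 0. Row \<open>i\<close> thus applies the linear
  functional sending \<open>y^k\<close> to \<open>\<mu> k\<close> to the polynomial
  \<open>y^(m-2-i) P\<close> (upper rows) or \<open>y^(2m-2-i) P'\<close> (lower rows).\<close>

lemma disc_mat_mult_vec:
  assumes m: "m \<ge> 2"
  shows "disc_mat m c *\<^sub>v disc_vec m c \<mu> = Matrix.vec (2*m-1) (\<lambda>i.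
     if i < m - 1 then \<Sum>k\<le>m. c k * \<mu> (m - 2 - i + k)
     else \<Sum>k<m. of_nat (Suc k) * c (Suc k) * \<mu> (2*m - 2 - i + k))"
proof (rule eq_vecI)
  fix i assume "i < dim_vec (Matrix.vec (2*m-1) (\<lambda>i.
     if i < m - 1 then \<Sum>k\<le>m. c k * \<mu> (m - 2 - i + k)
     else \<Sum>k<m. of_nat (Suc k) * c (Suc k) * \<mu> (2*m - 2 - i + k)))"
  then have i: "i < 2*m-1" by simp
  define g where "g = (\<lambda>j. (if i < m - 1 then (if i \<le> j \<and> j - i \<le> m then c (m + i - j) else 0)
     else (if i - (m - 1) \<le> j \<and> j \<le> i then of_nat (Suc (i - j)) * c (Suc (i - j)) else 0)) * \<mu> (2*m-2-j))"
  have "(disc_mat m c *\<^sub>v disc_vec m c \<mu>) $ i = (\<Sum>j<2*m-1. g j)"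
    unfolding disc_mat_def disc_vec_def using i m
    by (auto simp: scalar_prod_def lessThan_atLeast0 g_def mult.assoc numeral_2_eq_2 intro!: sum.cong)
  also have "\<dots> = (if i < m - 1 then \<Sum>k\<le>m. c k * \<mu> (m - 2 - i + k)
     else \<Sum>k<m. of_nat (Suc k) * c (Suc k) * \<mu> (2*m - 2 - i + k))"
  proof (cases "i < m - 1")
    case True
    have "(\<Sum>j<2*m-1. g j) = (\<Sum>j\<in>{i..i+m}. g j)"
      using True by (intro sum.mono_neutral_right) (auto simp: g_def)
    also have "\<dots> = (\<Sum>k\<le>m. c k * \<mu> (m - 2 - i + k))"
      by (rule sum.reindex_bij_witness[of _ "\<lambda>k. m + i - k" "\<lambda>j. m + i - j"])
         (use True in \<open>auto simp: g_def mult_2 numeral_2_eq_2 intro!: arg_cong[of _ _ \<mu>]\<close>)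
    finally show ?thesis using True by simp
  next
    case False
    have "(\<Sum>j<2*m-1. g j) = (\<Sum>j\<in>{i-(m-1)..i}. g j)"
      using False i by (intro sum.mono_neutral_right) (auto simp: g_def)
    also have "\<dots> = (\<Sum>k<m. of_nat (Suc k) * c (Suc k) * \<mu> (2*m - 2 - i + k))"
      by (rule sum.reindex_bij_witness[of _ "\<lambda>k. i - k" "\<lambda>j. i - j"])
         (use False i m in \<open>auto simp: g_def Suc_diff_le intro!: arg_cong[of _ _ \<mu>]\<close>)
    finally show ?thesis using False by simp
  qed
  finally show "(disc_mat m c *\<^sub>v disc_vec m c \<mu>) $ i = Matrix.vec (2*m-1) (\<lambda>i.
     if i < m - 1 then \<Sum>k\<le>m. c k * \<mu> (m - 2 - i + k)
     else \<Sum>k<m. of_nat (Suc k) * c (Suc k) * \<mu> (2*m - 2 - i + k)) $ i"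
    using i by simp
qed (simp add: disc_mat_def)

lemma disc_mat_mult_vec':
  assumes "m \<ge> 2"
    and "\<And>s. (\<Sum>k\<le>m. c k * \<mu> (s + k)) = R s"
    and "\<And>s. (\<Sum>k<m. of_nat (Suc k) * c (Suc k) * \<mu> (s + k)) = R' s"
  shows "disc_mat m c *\<^sub>v disc_vec m c \<mu> =
    Matrix.vec (2*m-1) (\<lambda>i. if i < m - 1 then R (m - 2 - i) else R' (2*m - 2 - i))"
  unfolding disc_mat_mult_vec[OF assms(1)] assms(2,3) ..

text \<open>Homogeneity in one column, read off from Cramer's rule for the vector \<open>a\<close>
  times \<open>unit_vec n k\<close>, whose image is \<open>a\<close> times column
  \<open>k\<close>.\<close>

lemma det_replace_col_smult:
  fixes A :: "'a::comm_ring_1 mat"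
  assumes A: "A \<in> carrier_mat n n" and l: "l \<in> carrier_vec n" and k: "k < n"
  shows "Determinant.det (replace_col A (a \<cdot>\<^sub>v l) k) = a * Determinant.det (replace_col A l k)"
proof -
  let ?A = "replace_col A l k"
  have B: "?A \<in> carrier_mat n n" using A by (auto simp: replace_col_def)
  have "?A *\<^sub>v (a \<cdot>\<^sub>v unit_vec n k) = a \<cdot>\<^sub>v l"
    by (rule eq_vecI) (use A B l k in \<open>auto simp: scalar_prod_def replace_col_def unit_vec_def if_distrib cong: if_cong\<close>)
  then have "replace_col A (a \<cdot>\<^sub>v l) k = replace_col ?A (?A *\<^sub>v (a \<cdot>\<^sub>v unit_vec n k)) k"
    by (intro eq_matI) (auto simp: replace_col_def)
  then show ?thesis
    using cramer_lemma_mat[OF B, of "a \<cdot>\<^sub>v unit_vec n k" k] k by simp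
qed

text \<open>Column 0 of the Sylvester matrix contains only the leading coefficients of
  \<open>P\<close> and \<open>pderiv P\<close>, so it is \<open>lead_coeff P\<close> times the
  column \<open>l\<close>. Taking this factor out carries out the division in
  \<open>discriminant\<close>.\<close>

lemma discriminant_eq_det:
  fixes P :: "'a::{idom_divide, semiring_char_0} poly"
  assumes m: "degree P \<ge> 2"
  shows "discriminant P = (-1) ^ (degree P * (degree P - 1) div 2) *
           Determinant.det (disc_mat (degree P) (coeff P))"
proof -
  define m where "m = degree P"
  have m2: "m \<ge> 2" using m by (simp add: m_def)
  let ?M = "disc_mat m (coeff P)"
  have d: "degree (pderiv P) = m - 1" by (simp add: degree_pderiv m_def)
  define l where "l = Matrix.vec (2*m-1) (\<lambda>i. if i = 0 then (1::'a) else if i = m - 1 then of_nat m else 0)"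
  have l: "l \<in> carrier_vec (2*m-1)" by (simp add: l_def)
  have M: "?M = replace_col ?M l 0"
    by (intro eq_matI) (auto simp: replace_col_def disc_mat_def l_def)
  have "sylvester_mat P (pderiv P) = replace_col ?M (lead_coeff P \<cdot>\<^sub>v l) 0"
  proof (rule eq_matI)
    fix i j assume "i < dim_row (replace_col ?M (lead_coeff P \<cdot>\<^sub>v l) 0)"
      "j < dim_col (replace_col ?M (lead_coeff P \<cdot>\<^sub>v l) 0)"
    then have ij: "i < 2*m-1" "j < 2*m-1" by (auto simp: replace_col_def disc_mat_def)
    have "i < degree P + degree (pderiv P)" "j < degree P + degree (pderiv P)"
      using ij m2 by (auto simp: d m_def[symmetric])
    from sylvester_index_mat[OF this]
    show "sylvester_mat P (pderiv P) $$ (i, j) = replace_col ?M (lead_coeff P \<cdot>\<^sub>v l) 0 $$ (i, j)"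
      using ij m2 by (auto simp: replace_col_def disc_mat_def l_def d coeff_pderiv m_def[symmetric] mult.commute)
  qed (use m2 in \<open>auto simp: replace_col_def disc_mat_def d m_def[symmetric]\<close>)
  then have "resultant P (pderiv P) = lead_coeff P * Determinant.det ?M"
    using det_replace_col_smult[OF disc_mat_carrier l, of 0 "coeff P" "lead_coeff P"] m2 M[symmetric]
    by (simp add: resultant_def)
  moreover have "lead_coeff P \<noteq> 0" using m by auto
  ultimately show ?thesis by (simp add: discriminant_def m_def)
qed

text \<open>The size of the matrix is fixed by the generic degree, so the formula survives a
  homomorphism that kills leading coefficients. This is how one discriminant of the family speaks
  about every member.\<close>

lemma hom_discriminant:
  fixes P :: "'a::{idom_divide, semiring_char_0} poly" and \<phi> :: "'a \<Rightarrow> 'b::comm_ring_1"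
  assumes "comm_ring_hom \<phi>" and m: "degree P \<ge> 2"
  shows "\<phi> (discriminant P) = (-1) ^ (degree P * (degree P - 1) div 2) *
           Determinant.det (disc_mat (degree P) (\<lambda>k. \<phi> (coeff P k)))"
proof -
  interpret comm_ring_hom \<phi> by fact
  have "map_mat \<phi> (disc_mat (degree P) (coeff P)) = disc_mat (degree P) (\<lambda>k. \<phi> (coeff P k))"
    by (intro eq_matI) (auto simp: disc_mat_def hom_distribs)
  then show ?thesis
    unfolding discriminant_eq_det[OF m] by (simp add: hom_distribs flip: hom_det)
qed

section \<open>Simple and double vanishing of the determinant\<close>

text \<open>A double root at infinity of a polynomial of formal degree \<open>m\<close>: every
  nonzero entry of column 1 is a multiple of \<open>c m\<close> or \<open>c (m - 1)\<close>.\<close>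

lemma det_disc_mat_infinity:
  fixes c :: "nat \<Rightarrow> 'a::idom"
  assumes m: "m \<ge> 2" and c: "c m = 0" "c (m - 1) = 0"
  shows "Determinant.det (disc_mat m c) = 0"
proof -
  let ?e = "unit_vec (2*m-1) 1 :: 'a Matrix.vec"
  have "?e $ 1 \<noteq> 0\<^sub>v (2*m-1) $ 1" using m by simp
  then have "?e \<noteq> 0\<^sub>v (2*m-1)" by metis
  moreover have "disc_mat m c *\<^sub>v ?e = 0\<^sub>v (2*m-1)"
  proof (rule eq_vecI)
    fix i assume "i < dim_vec (0\<^sub>v (2*m-1) :: 'a Matrix.vec)"
    then have i: "i < 2*m-1" by simp
    have "(disc_mat m c *\<^sub>v ?e) $ i = disc_mat m c $$ (i, 1)"
      using i m by (auto simp: disc_mat_def)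
    also have "\<dots> = 0"
    proof -
      consider "i = 0" | "i = 1" "i < m - 1" | "i > 1" "i < m - 1" | "i = m - 1" | "i = m" | "i > m" by linarith
      then show ?thesis
      proof cases
        case 4
        then have "Suc (i - 1) = m - 1" using m by simp
        with 4 i m c show ?thesis by (auto simp: disc_mat_def)
      qed (use i m c in \<open>auto simp: disc_mat_def numeral_2_eq_2\<close>)
    qed
    finally show "(disc_mat m c *\<^sub>v ?e) $ i = 0\<^sub>v (2*m-1) $ i" using i by simp
  qed (simp add: disc_mat_def)
  ultimately show ?thesis
    using det_0_iff_vec_prod_zero[OF disc_mat_carrier[of m c]] unit_vec_carrier by blast
qed

text \<open>
  Cramer's rule with \<open>A v = (x - x0) L\<close> extracts one factor \<open>x - x0\<close>; the matrix that remains is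
  singular at \<open>x0\<close>.
\<close>

lemma pCons_dvd_sq_det:
  fixes A :: "'a::field poly mat"
  assumes A: "A \<in> carrier_mat n n" and v: "v \<in> carrier_vec n" and k: "k < n" "v $ k = 1"
    and L: "L \<in> carrier_vec n" and AvL: "A *\<^sub>v v = [:-x0, 1:] \<cdot>\<^sub>v L"
    and w: "w \<in> carrier_vec n" "w $ k = 0" and nz: "w \<noteq> 0\<^sub>v n \<or> \<alpha> \<noteq> 0"
    and ker: "map_mat (\<lambda>p. poly p x0) A *\<^sub>v w + \<alpha> \<cdot>\<^sub>v map_vec (\<lambda>p. poly p x0) L = 0\<^sub>v n"
  shows "[:-x0, 1:]\<^sup>2 dvd Determinant.det A"
proof -
  have hom: "comm_ring_hom (\<lambda>p. poly p x0)" by unfold_locales auto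
  let ?R = "replace_col A L k"
  have R: "?R \<in> carrier_mat n n" using A by (auto simp: replace_col_def)
  have "Determinant.det A = [:-x0, 1:] * Determinant.det ?R"
    using cramer_lemma_mat[OF A v k(1)] k(2) det_replace_col_smult[OF A L k(1), of "[:-x0, 1:]"]
    by (simp add: AvL)
  moreover have "poly (Determinant.det ?R) x0 = 0"
  proof -
    \<comment> \<open>Column \<open>k\<close> of \<open>?R\<close> is \<open>L\<close>, and
      \<open>w $ k = 0\<close> leaves room for the entry \<open>\<alpha>\<close>. At
      \<open>x0\<close> the matrix \<open>?R\<close> therefore sends \<open>?z\<close> to
      \<open>A w + \<alpha> L\<close>, which is zero by \<open>ker\<close>.\<close>
    let ?z = "w + \<alpha> \<cdot>\<^sub>v unit_vec n k"
    have z: "?z \<in> carrier_vec n" using w by simp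
    have zi: "?z $ i = (if i = k then \<alpha> else w $ i)" if "i < n" for i
      using that w k by (auto simp: unit_vec_def)
    have "?z \<noteq> 0\<^sub>v n"
    proof
      assume 0: "?z = 0\<^sub>v n"
      then have "(if i = k then \<alpha> else w $ i) = 0" if "i < n" for i
        using zi[OF that] that by simp
      then have 1: "(if i = k then \<alpha> else w $ i) = 0" if "i < n" for i
        using that by blast
      have "\<alpha> = 0" using 1[of k] k by simp
      moreover have "w $ i = 0" if "i < n" for i using 1[OF that] w by (cases "i = k") auto
      then have "w = 0\<^sub>v n" using w by (auto intro!: eq_vecI)
      ultimately show False using nz by simp
    qed
    moreover have "map_mat (\<lambda>p. poly p x0) ?R *\<^sub>v ?z = 0\<^sub>v n"
    proof (rule eq_vecI)
      fix i assume "i < dim_vec (0\<^sub>v n :: 'a Matrix.vec)"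
      then have i: "i < n" by simp
      have "(map_mat (\<lambda>p. poly p x0) ?R *\<^sub>v ?z) $ i =
          (\<Sum>j\<in>{0..<n}. (if j = k then poly (L $ i) x0 else poly (A $$ (i,j)) x0) * (if j = k then \<alpha> else w $ j))"
        using i R z A L w k by (auto simp: scalar_prod_def replace_col_def zi intro!: sum.cong)
      also have "\<dots> = (\<Sum>j\<in>{0..<n}. poly (A $$ (i,j)) x0 * w $ j + (if j = k then \<alpha> * poly (L $ i) x0 else 0))"
        using w by (intro sum.cong) auto
      also have "\<dots> = (map_mat (\<lambda>p. poly p x0) A *\<^sub>v w + \<alpha> \<cdot>\<^sub>v map_vec (\<lambda>p. poly p x0) L) $ i"
        using i A L w k by (auto simp: scalar_prod_def sum.distrib)
      finally show "(map_mat (\<lambda>p. poly p x0) ?R *\<^sub>v ?z) $ i = 0\<^sub>v n $ i" by (simp add: ker)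
    qed (use R in auto)
    moreover have "map_mat (\<lambda>p. poly p x0) ?R \<in> carrier_mat n n" using R by simp
    ultimately have "Determinant.det (map_mat (\<lambda>p. poly p x0) ?R) = 0"
      using det_0_iff_vec_prod_zero z by blast
    then show ?thesis by (simp only: comm_ring_hom.hom_det[OF hom])
  qed
  then have "[:-x0, 1:] dvd Determinant.det ?R" by (simp add: poly_eq_0_iff_dvd)
  ultimately show ?thesis by (metis power2_eq_square mult_dvd_mono dvd_refl)
qed

lemma sum_coeff_power:
  fixes p :: "'a::comm_semiring_1 poly"
  assumes "degree p \<le> m"
  shows "(\<Sum>k\<le>m. coeff p k * y ^ (s + k)) = y ^ s * poly p y"
proof -
  have "(\<Sum>k\<le>m. coeff p k * y ^ (s + k)) = (\<Sum>k\<le>degree p. coeff p k * y ^ (s + k))"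
    using assms by (intro sum.mono_neutral_right) (auto simp: coeff_eq_0)
  then show ?thesis
    by (simp add: poly_altdef sum_distrib_left power_add algebra_simps)
qed

lemma sum_Suc_coeff_pderiv:
  fixes p :: "'a::{comm_semiring_1,semiring_no_zero_divisors} poly"
  assumes "m \<ge> 1"
  shows "(\<Sum>k<m. of_nat (Suc k) * coeff p (Suc k) * \<mu> k) = (\<Sum>k\<le>m-1. coeff (pderiv p) k * \<mu> k)"
  using assms by (intro sum.cong) (auto simp: coeff_pderiv)

lemma sum_coeff_pderiv_power:
  fixes p :: "'a::{comm_semiring_1,semiring_no_zero_divisors} poly"
  assumes "degree p \<le> m" "m \<ge> 1"
  shows "(\<Sum>k<m. of_nat (Suc k) * coeff p (Suc k) * y ^ (s + k)) = y ^ s * poly (pderiv p) y"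
proof -
  have "degree (pderiv p) \<le> m - 1" using assms(1) degree_pderiv_le[of p] by linarith
  then show ?thesis
    using sum_Suc_coeff_pderiv[OF assms(2), of p "\<lambda>k. y ^ (s + k)"] sum_coeff_power[of "pderiv p" "m - 1" y s]
    by simp
qed

lemma poly_map_poly_poly: "poly (map_poly (\<lambda>q. poly q x) p) y = poly (poly p [:y:]) x"
  by (induction p) (auto simp: map_poly_pCons)

lemma sum_coeff_deriv_power:
  fixes p :: "'a::field poly"
  assumes "degree p \<le> m"
  shows "(\<Sum>k\<le>m. coeff p k * (of_nat (s + k) * y ^ (s + k - 1))) = poly (pderiv (monom 1 s * p)) y"
proof -
  have "monom 1 s * p = (\<Sum>k\<le>m. monom (coeff p k) (s + k))"
    using poly_as_sum_of_monoms'[OF assms] by (metis (no_types, lifting) mult_1 mult_monom sum.cong sum_distrib_left)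
  then have "pderiv (monom 1 s * p) = (\<Sum>k\<le>m. pderiv (monom (coeff p k) (s + k)))"
    by (simp add: pderiv_sum)
  then show ?thesis
    by (simp add: poly_sum poly_monom pderiv_monom algebra_simps)
qed

text \<open>Common frame for the two sources of a double factor. Here \<open>v\<close> evaluates at
  \<open>y0\<close>, and \<open>L\<close> consists of the quotients \<open>a\<close> and
  \<open>g\<close> of \<open>p\<close> and its \<open>y\<close>-derivative at \<open>y0\<close> by
  \<open>x - x0\<close>; their values at \<open>x0\<close> are \<open>x\<close>-derivatives. The
  functional \<open>\<nu>\<close> supplies \<open>w\<close>, with \<open>\<nu> 0 = 0\<close> giving
  the zero entry opposite the 1 of \<open>v\<close>; \<open>row\<close> and \<open>row'\<close> are
  the kernel condition.\<close>

lemma sq_dvd_det_disc_matI: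
  fixes p :: "'a::field poly poly"
  assumes m: "m \<ge> 2" and deg: "degree p \<le> m"
    and p0: "poly (poly p [:y0:]) x0 = 0" "poly (poly (pderiv p) [:y0:]) x0 = 0"
    and \<nu>: "\<nu> 0 = 0" "\<nu> 1 \<noteq> 0 \<or> \<alpha> \<noteq> 0"
    and row: "\<And>s. (\<Sum>k\<le>m. coeff (map_poly (\<lambda>q. poly q x0) p) k * \<nu> (s + k))
        + \<alpha> * (y0 ^ s * poly (pderiv (poly p [:y0:])) x0) = 0"
    and row': "\<And>s. (\<Sum>k\<le>m-1. coeff (pderiv (map_poly (\<lambda>q. poly q x0) p)) k * \<nu> (s + k))
        + \<alpha> * (y0 ^ s * poly (pderiv (poly (pderiv p) [:y0:])) x0) = 0"
  shows "[:-x0, 1:]\<^sup>2 dvd Determinant.det (disc_mat m (coeff p))"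
proof -
  let ?n = "2*m-1" and ?t = "[:-x0, 1:]"
  define q where "q = map_poly (\<lambda>q. poly q x0) p"
  obtain a where a: "poly p [:y0:] = ?t * a" using p0(1) by (auto simp: poly_eq_0_iff_dvd elim: dvdE)
  obtain g where g: "poly (pderiv p) [:y0:] = ?t * g" using p0(2) by (auto simp: poly_eq_0_iff_dvd elim: dvdE)
  have ax: "poly (pderiv (poly p [:y0:])) x0 = poly a x0" and gx: "poly (pderiv (poly (pderiv p) [:y0:])) x0 = poly g x0"
    unfolding a g pderiv_mult by (simp_all add: pderiv_pCons)
  define L where "L = Matrix.vec ?n (\<lambda>i. if i < m - 1 then [:y0:] ^ (m - 2 - i) * a else [:y0:] ^ (2*m-2-i) * g)"
  define v where "v = disc_vec m (coeff p) (\<lambda>k. [:y0:] ^ k)"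
  define w where "w = disc_vec m (\<lambda>k. poly (coeff p k) x0) \<nu>"
  have q: "coeff q k = poly (coeff p k) x0" for k by (simp add: q_def coeff_map_poly)
  show ?thesis
  proof (rule pCons_dvd_sq_det[of _ ?n v "2*m-2" L x0 w \<alpha>])
    show "v $ (2*m-2) = 1" "w $ (2*m-2) = 0" using m \<nu> by (auto simp: v_def w_def disc_vec_def)
    show "v \<in> carrier_vec ?n" "w \<in> carrier_vec ?n" "L \<in> carrier_vec ?n"
      by (auto simp: v_def w_def disc_vec_def L_def)
    show "disc_mat m (coeff p) *\<^sub>v v = ?t \<cdot>\<^sub>v L"
      unfolding v_def L_def
        disc_mat_mult_vec'[OF m sum_coeff_power[OF deg] sum_coeff_pderiv_power[OF deg order.trans[OF one_le_numeral m]]]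
      by (intro eq_vecI) (auto simp: a g simp del: mult_pCons_left simp flip: mult.left_commute mult.assoc)
    \<comment> \<open>The column next to the last belongs to the power \<open>y^1\<close>, so
      \<open>\<nu> 1\<close> shows that \<open>w\<close> is nonzero.\<close>
    have "w $ (2*m-3) = \<nu> 1"
      using m by (auto simp: w_def disc_vec_def Suc_diff_le intro!: arg_cong[of _ _ \<nu>])
    moreover have "2*m - 3 < ?n" using m by simp
    ultimately show "w \<noteq> 0\<^sub>v ?n \<or> \<alpha> \<noteq> 0" using \<nu>(2) by (metis index_zero_vec(1))
    have "map_mat (\<lambda>p. poly p x0) (disc_mat m (coeff p)) = disc_mat m (coeff q)"
      by (intro eq_matI) (auto simp: disc_mat_def q)
    moreover have "disc_mat m (coeff q) *\<^sub>v w = Matrix.vec ?n (\<lambda>i. if i < m - 1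
        then - (\<alpha> * (y0 ^ (m - 2 - i) * poly a x0)) else - (\<alpha> * (y0 ^ (2*m - 2 - i) * poly g x0)))"
      unfolding w_def q[symmetric]
      by (rule disc_mat_mult_vec'[OF m])
         (use row row' m sum_Suc_coeff_pderiv[of m q] in
           \<open>auto simp: q_def[symmetric] ax gx eq_neg_iff_add_eq_0 simp del: of_nat_Suc\<close>)
    ultimately show "map_mat (\<lambda>p. poly p x0) (disc_mat m (coeff p)) *\<^sub>v w + \<alpha> \<cdot>\<^sub>v map_vec (\<lambda>p. poly p x0) L = 0\<^sub>v ?n"
      by (intro eq_vecI) (auto simp: L_def disc_mat_def)
  qed (use m disc_mat_carrier in auto)
qed

text \<open>The second functional is a multiple of differentiation at \<open>y0\<close>. It
  annihilates \<open>y^s q\<close> because \<open>y0\<close> is a double root of \<open>q\<close>,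
  and sends \<open>y^s q'\<close> to a multiple of the second derivative \<open>h\<close>.\<close>

lemma sq_dvd_det_disc_mat_singular:
  fixes p :: "'a::field poly poly"
  assumes m: "m \<ge> 2" and deg: "degree p \<le> m"
    and p0: "poly (poly p [:y0:]) x0 = 0" "poly (poly (pderiv p) [:y0:]) x0 = 0"
    and sing: "poly (pderiv (poly p [:y0:])) x0 = 0 \<or> poly (poly (pderiv (pderiv p)) [:y0:]) x0 = 0"
  shows "[:-x0, 1:]\<^sup>2 dvd Determinant.det (disc_mat m (coeff p))"
proof -
  have hom: "idom_hom (\<lambda>p. poly p x0)" by unfold_locales auto
  define q where "q = map_poly (\<lambda>q. poly q x0) p"
  define h where "h = poly (poly (pderiv (pderiv p)) [:y0:]) x0"
  define g where "g = poly (pderiv (poly (pderiv p) [:y0:])) x0"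
  \<comment> \<open>For \<open>h = 0\<close> differentiation alone is in the kernel, with
    \<open>\<alpha> = 0\<close>. Otherwise \<open>sing\<close> forces the
    \<open>x\<close>-derivative of \<open>p\<close> to vanish, and the weights \<open>- g\<close>
    and \<open>\<alpha> = h\<close> cancel the mixed derivative \<open>g\<close> in the lower
    rows.\<close>
  define \<beta> where "\<beta> = (if h = 0 then 1 else - g)"
  have pq: "pderiv q = map_poly (\<lambda>q. poly q x0) (pderiv p)"
    "pderiv (pderiv q) = map_poly (\<lambda>q. poly q x0) (pderiv (pderiv p))"
    by (simp_all add: q_def idom_hom.map_poly_pderiv[OF hom])
  have q0: "poly q y0 = 0" "poly (pderiv q) y0 = 0" "poly (pderiv (pderiv q)) y0 = h"
    using p0 unfolding h_def pq(2) unfolding pq(1) by (simp_all add: q_def poly_map_poly_poly)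
  have dq: "degree q \<le> m" using deg degree_map_poly_le[of "\<lambda>q. poly q x0" p] by (simp add: q_def)
  have dq': "degree (pderiv q) \<le> m - 1" using dq degree_pderiv_le[of q] by linarith
  show ?thesis
  proof (rule sq_dvd_det_disc_matI[OF m deg p0, of "\<lambda>k. \<beta> * (of_nat k * y0 ^ (k - 1))" h])
    fix s
    have "(\<Sum>k\<le>m. coeff q k * (\<beta> * (of_nat (s + k) * y0 ^ (s + k - 1)))) = \<beta> * poly (pderiv (monom 1 s * q)) y0"
      unfolding sum_coeff_deriv_power[OF dq, symmetric] sum_distrib_left by (simp add: algebra_simps)
    also have "\<dots> = 0" by (simp add: pderiv_mult q0)
    finally show "(\<Sum>k\<le>m. coeff (map_poly (\<lambda>q. poly q x0) p) k * (\<beta> * (of_nat (s + k) * y0 ^ (s + k - 1)))) +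
         h * (y0 ^ s * poly (pderiv (poly p [:y0:])) x0) = 0"
      using sing by (auto simp: q_def h_def)
    have "(\<Sum>k\<le>m-1. coeff (pderiv q) k * (\<beta> * (of_nat (s + k) * y0 ^ (s + k - 1)))) = \<beta> * poly (pderiv (monom 1 s * pderiv q)) y0"
      unfolding sum_coeff_deriv_power[OF dq', symmetric] sum_distrib_left by (simp add: algebra_simps)
    also have "\<dots> = \<beta> * (y0 ^ s * h)" by (simp add: pderiv_mult q0 poly_monom)
    finally show "(\<Sum>k\<le>m-1. coeff (pderiv (map_poly (\<lambda>q. poly q x0) p)) k * (\<beta> * (of_nat (s + k) * y0 ^ (s + k - 1)))) +
         h * (y0 ^ s * poly (pderiv (poly (pderiv p) [:y0:])) x0) = 0"
      by (auto simp: q_def \<beta>_def g_def)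
  qed (auto simp: \<beta>_def)
qed

text \<open>Evaluation at either double root annihilates all rows at \<open>x0\<close>. Their
  difference serves as \<open>\<nu>\<close> with \<open>\<alpha> = 0\<close>: it vanishes on
  constants, and \<open>\<nu> 1 = y1 - y0\<close> is nonzero.\<close>

lemma sq_dvd_det_disc_mat_two_double_roots:
  fixes p :: "'a::field poly poly"
  assumes m: "m \<ge> 2" and deg: "degree p \<le> m"
    and p0: "poly (poly p [:y0:]) x0 = 0" "poly (poly (pderiv p) [:y0:]) x0 = 0"
    and p1: "poly (poly p [:y1:]) x0 = 0" "poly (poly (pderiv p) [:y1:]) x0 = 0"
    and ne: "y0 \<noteq> y1"
  shows "[:-x0, 1:]\<^sup>2 dvd Determinant.det (disc_mat m (coeff p))"
proof -
  have hom: "idom_hom (\<lambda>p. poly p x0)" by unfold_locales auto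
  define q where "q = map_poly (\<lambda>q. poly q x0) p"
  have q0: "poly q y0 = 0" "poly (pderiv q) y0 = 0" "poly q y1 = 0" "poly (pderiv q) y1 = 0"
    using p0 p1 by (simp_all add: q_def idom_hom.map_poly_pderiv[OF hom, symmetric] poly_map_poly_poly)
  have dq: "degree q \<le> m" using deg degree_map_poly_le[of "\<lambda>q. poly q x0" p] by (simp add: q_def)
  have dq': "degree (pderiv q) \<le> m - 1" using dq degree_pderiv_le[of q] by linarith
  show ?thesis
    by (rule sq_dvd_det_disc_matI[OF m deg p0, of "\<lambda>k. y1 ^ k - y0 ^ k" 0])
       (use ne q0 in \<open>auto simp: right_diff_distrib sum_subtractf sum_coeff_power[OF dq] sum_coeff_power[OF dq', simplified] q_def[symmetric]\<close>)
qed

lemma det_disc_mat_double_root: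
  fixes p :: "'a::field poly"
  assumes m: "m \<ge> 2" and deg: "degree p \<le> m" and p0: "poly p y0 = 0" "poly (pderiv p) y0 = 0"
  shows "Determinant.det (disc_mat m (coeff p)) = 0"
proof -
  let ?v = "disc_vec m (coeff p) (\<lambda>k. y0 ^ k)"
  \<comment> \<open>This entry is \<open>y0 ^ 0 = 1\<close>.\<close>
  have "?v $ (2*m-2) \<noteq> 0" "2*m-2 < 2*m-1" using m by (auto simp: disc_vec_def)
  then have "?v \<noteq> 0\<^sub>v (2*m-1)" by (metis index_zero_vec(1))
  moreover have "disc_mat m (coeff p) *\<^sub>v ?v = 0\<^sub>v (2*m-1)"
    unfolding disc_mat_mult_vec'[OF m sum_coeff_power[OF deg] sum_coeff_pderiv_power[OF deg order.trans[OF one_le_numeral m]]]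
    by (intro eq_vecI) (auto simp: p0)
  ultimately show ?thesis
    using det_0_iff_vec_prod_zero[OF disc_mat_carrier] disc_vec_carrier by blast
qed

section \<open>Specialization of a family\<close>

text \<open>The target field stays generic: real values describe the zero set in
  \<open>\<Omega>\<close>, complex ones enter the covering argument.\<close>

definition specialize :: "real \<Rightarrow> real poly poly \<Rightarrow> 'a::real_normed_field poly" where
  "specialize b = map_poly (\<lambda>c. of_real (poly c b))"

lemma coeff_specialize: "coeff (specialize b q) k = of_real (poly (coeff q k) b)"
  by (simp add: specialize_def coeff_map_poly)

lemma comm_ring_hom_specialize: "comm_ring_hom (specialize b :: _ \<Rightarrow> 'a::real_normed_field poly)"
proof -
  have "comm_ring_hom (\<lambda>c. of_real (poly c b) :: 'a)" by unfold_locales auto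
  then interpret map_poly_comm_ring_hom "\<lambda>c. of_real (poly c b) :: 'a"
    by (simp add: map_poly_comm_ring_hom_def)
  show ?thesis unfolding specialize_def ..
qed

lemma idom_hom_specialize: "idom_hom (specialize b :: _ \<Rightarrow> 'a::real_normed_field poly)"
  using comm_ring_hom_specialize by (simp add: idom_hom_def)

lemma idom_hom_poly_specialize: "idom_hom (\<lambda>q. poly (specialize b q) x :: 'a::real_normed_field)"
proof -
  interpret comm_ring_hom "specialize b :: _ \<Rightarrow> 'a poly" by (rule comm_ring_hom_specialize)
  show ?thesis by unfold_locales (auto simp: hom_distribs)
qed

definition value_at :: "real poly poly poly \<Rightarrow> real \<Rightarrow> 'a::real_normed_field \<Rightarrow> 'a \<Rightarrow> 'a" where
  "value_at F b x y = poly (poly (map_poly (specialize b) F) [:y:]) x"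

definition fibre :: "real poly poly poly \<Rightarrow> real \<Rightarrow> 'a::real_normed_field \<Rightarrow> 'a poly" where
  "fibre F b x = map_poly (\<lambda>q. poly (specialize b q) x) F"

lemma coeff_fibre: "coeff (fibre F b x) k = poly (specialize b (coeff F k)) x"
  using idom_hom_poly_specialize[of b x] by (simp add: fibre_def coeff_map_poly specialize_def)

lemma degree_fibre: "degree (fibre F b x) \<le> degree F"
  by (simp add: fibre_def degree_map_poly_le)

lemma specialize_0 [simp]: "specialize b 0 = 0" by (simp add: specialize_def)

lemma value_at_fibre: "value_at F b x y = poly (fibre F b x) y"
proof -
  have "fibre F b x = map_poly (\<lambda>q. poly q x) (map_poly (specialize b) F)"
    by (intro poly_eqI) (simp add: coeff_fibre coeff_map_poly)
  then show ?thesis by (simp add: value_at_def poly_map_poly_poly)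
qed

lemma fibre_pderiv: "fibre (pderiv F) b x = pderiv (fibre F b x)"
  unfolding fibre_def by (rule idom_hom.map_poly_pderiv[OF idom_hom_poly_specialize])

lemma value_at_sum: "value_at F b x y = (\<Sum>j\<le>degree F. poly (specialize b (coeff F j)) x * y ^ j)"
proof -
  have "poly (fibre F b x) y = (\<Sum>j\<le>degree F. coeff (fibre F b x) j * y ^ j)"
    unfolding poly_altdef by (intro sum.mono_neutral_left) (auto simp: degree_fibre coeff_eq_0)
  then show ?thesis by (simp add: value_at_fibre coeff_fibre)
qed

lemma poly_specialize_sum: "poly (specialize b q :: 'a::real_normed_field poly) x = (\<Sum>i\<le>degree q. of_real (poly (coeff q i) b) * x ^ i)"
proof -
  have "degree (specialize b q :: 'a poly) \<le> degree q" by (simp add: specialize_def degree_map_poly_le)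
  then have "poly (specialize b q) x = (\<Sum>j\<le>degree q. coeff (specialize b q) j * x ^ j)"
    unfolding poly_altdef by (intro sum.mono_neutral_left) (auto simp: coeff_eq_0)
  then show ?thesis by (simp add: coeff_specialize)
qed

lemma continuous_on_poly_specialize [continuous_intros]:
  assumes "continuous_on S f" "continuous_on S g"
  shows "continuous_on S (\<lambda>s. poly (specialize (f s) q) (g s))"
  unfolding poly_specialize_sum by (intro continuous_intros assms)

lemma continuous_on_value_at [continuous_intros]:
  assumes "continuous_on S f" "continuous_on S g" "continuous_on S h"
  shows "continuous_on S (\<lambda>s. value_at F (f s) (g s) (h s))"
  unfolding value_at_sum by (intro continuous_intros assms)

lemma tendsto_poly_specialize [tendsto_intros]:
  assumes "(f \<longlongrightarrow> b) A" "(g \<longlongrightarrow> x) A"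
  shows "((\<lambda>s. poly (specialize (f s) q) (g s)) \<longlongrightarrow> poly (specialize b q) x) A"
  unfolding poly_specialize_sum by (intro tendsto_intros assms)

lemma tendsto_value_at [tendsto_intros]:
  assumes "(f \<longlongrightarrow> b) A" "(g \<longlongrightarrow> x) A" "(h \<longlongrightarrow> y) A"
  shows "((\<lambda>s. value_at F (f s) (g s) (h s)) \<longlongrightarrow> value_at F b x y) A"
  unfolding value_at_sum by (intro tendsto_intros assms)

lemma specialize_pderiv: "specialize b (pderiv q) = pderiv (specialize b q)"
proof -
  have "idom_hom (\<lambda>c. of_real (poly c b) :: 'a)" by unfold_locales auto
  then show "specialize b (pderiv q) = (pderiv (specialize b q) :: 'a poly)"
    unfolding specialize_def by (rule idom_hom.map_poly_pderiv)
qed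

definition pderiv_x :: "real poly poly poly \<Rightarrow> real poly poly poly" where
  "pderiv_x F = map_poly pderiv F"

lemma value_at_pderiv_x: "value_at (pderiv_x F) b x y = poly (pderiv (poly (map_poly (specialize b) F) [:y:])) x"
proof -
  have "poly (map_poly (specialize b) F) [:y:] = (\<Sum>j\<le>degree F. specialize b (coeff F j) * [:y:] ^ j)"
    unfolding poly_altdef
    by (intro sum.mono_neutral_cong_left) (auto simp: degree_map_poly_le coeff_map_poly intro!: le_degree)
  moreover have "pderiv ([:y:] ^ j) = 0" for j by (simp add: poly_const_pow)
  moreover have "value_at (pderiv_x F) b x y = (\<Sum>j\<le>degree F. poly (specialize b (coeff (pderiv_x F) j)) x * y ^ j)"
    unfolding value_at_sum by (intro sum.mono_neutral_cong_left) (auto simp: degree_map_poly_le pderiv_x_def coeff_eq_0 coeff_map_poly)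
  ultimately show ?thesis
    by (simp add: pderiv_sum poly_sum pderiv_mult pderiv_x_def coeff_map_poly specialize_pderiv mult.commute)
qed

lemma DERIV_value_at_y [derivative_intros]: "((\<lambda>y. value_at F b x y) has_field_derivative value_at (pderiv F) b x y) (at y within S)"
  unfolding value_at_fibre fibre_pderiv by (rule DERIV_subset[OF poly_DERIV]) auto

lemma DERIV_value_at_x: "((\<lambda>x. value_at F b x y) has_field_derivative value_at (pderiv_x F) b x y) (at x within S)"
  unfolding value_at_pderiv_x unfolding value_at_def by (rule DERIV_subset[OF poly_DERIV]) auto

lemma eval2_family_at: "eval2 (family_at F b) x y = value_at F b x y"
  by (simp add: eval2_def value_at_def family_at_def specialize_def)

section \<open>Roots of the discriminant of a member and their multiplicity\<close>

lemma specialize_discriminant: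
  assumes "degree F \<ge> 2"
  shows "(specialize b (discriminant F) :: 'a::real_normed_field poly) = (-1) ^ (degree F * (degree F - 1) div 2) *
    Determinant.det (disc_mat (degree F) (coeff (map_poly (specialize b) F)))"
proof -
  have "coeff (map_poly (specialize b :: _ \<Rightarrow> 'a poly) F) = (\<lambda>k. specialize b (coeff F k))" by (auto simp: coeff_map_poly)
  then show ?thesis using hom_discriminant[OF comm_ring_hom_specialize assms] by simp
qed

lemma discriminant_zero_double_root:
  fixes x y :: "'a::real_normed_field"
  assumes m: "degree F \<ge> 2" and "value_at F b x y = 0" "value_at (pderiv F) b x y = 0"
  shows "poly (specialize b (discriminant F)) x = 0"
proof -
  interpret idom_hom "\<lambda>q. poly (specialize b q) x" by (rule idom_hom_poly_specialize)
  show ?thesis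
    using hom_discriminant[OF comm_ring_hom_axioms m] det_disc_mat_double_root[OF m degree_fibre, of b x y] assms
    by (simp add: value_at_fibre fibre_pderiv coeff_fibre[symmetric])
qed

lemma discriminant_zero_infinity:
  fixes x :: "'a::real_normed_field"
  assumes m: "degree F \<ge> 2" and "poly (specialize b (coeff F (degree F))) x = 0" "poly (specialize b (coeff F (degree F - 1))) x = 0"
  shows "poly (specialize b (discriminant F)) x = 0"
proof -
  interpret idom_hom "\<lambda>q. poly (specialize b q) x" by (rule idom_hom_poly_specialize)
  show ?thesis
    using hom_discriminant[OF comm_ring_hom_axioms m] det_disc_mat_infinity[OF m] assms by simp
qed

lemma value_at_as_poly_pderiv:
  "value_at (pderiv F) b x y = poly (poly (pderiv (map_poly (specialize b) F)) [:y:]) x"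
  by (simp add: value_at_def idom_hom.map_poly_pderiv[OF idom_hom_specialize])

text \<open>Used contrapositively: over a root of the discriminant that is not multiple, a vertical
  tangency is a nondegenerate fold.\<close>

lemma discriminant_sq_dvd_singular:
  fixes x y :: "'a::real_normed_field"
  assumes m: "degree F \<ge> 2" and "value_at F b x y = 0" "value_at (pderiv F) b x y = 0"
    and "value_at (pderiv_x F) b x y = 0 \<or> value_at (pderiv (pderiv F)) b x y = 0"
  shows "[:-x, 1:]\<^sup>2 dvd specialize b (discriminant F)"
  unfolding specialize_discriminant[OF m]
  by (intro dvd_mult sq_dvd_det_disc_mat_singular[of _ _ y])
     (use assms in \<open>auto simp: value_at_as_poly_pderiv value_at_pderiv_x degree_map_poly_le idom_hom.map_poly_pderiv[OF idom_hom_specialize] simp flip: value_at_def\<close>)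

lemma discriminant_sq_dvd_two_double_roots:
  fixes x y y' :: "'a::real_normed_field"
  assumes m: "degree F \<ge> 2" and "value_at F b x y = 0" "value_at (pderiv F) b x y = 0"
    "value_at F b x y' = 0" "value_at (pderiv F) b x y' = 0" "y \<noteq> y'"
  shows "[:-x, 1:]\<^sup>2 dvd specialize b (discriminant F)"
  unfolding specialize_discriminant[OF m]
  by (intro dvd_mult sq_dvd_det_disc_mat_two_double_roots[of _ _ y _ y'])
     (use assms in \<open>auto simp: value_at_as_poly_pderiv degree_map_poly_le simp flip: value_at_def\<close>)

text \<open>The second level, with \<open>D\<close> in place of a member. A nonzero double
  discriminant at \<open>b\<close> thus excludes double real roots of \<open>specialize b D\<close>,
  and in particular excludes the zero polynomial.\<close>

lemma discriminant2_zero_double_root: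
  fixes D :: "real poly poly" and x :: real
  assumes n: "degree D \<ge> 2" and "poly (specialize b D) x = 0" "poly (pderiv (specialize b D)) x = 0"
  shows "poly (discriminant D) b = 0"
proof -
  have hom: "comm_ring_hom (\<lambda>c. poly c b)" by unfold_locales auto
  have "degree (specialize b D :: real poly) \<le> degree D" by (simp add: specialize_def degree_map_poly_le)
  from det_disc_mat_double_root[OF n this assms(2,3)]
  moreover have "coeff (specialize b D) = (\<lambda>k. poly (coeff D k) b)" by (auto simp: coeff_specialize)
  ultimately show ?thesis using hom_discriminant[OF hom n] by simp
qed

lemma discriminant2_zero_infinity:
  fixes D :: "real poly poly"
  assumes n: "degree D \<ge> 2" and "poly (coeff D (degree D)) b = 0" "poly (coeff D (degree D - 1)) b = 0"
  shows "poly (discriminant D) b = 0"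
proof -
  have hom: "comm_ring_hom (\<lambda>c. poly c b)" by unfold_locales auto
  show ?thesis
    using hom_discriminant[OF hom n] det_disc_mat_infinity[OF n] assms by simp
qed

lemma sq_dvd_imp_double_root:
  fixes p :: "'a::field poly"
  assumes "[:-x, 1:]\<^sup>2 dvd p" shows "poly p x = 0" "poly (pderiv p) x = 0"
proof -
  obtain q where "p = [:-x, 1:]\<^sup>2 * q" using assms by (elim dvdE)
  then show "poly p x = 0" "poly (pderiv p) x = 0"
    by (simp_all only: power2_eq_square pderiv_mult poly_mult poly_add) simp_all
qed

section \<open>Zero sets of the members\<close>

text \<open>The affine content of the hypotheses: \<open>zero_in_closure\<close> comes from (iv),
  \<open>compact_zeros\<close> from (iv) together with isolation at infinity. Both are invariant
  under exchange of the variables, which makes the symmetric use of the two discriminants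
  possible.\<close>

locale curve_family =
  fixes F :: "real poly poly poly" and \<Omega> :: "(real \<times> real) set" and I :: "real set"
  assumes open_Omega: "open \<Omega>"
    and zero_in_closure: "\<And>b x y. b \<in> I \<Longrightarrow> (x, y) \<in> closure \<Omega> \<Longrightarrow> value_at F b x y = 0 \<Longrightarrow> (x, y) \<in> \<Omega>"
    and compact_zeros: "\<And>b. b \<in> I \<Longrightarrow> compact {(x, y) \<in> \<Omega>. value_at F b x y = 0}"
begin

abbreviation "D \<equiv> discriminant F"

definition Z :: "real \<Rightarrow> (real \<times> real) set" where
  "Z b = {(x, y) \<in> \<Omega>. value_at F b x y = 0}"

lemma Z_iff: "(x, y) \<in> Z b \<longleftrightarrow> (x, y) \<in> \<Omega> \<and> value_at F b x y = 0"
  by (simp add: Z_def)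

lemma compact_Z: "b \<in> I \<Longrightarrow> compact (Z b)"
  unfolding Z_def by (rule compact_zeros)

text \<open>If the member vanished on the whole vertical line, the slice of \<open>\<Omega>\<close>
  would equal the slice of its closure. Being clopen and nonempty it would be the full line, against
  compactness of \<open>Z b\<close>.\<close>

lemma no_vertical_line:
  assumes b: "b \<in> I" and xy: "(x, y0) \<in> \<Omega>"
  shows "\<exists>y. value_at F b x y \<noteq> 0"
proof (rule ccontr)
  assume "\<not> ?thesis"
  then have 0: "value_at F b x y = 0" for y by simp
  let ?A = "Pair x -` \<Omega>"
  have "open ?A" by (intro open_vimage open_Omega continuous_intros)
  moreover have "?A = Pair x -` closure \<Omega>"
    using zero_in_closure[OF b _ 0] closure_subset by blast
  then have "closed ?A"
    by (simp only:) (intro closed_vimage closed_closure continuous_intros)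
  ultimately have "?A = UNIV" using xy clopen[of ?A] by auto
  then have "(x, y) \<in> Z b" for y using 0 by (auto simp: Z_iff)
  moreover obtain B where "\<And>p. p \<in> Z b \<Longrightarrow> norm p \<le> B"
    using compact_imp_bounded[OF compact_Z[OF b]] by (auto simp: bounded_iff)
  ultimately have "norm (x, \<bar>B\<bar> + 1) \<le> B" by blast
  moreover have "\<bar>B\<bar> + 1 \<le> norm (x, \<bar>B\<bar> + 1)" using norm_snd_le[of "\<bar>B\<bar> + 1" x] by simp
  ultimately show False by linarith
qed

lemma fibre_nonzero: "b \<in> I \<Longrightarrow> (x, y) \<in> \<Omega> \<Longrightarrow> fibre F b x \<noteq> 0"
  using no_vertical_line[of b x y] by (auto simp: value_at_fibre)

section \<open>Local structure of the zero set\<close>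

lemma box_in_Omega:
  assumes "(x0, y0) \<in> \<Omega>"
  obtains r where "r > 0" "\<And>x y. \<bar>x - x0\<bar> < r \<Longrightarrow> \<bar>y - y0\<bar> < r \<Longrightarrow> (x, y) \<in> \<Omega>"
proof -
  obtain A B where "open A" "open B" "(x0, y0) \<in> A \<times> B" "A \<times> B \<subseteq> \<Omega>"
    using open_Omega assms by (rule open_prod_elim)
  then obtain r1 r2 where "r1 > 0" "r2 > 0" "ball x0 r1 \<subseteq> A" "ball y0 r2 \<subseteq> B"
    using openE[of A x0] openE[of B y0] by (metis mem_Sigma_iff)
  with \<open>A \<times> B \<subseteq> \<Omega>\<close> show thesis
    by (intro that[of "min r1 r2"]) (auto simp: subset_iff dist_real_def abs_minus_commute)
qed

text \<open>A nonzero \<open>y\<close>-derivative gives opposite signs at \<open>y0 - h\<close> and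
  \<open>y0 + h\<close>. The signs persist for nearby \<open>x\<close>, and the intermediate value
  theorem yields a zero between.\<close>

lemma simple_zero_persists:
  assumes xy: "(x0, y0) \<in> \<Omega>" and 0: "value_at F b x0 y0 = 0" and dy: "value_at (pderiv F) b x0 y0 \<noteq> 0" and "\<eta> > 0"
  shows "\<forall>\<^sub>F x in at x0. \<exists>y. \<bar>y - y0\<bar> < \<eta> \<and> (x, y) \<in> Z b"
proof -
  obtain r where r: "r > 0" "\<And>x y. \<bar>x - x0\<bar> < r \<Longrightarrow> \<bar>y - y0\<bar> < r \<Longrightarrow> (x, y) \<in> \<Omega>"
    using box_in_Omega[OF xy] by blast
  define s where "s = sgn (value_at (pderiv F) b x0 y0)"
  have der: "((\<lambda>y. s * value_at F b x0 y) has_field_derivative s * value_at (pderiv F) b x0 y0) (at y0)"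
    by (intro DERIV_cmult DERIV_value_at_y)
  have pos: "s * value_at (pderiv F) b x0 y0 > 0" using dy by (simp add: s_def sgn_real_def)
  obtain d1 where d1: "d1 > 0" "\<And>h. 0 < h \<Longrightarrow> h < d1 \<Longrightarrow> s * value_at F b x0 y0 < s * value_at F b x0 (y0 + h)"
    using DERIV_pos_inc_right[OF der pos] by auto
  obtain d2 where d2: "d2 > 0" "\<And>h. 0 < h \<Longrightarrow> h < d2 \<Longrightarrow> s * value_at F b x0 (y0 - h) < s * value_at F b x0 y0"
    using DERIV_pos_inc_left[OF der pos] by auto
  define h where "h = min (min d1 d2) (min r \<eta>) / 2"
  have h: "0 < h" "h < d1" "h < d2" "h < r" "h < \<eta>"
    using d1(1) d2(1) r(1) \<open>\<eta> > 0\<close> by (auto simp: h_def min_def)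
  have "\<forall>\<^sub>F x in at x0. s * value_at F b x (y0 + h) > 0"
    by (rule order_tendstoD(1)[of _ "s * value_at F b x0 (y0 + h)"]) (use d1(2)[OF h(1,2)] 0 in \<open>auto intro!: tendsto_intros\<close>)
  moreover have "\<forall>\<^sub>F x in at x0. s * value_at F b x (y0 - h) < 0"
    by (rule order_tendstoD(2)[of _ "s * value_at F b x0 (y0 - h)"]) (use d2(2)[OF h(1,3)] 0 in \<open>auto intro!: tendsto_intros\<close>)
  moreover have "\<forall>\<^sub>F x in at x0. \<bar>x - x0\<bar> < r"
    using r(1) by (auto simp: eventually_at dist_real_def)
  ultimately show ?thesis
  proof eventually_elim
    case (elim x)
    have "\<exists>y\<ge>y0 - h. y \<le> y0 + h \<and> s * value_at F b x y = 0"
      by (rule IVT') (use elim h in \<open>auto intro!: continuous_intros\<close>)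
    then obtain y where y: "y0 - h \<le> y" "y \<le> y0 + h" "value_at F b x y = 0"
      using dy by (auto simp: s_def sgn_real_def split: if_splits)
    then have "\<bar>y - y0\<bar> \<le> h" by linarith
    with y show ?case using r(2)[OF elim(3), of y] h by (intro exI[of _ y]) (auto simp: Z_iff)
  qed
qed

lemma critical_point_discriminant:
  assumes b: "b \<in> I" and xy: "(x, y) \<in> Z b" and dy: "value_at (pderiv F) b x y = 0"
  shows "degree F \<ge> 2" "poly (specialize b D) x = 0"
proof -
  show "degree F \<ge> 2"
  \<comment> \<open>A fibre of degree at most 1 with a double root is zero, which would be a
    vertical line of zeros.\<close>
  proof (rule ccontr)
    assume "\<not> ?thesis"
    then have "degree (fibre F b x) \<le> 1" using degree_fibre[of F b x] by linarith
    then have "fibre F b x = [:coeff (fibre F b x) 0, coeff (fibre F b x) 1:]"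
      by (intro poly_eqI) (auto simp: coeff_pCons coeff_eq_0 split: nat.split)
    then obtain a c where ac: "fibre F b x = [:a, c:]" by blast
    have "fibre F b x = 0" using xy dy by (auto simp: Z_iff value_at_fibre fibre_pderiv ac pderiv_pCons)
    then show False using fibre_nonzero[OF b] xy by (auto simp: Z_iff)
  qed
  then show "poly (specialize b D) x = 0"
    using discriminant_zero_double_root xy dy by (auto simp: Z_iff)
qed

text \<open>A simple zero continues to both sides of \<open>x0\<close>. The sign \<open>s\<close>
  treats rightmost and leftmost points together.\<close>

lemma x_extremal_critical:
  assumes xy: "(x0, y0) \<in> Z b" and s: "s = 1 \<or> s = -1" and max: "\<And>x y. (x, y) \<in> Z b \<Longrightarrow> s * x \<le> s * x0"
  shows "value_at (pderiv F) b x0 y0 = 0"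
proof (rule ccontr)
  assume dy: "value_at (pderiv F) b x0 y0 \<noteq> 0"
  have "\<forall>\<^sub>F x in at x0. \<exists>y. \<bar>y - y0\<bar> < 1 \<and> (x, y) \<in> Z b"
    using simple_zero_persists[OF _ _ dy, of 1] xy by (auto simp: Z_iff)
  then obtain d where d: "d > 0" "\<And>x. x \<noteq> x0 \<Longrightarrow> \<bar>x - x0\<bar> < d \<Longrightarrow> \<exists>y. (x, y) \<in> Z b"
    unfolding eventually_at dist_real_def by blast
  obtain y where "(x0 + s * (d/2), y) \<in> Z b" using d(1) d(2)[of "x0 + s * (d/2)"] s by auto
  from max[OF this] show False using s d(1) by auto
qed

text \<open>Locally the curve looks like a parabola with vertical tangent. After normalizing by the
  sign \<open>\<sigma>\<close> of the second \<open>y\<close>-derivative, the values at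
  \<open>y0 + h\<close> and \<open>y0 - h\<close> are positive, while on one side of
  \<open>x0\<close> the value at \<open>y0\<close> turns negative; this yields one zero above and
  one below.\<close>

lemma fold_point:
  assumes xy: "(x0, y0) \<in> Z b" and dy: "value_at (pderiv F) b x0 y0 = 0"
    and dyy: "value_at (pderiv (pderiv F)) b x0 y0 \<noteq> 0" and dx: "value_at (pderiv_x F) b x0 y0 \<noteq> 0"
  shows "\<exists>s\<in>{1, -1}. \<forall>\<^sub>F t in at_right 0. \<exists>y1 y2. y1 \<noteq> y2 \<and> (x0 + s * t, y1) \<in> Z b \<and> (x0 + s * t, y2) \<in> Z b"
proof -
  have 0: "value_at F b x0 y0 = 0" using xy by (simp add: Z_iff)
  obtain r where r: "r > 0" "\<And>x y. \<bar>x - x0\<bar> < r \<Longrightarrow> \<bar>y - y0\<bar> < r \<Longrightarrow> (x, y) \<in> \<Omega>"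
    using box_in_Omega[of x0 y0] xy by (auto simp: Z_iff)
  define \<sigma> where "\<sigma> = sgn (value_at (pderiv (pderiv F)) b x0 y0)"
  have \<sigma>: "\<sigma> = 1 \<or> \<sigma> = -1" using dyy by (auto simp: \<sigma>_def sgn_real_def)
  \<comment> \<open>The side of \<open>x0\<close> on which the \<open>x\<close>-derivative makes
    \<open>\<sigma> * value_at F b x y0\<close> negative.\<close>
  define s where "s = - sgn (\<sigma> * value_at (pderiv_x F) b x0 y0)"
  have s: "s = 1 \<or> s = -1" using dx \<sigma> by (auto simp: s_def sgn_real_def)
  let ?p = "fibre F b x0"
  obtain q where q: "?p = [:-y0, 1:] * q" using 0 by (auto simp: value_at_fibre poly_eq_0_iff_dvd elim: dvdE)
  have "poly q y0 = 0" using dy by (simp add: value_at_fibre fibre_pderiv q pderiv_mult pderiv_pCons del: mult_pCons_left)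
  then obtain u where u: "q = [:-y0, 1:] * u" by (auto simp: poly_eq_0_iff_dvd elim: dvdE)
  have "\<sigma> * (2 * poly u y0) > 0" using dyy
    by (simp add: \<sigma>_def value_at_fibre fibre_pderiv q u pderiv_mult pderiv_pCons pderiv_add sgn_real_def del: mult_pCons_left split: if_splits)
  then have "\<forall>\<^sub>F y in at y0. \<sigma> * poly u y > 0"
    by (intro order_tendstoD(1)[of _ "\<sigma> * poly u y0"] tendsto_intros) (auto simp: isCont_def[symmetric])
  then obtain d where d: "d > 0" "\<And>y. y \<noteq> y0 \<Longrightarrow> \<bar>y - y0\<bar> < d \<Longrightarrow> \<sigma> * poly u y > 0"
    unfolding eventually_at dist_real_def by blast
  define h where "h = min d r / 2"
  have h: "0 < h" "h < d" "h < r" using d r by (auto simp: h_def min_def)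
  have pos: "\<sigma> * value_at F b x0 (y0 + h) > 0" "\<sigma> * value_at F b x0 (y0 - h) > 0"
    using d(2)[of "y0 + h"] d(2)[of "y0 - h"] h
    by (auto simp: value_at_fibre q u mult.left_commute[of \<sigma>] zero_less_mult_iff simp del: mult_pCons_left)
  have lim: "((\<lambda>t. \<sigma> * value_at F b (x0 + s * t) y) \<longlongrightarrow> \<sigma> * value_at F b x0 y) (at_right 0)" for y
    by (rule tendsto_eq_intros refl | simp)+
  have "\<forall>\<^sub>F t in at_right 0. \<sigma> * value_at F b (x0 + s * t) (y0 + h) > 0" "\<forall>\<^sub>F t in at_right 0. \<sigma> * value_at F b (x0 + s * t) (y0 - h) > 0"
    using order_tendstoD(1)[OF lim pos(1)] order_tendstoD(1)[OF lim pos(2)] by auto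
  moreover have "\<forall>\<^sub>F t in at_right 0. \<sigma> * value_at F b (x0 + s * t) y0 < 0"
  proof -
    have der: "((\<lambda>t. \<sigma> * value_at F b (x0 + s * t) y0) has_field_derivative \<sigma> * (value_at (pderiv_x F) b (x0 + s * 0) y0 * s)) (at 0)"
      by (intro DERIV_cmult DERIV_chain2[OF DERIV_value_at_x]) (auto intro!: derivative_eq_intros)
    have neg: "\<sigma> * (value_at (pderiv_x F) b (x0 + s * 0) y0 * s) < 0"
      using dx \<sigma> by (auto simp: s_def sgn_real_def)
    obtain e where "e > 0" "\<And>t. 0 < t \<Longrightarrow> t < e \<Longrightarrow> \<sigma> * value_at F b (x0 + s * (0 + t)) y0 < \<sigma> * value_at F b (x0 + s * 0) y0"
      using DERIV_neg_dec_right[OF der neg] by auto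
    then show ?thesis using 0 by (auto simp: eventually_at_right_field)
  qed
  moreover have "\<forall>\<^sub>F t in at_right 0. t < r" using r(1) by (auto simp: eventually_at_right_field)
  moreover have "\<forall>\<^sub>F t in at_right (0::real). 0 < t" by (simp add: eventually_at_right_less)
  ultimately have "\<forall>\<^sub>F t in at_right 0. \<exists>y1 y2. y1 \<noteq> y2 \<and> (x0 + s * t, y1) \<in> Z b \<and> (x0 + s * t, y2) \<in> Z b"
  proof eventually_elim
    case (elim t)
    let ?x = "x0 + s * t"
    have x: "\<bar>?x - x0\<bar> < r" using elim s by auto
    have "\<exists>y\<ge>y0. y \<le> y0 + h \<and> \<sigma> * value_at F b ?x y = 0"
      by (rule IVT') (use elim h in \<open>auto intro!: continuous_intros\<close>)
    then obtain y2 where y2: "y0 \<le> y2" "y2 \<le> y0 + h" "value_at F b ?x y2 = 0" using \<sigma> by auto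
    have "\<exists>y\<ge>y0 - h. y \<le> y0 \<and> \<sigma> * value_at F b ?x y = 0"
      by (rule IVT2') (use elim h in \<open>auto intro!: continuous_intros\<close>)
    then obtain y1 where y1: "y0 - h \<le> y1" "y1 \<le> y0" "value_at F b ?x y1 = 0" using \<sigma> by auto
    have "y1 \<noteq> y2" using y1 y2 elim(3) by (metis order.antisym less_irrefl mult_zero_right)
    moreover have "(?x, y1) \<in> Z b" "(?x, y2) \<in> Z b"
      using y1 y2 h r(2)[OF x] by (auto simp: Z_iff)
    ultimately show ?case by blast
  qed
  then show ?thesis using s by blast
qed

section \<open>Two sheets between consecutive roots of the discriminant\<close>

definition twofold :: "real \<Rightarrow> real set" where
  "twofold b = {x. \<exists>y1 y2. y1 \<noteq> y2 \<and> (x, y1) \<in> Z b \<and> (x, y2) \<in> Z b}"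

text \<open>Without roots of \<open>D\<close> all zeros over the interval are simple. Hence
  \<open>twofold b\<close> is open there by persistence, and closed because limits of two zeros
  exist by compactness and cannot coincide; connectedness of the interval finishes.\<close>

lemma twofold_interval:
  assumes b: "b \<in> I" and D: "\<And>x. p < x \<Longrightarrow> x < q \<Longrightarrow> poly (specialize b D) x \<noteq> 0"
    and x: "x \<in> twofold b" "p < x" "x < q"
  shows "{p<..<q} \<subseteq> twofold b"
proof -
  have nz: "value_at (pderiv F) b x y \<noteq> 0" if "(x, y) \<in> Z b" "p < x" "x < q" for x y
    using critical_point_discriminant[OF b that(1)] D that by auto
  have "openin (top_of_set {p<..<q}) ({p<..<q} \<inter> twofold b)"
    unfolding openin_open_eq[OF open_greaterThanLessThan]
  proof (intro conjI)
    show "open ({p<..<q} \<inter> twofold b)"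
      unfolding open_dist
    proof safe
      fix x assume x: "x \<in> twofold b" "x \<in> {p<..<q}"
      then obtain y1 y2 where y: "y1 \<noteq> y2" "(x, y1) \<in> Z b" "(x, y2) \<in> Z b" by (auto simp: twofold_def)
      define \<eta> where "\<eta> = \<bar>y1 - y2\<bar> / 2"
      have "\<eta> > 0" using y by (simp add: \<eta>_def)
      have "\<forall>\<^sub>F x in at x. \<exists>y. \<bar>y - y1\<bar> < \<eta> \<and> (x, y) \<in> Z b"
        using simple_zero_persists[OF _ _ nz[OF y(2)] \<open>\<eta> > 0\<close>] x y by (auto simp: Z_iff)
      moreover have "\<forall>\<^sub>F x in at x. \<exists>y. \<bar>y - y2\<bar> < \<eta> \<and> (x, y) \<in> Z b"
        using simple_zero_persists[OF _ _ nz[OF y(3)] \<open>\<eta> > 0\<close>] x y by (auto simp: Z_iff)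
      moreover have "\<forall>\<^sub>F x' in at x. x' \<in> {p<..<q}"
        using x by (intro topological_tendstoD tendsto_ident_at) auto
      ultimately have "\<forall>\<^sub>F x' in at x. x' \<in> {p<..<q} \<inter> twofold b"
      proof eventually_elim
        case (elim x')
        then obtain z1 z2 where "\<bar>z1 - y1\<bar> < \<eta>" "\<bar>z2 - y2\<bar> < \<eta>" "(x', z1) \<in> Z b" "(x', z2) \<in> Z b" by auto
        moreover from this have "z1 \<noteq> z2" unfolding \<eta>_def by (auto simp: abs_if split: if_splits)
        ultimately show ?case using elim by (auto simp: twofold_def)
      qed
      then show "\<exists>e>0. \<forall>x'. dist x' x < e \<longrightarrow> x' \<in> {p<..<q} \<inter> twofold b"
        using x unfolding eventually_at by (metis IntI UNIV_I)
    qed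
  qed auto
  moreover have "closedin (top_of_set {p<..<q}) ({p<..<q} \<inter> twofold b)"
    unfolding closedin_limpt
  proof safe
    fix x assume "x islimpt ({p<..<q} \<inter> twofold b)" and x: "x \<in> {p<..<q}"
    then obtain f where f: "\<And>n::nat. f n \<in> ({p<..<q} \<inter> twofold b) - {x}" "f \<longlonglongrightarrow> x"
      unfolding islimpt_sequential by blast
    then have "\<exists>y1 y2. y1 \<noteq> y2 \<and> (f n, y1) \<in> Z b \<and> (f n, y2) \<in> Z b" for n
      by (auto simp: twofold_def)
    then obtain g h where gh: "\<And>n. g n \<noteq> h n" "\<And>n. (f n, g n) \<in> Z b" "\<And>n. (f n, h n) \<in> Z b" by metis
    obtain P r where P: "P \<in> Z b" "strict_mono (r :: nat \<Rightarrow> nat)" "((\<lambda>n. (f n, g n)) \<circ> r) \<longlonglongrightarrow> P"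
      using compact_Z[OF b] gh(2) unfolding compact_def by meson
    obtain Q t where Q: "Q \<in> Z b" "strict_mono (t :: nat \<Rightarrow> nat)" "((\<lambda>n. (f (r n), h (r n))) \<circ> t) \<longlonglongrightarrow> Q"
      using compact_Z[OF b] gh(3) unfolding compact_def by meson
    have fr: "(\<lambda>n. f (r n)) \<longlonglongrightarrow> x" and fx: "(\<lambda>n. f (r (t n))) \<longlonglongrightarrow> x"
      using LIMSEQ_subseq_LIMSEQ[OF f(2) P(2)] LIMSEQ_subseq_LIMSEQ[OF LIMSEQ_subseq_LIMSEQ[OF f(2) P(2)] Q(2)] by (auto simp: o_def)
    have g: "(\<lambda>n. g (r (t n))) \<longlonglongrightarrow> snd P"
      using LIMSEQ_subseq_LIMSEQ[OF tendsto_snd[OF P(3)] Q(2)] by (simp add: o_def)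
    have h: "(\<lambda>n. h (r (t n))) \<longlonglongrightarrow> snd Q"
      using tendsto_snd[OF Q(3)] by (simp add: o_def)
    have "fst P = x" using LIMSEQ_unique[OF fr] tendsto_fst[OF P(3)] by (simp add: o_def)
    moreover have "fst Q = x" using LIMSEQ_unique[OF fx] tendsto_fst[OF Q(3)] by (simp add: o_def)
    ultimately have PQ: "(x, snd P) \<in> Z b" "(x, snd Q) \<in> Z b" using P Q by (metis prod.collapse)+
    have "snd P \<noteq> snd Q"
    proof
      assume eq: "snd P = snd Q"
      \<comment> \<open>If the two zeros merged, Rolle's critical points between them would converge
        to a zero with vanishing \<open>y\<close>-derivative.\<close>
      have "\<exists>z. (min (g n) (h n) < z \<and> z < max (g n) (h n)) \<and> value_at (pderiv F) b (f n) z = 0" for n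
      proof -
        have "min (g n) (h n) < max (g n) (h n)" using gh(1)[of n] by (auto simp: min_def max_def)
        moreover have "value_at F b (f n) (min (g n) (h n)) = value_at F b (f n) (max (g n) (h n))"
          using gh(2,3)[of n] by (auto simp: Z_iff min_def max_def)
        ultimately have "\<exists>z>min (g n) (h n). z < max (g n) (h n) \<and>
            ((\<lambda>y. value_at F b (f n) y) has_field_derivative 0) (at z)"
          by (intro Rolle DERIV_continuous_on[OF DERIV_value_at_y]) (assumption | (unfold real_differentiable_def, rule exI, rule DERIV_value_at_y))+
        then show ?thesis by (metis DERIV_unique DERIV_value_at_y)
      qed
      then obtain z where z: "\<And>n. min (g n) (h n) < z n" "\<And>n. z n < max (g n) (h n)" "\<And>n. value_at (pderiv F) b (f n) (z n) = 0"
        by metis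
      have "(\<lambda>n. z (r (t n))) \<longlonglongrightarrow> snd P"
      proof (rule tendsto_sandwich)
        show "(\<lambda>n. min (g (r (t n))) (h (r (t n)))) \<longlonglongrightarrow> snd P" "(\<lambda>n. max (g (r (t n))) (h (r (t n)))) \<longlonglongrightarrow> snd P"
          using tendsto_min[OF g h] tendsto_max[OF g h] eq by auto
      qed (use z in \<open>auto intro!: always_eventually less_imp_le\<close>)
      then have "(\<lambda>n. value_at (pderiv F) b (f (r (t n))) (z (r (t n)))) \<longlonglongrightarrow> value_at (pderiv F) b x (snd P)"
        by (intro tendsto_intros fx)
      then have "value_at (pderiv F) b x (snd P) = 0" by (simp add: z(3) LIMSEQ_const_iff)
      then show False using nz[OF PQ(1)] x by auto
    qed
    then show "x \<in> twofold b" using PQ by (auto simp: twofold_def)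
  qed
  ultimately have "{p<..<q} \<inter> twofold b = {} \<or> {p<..<q} \<inter> twofold b = {p<..<q}"
    using connected_clopen[of "{p<..<q}"] by auto
  moreover have "x \<in> {p<..<q} \<inter> twofold b" using x by simp
  ultimately show ?thesis by blast
qed

text \<open>Here \<open>q\<close> is the abscissa of a rightmost point, a nondegenerate fold by
  \<open>sqf\<close>, and \<open>p\<close> is the preceding root of \<open>D\<close>. The leftmost
  point guarantees that such a root exists.\<close>

lemma two_discriminant_roots:
  assumes b: "b \<in> I" and sqf: "\<And>x. \<not> [:-x, 1:]\<^sup>2 dvd (specialize b D :: real poly)" and ne: "Z b \<noteq> {}"
  obtains p q where "degree F \<ge> 2" "p < q" "poly (specialize b D) p = 0" "poly (specialize b D) q = 0" "{p<..<q} \<subseteq> twofold b"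
proof -
  have cont: "continuous_on (Z b) fst" by (intro continuous_intros)
  obtain P where P: "P \<in> Z b" "\<And>R. R \<in> Z b \<Longrightarrow> fst R \<le> fst P"
    using continuous_attains_sup[OF compact_Z[OF b] ne cont] by blast
  obtain Q where Q: "Q \<in> Z b" "\<And>R. R \<in> Z b \<Longrightarrow> fst Q \<le> fst R"
    using continuous_attains_inf[OF compact_Z[OF b] ne cont] by blast
  obtain q y where Pq: "P = (q, y)" by (cases P)
  obtain p0 z where Qp: "Q = (p0, z)" by (cases Q)
  have dyP: "value_at (pderiv F) b q y = 0" 
  proof (rule x_extremal_critical[of q y b 1])
    show "1 * x \<le> 1 * q" if "(x, y') \<in> Z b" for x y' using P(2)[OF that] Pq by simp
  qed (use P Pq in auto)
  have dyQ: "value_at (pderiv F) b p0 z = 0" 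
  proof (rule x_extremal_critical[of p0 z b "-1"])
    show "-1 * x \<le> -1 * p0" if "(x, y') \<in> Z b" for x y' using Q(2)[OF that] Qp by simp
  qed (use Q Qp in auto)
  have PZ: "(q, y) \<in> Z b" and QZ: "(p0, z) \<in> Z b" using P Q Pq Qp by auto
  note crit = critical_point_discriminant[OF b PZ dyP] critical_point_discriminant[OF b QZ dyQ]
  have "value_at F b q y = 0" using PZ by (simp add: Z_iff)
  then have "value_at (pderiv_x F) b q y \<noteq> 0" "value_at (pderiv (pderiv F)) b q y \<noteq> 0"
    using discriminant_sq_dvd_singular[OF crit(1) _ dyP] sqf by blast+
  from fold_point[OF PZ dyP this(2,1)] obtain s where s: "s \<in> {1, -1}"
      "\<forall>\<^sub>F t in at_right 0. \<exists>y1 y2. y1 \<noteq> y2 \<and> (q + s * t, y1) \<in> Z b \<and> (q + s * t, y2) \<in> Z b" by blast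
  then obtain e where e: "e > 0" "\<And>t. 0 < t \<Longrightarrow> t < e \<Longrightarrow> q + s * t \<in> twofold b"
    by (auto simp: eventually_at_right_field twofold_def)
  \<comment> \<open>A fold opening to the right would produce points beyond the rightmost
    one.\<close>
  have "s = -1"
  proof -
    have "q + s * (e/2) \<in> twofold b" using e(2)[of "e/2"] e(1) by simp
    then obtain y' where "(q + s * (e/2), y') \<in> Z b" by (auto simp: twofold_def)
    from P(2)[OF this] show ?thesis using s(1) e(1) Pq by auto
  qed
  then have tw: "q - t \<in> twofold b" if "0 < t" "t < e" for t using e(2)[OF that] by simp
  have nz: "specialize b D \<noteq> (0 :: real poly)" using sqf[of 0] by auto
  define R where "R = {x. x < q \<and> poly (specialize b D) x = 0}"
  have "finite R" using poly_roots_finite[OF nz] by (auto simp: R_def)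
  have "p0 < q"
  proof -
    have "q - e/2 \<in> twofold b" using tw[of "e/2"] e(1) by simp
    then obtain y' where "(q - e/2, y') \<in> Z b" by (auto simp: twofold_def)
    from Q(2)[OF this] show ?thesis using e(1) Qp by simp
  qed
  then have "p0 \<in> R" using crit(4) by (simp add: R_def)
  define p where "p = Max R"
  have pR: "p \<in> R" "\<And>x. x \<in> R \<Longrightarrow> x \<le> p" using Max_in[OF \<open>finite R\<close>] Max_ge[OF \<open>finite R\<close>] \<open>p0 \<in> R\<close> by (auto simp: p_def)
  then have "p < q" "poly (specialize b D) p = 0" by (auto simp: R_def)
  \<comment> \<open>Close enough to \<open>q\<close> to lie on the fold and to the right of
    \<open>p\<close>.\<close>
  define x where "x = q - min (q - p) e / 2"
  have "x \<in> twofold b" "p < x" "x < q"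
    using tw[of "min (q - p) e / 2"] e(1) \<open>p < q\<close> by (auto simp: x_def min_def field_simps)
  have "{p<..<q} \<subseteq> twofold b"
    by (rule twofold_interval[OF b _ \<open>x \<in> twofold b\<close> \<open>p < x\<close> \<open>x < q\<close>])
       (use pR(2) in \<open>fastforce simp: R_def\<close>)
  then show thesis using that crit(1,2) \<open>p < q\<close> \<open>poly (specialize b D) p = 0\<close> by blast
qed

end

section \<open>Zeros cannot appear from infinity\<close>

text \<open>Under \<open>w = 1/y\<close> the roots become two distinct roots tending to 0 of the
  reversed polynomial \<open>R k\<close>, and Rolle gives a root of \<open>R' k\<close> tending to 0
  as well. At 0 the limits of \<open>R k\<close> and \<open>R' k\<close> are \<open>l m\<close> and
  \<open>l (m - 1)\<close>.\<close>

lemma roots_to_infinity: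
  fixes c :: "nat \<Rightarrow> nat \<Rightarrow> real"
  assumes lim: "\<And>i. i \<le> m \<Longrightarrow> (\<lambda>k. c k i) \<longlonglongrightarrow> l i" and m: "m \<ge> 1"
    and y: "\<And>k. (\<Sum>i\<le>m. c k i * y k ^ i) = 0" "filterlim y at_infinity sequentially"
    and z: "\<And>k. (\<Sum>i\<le>m. c k i * z k ^ i) = 0" "filterlim z at_infinity sequentially"
    and ne: "\<And>k. y k \<noteq> z k"
  shows "l m = 0" "l (m - 1) = 0"
proof -
  define R where "R = (\<lambda>k w. \<Sum>i\<le>m. c k i * w ^ (m - i))"
  define R' where "R' = (\<lambda>k w. \<Sum>i\<le>m. c k i * (real (m - i) * w ^ (m - i - 1)))"
  have der: "(R k has_field_derivative R' k w) (at w within S)" for k w S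
    unfolding R_def R'_def by (auto intro!: derivative_eq_intros sum.cong)
  have limR: "(\<lambda>k. R k (w k)) \<longlonglongrightarrow> l m" if "w \<longlonglongrightarrow> 0" for w
  proof -
    have "(\<lambda>k. R k (w k)) \<longlonglongrightarrow> (\<Sum>i\<le>m. l i * 0 ^ (m - i))"
      unfolding R_def by (intro tendsto_intros lim that) auto
    also have "(\<Sum>i\<le>m. l i * 0 ^ (m - i)) = (\<Sum>i\<in>{m}. l i * 0 ^ (m - i))"
      by (rule sum.mono_neutral_right) auto
    finally show ?thesis by simp
  qed
  have limR': "(\<lambda>k. R' k (w k)) \<longlonglongrightarrow> l (m - 1)" if "w \<longlonglongrightarrow> 0" for w
  proof -
    have "(\<lambda>k. R' k (w k)) \<longlonglongrightarrow> (\<Sum>i\<le>m. l i * (real (m - i) * 0 ^ (m - i - 1)))"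
      unfolding R'_def by (intro tendsto_intros lim that) auto
    also have "(\<Sum>i\<le>m. l i * (real (m - i) * 0 ^ (m - i - 1))) = (\<Sum>i\<in>{m-1}. l i * (real (m - i) * 0 ^ (m - i - 1)))"
      by (rule sum.mono_neutral_right) auto
    finally show ?thesis using m by simp
  qed
  have root: "R k (inverse t) = 0" if "(\<Sum>i\<le>m. c k i * t ^ i) = 0" "t \<noteq> 0" for k t
  proof -
    have "R k (inverse t) = (\<Sum>i\<le>m. inverse t ^ m * (c k i * t ^ i))"
      unfolding R_def using that(2) by (intro sum.cong) (auto simp: power_diff field_simps)
    then show ?thesis using that(1) by (simp flip: sum_distrib_left)
  qed
  have iy: "(\<lambda>k. inverse (y k)) \<longlonglongrightarrow> 0" and iz: "(\<lambda>k. inverse (z k)) \<longlonglongrightarrow> 0"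
    using filterlim_compose[OF tendsto_inverse_0] y(2) z(2) by auto
  have nz: "\<forall>\<^sub>F k in sequentially. y k \<noteq> 0 \<and> z k \<noteq> 0"
    using filterlim_at_infinity_imp_eventually_ne[OF y(2), of 0] filterlim_at_infinity_imp_eventually_ne[OF z(2), of 0]
    by eventually_elim auto
  have "(\<lambda>k. R k (inverse (y k))) \<longlonglongrightarrow> 0"
    by (rule tendsto_eventually) (use nz in eventually_elim, auto simp: root y)
  with limR[OF iy] show "l m = 0" using LIMSEQ_unique by blast
  \<comment> \<open>The clause on \<open>R'\<close> is conditional so that a choice exists for every
    \<open>k\<close>; both roots are nonzero eventually.\<close>
  define P where "P = (\<lambda>k w. min (inverse (y k)) (inverse (z k)) \<le> w \<and> w \<le> max (inverse (y k)) (inverse (z k)) \<and>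
     (y k \<noteq> 0 \<and> z k \<noteq> 0 \<longrightarrow> R' k w = 0))"
  have "\<exists>w. P k w" for k
  proof (cases "y k \<noteq> 0 \<and> z k \<noteq> 0")
    case True
    let ?a = "min (inverse (y k)) (inverse (z k))" and ?b = "max (inverse (y k)) (inverse (z k))"
    have "min u v < max u v" if "u \<noteq> v" for u v :: real using that by (auto simp: min_def max_def)
    then have "?a < ?b" using ne[of k] by simp
    moreover have "R k ?a = R k ?b" using True y(1) z(1) root by (auto simp: min_def max_def)
    ultimately have "\<exists>w>?a. w < ?b \<and> (R k has_field_derivative 0) (at w)"
      by (intro Rolle DERIV_continuous_on[OF der])
         (assumption | (unfold real_differentiable_def, rule exI, rule der))+
    then obtain w where "?a < w" "w < ?b" "R' k w = 0" by (metis DERIV_unique der)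
    then show ?thesis by (intro exI[of _ w]) (simp add: P_def)
  next
    case False
    then show ?thesis by (intro exI[of _ "min (inverse (y k)) (inverse (z k))"]) (auto simp: P_def)
  qed
  then obtain w where w: "\<And>k. P k (w k)" by metis
  have "w \<longlonglongrightarrow> 0"
  proof (rule tendsto_sandwich)
    show "(\<lambda>k. min (inverse (y k)) (inverse (z k))) \<longlonglongrightarrow> 0" "(\<lambda>k. max (inverse (y k)) (inverse (z k))) \<longlonglongrightarrow> 0"
      using tendsto_min[OF iy iz] tendsto_max[OF iy iz] by auto
  qed (use w in \<open>auto simp: P_def\<close>)
  moreover have "(\<lambda>k. R' k (w k)) \<longlonglongrightarrow> 0"
    by (rule tendsto_eventually) (use nz in eventually_elim, use w in \<open>auto simp: P_def\<close>)
  ultimately show "l (m - 1) = 0" using limR' LIMSEQ_unique by blast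
qed

lemma filterlim_at_top_arctan:
  assumes "(\<lambda>k. arctan (f k)) \<longlonglongrightarrow> pi / 2"
  shows "filterlim f at_top sequentially"
  unfolding filterlim_at_top_dense
proof
  fix u :: real
  have "\<forall>\<^sub>F k in sequentially. arctan u < arctan (f k)"
    by (rule order_tendstoD(1)[OF assms arctan_ubound])
  then show "\<forall>\<^sub>F k in sequentially. u < f k" by (simp add: arctan_less_iff)
qed

text \<open>The values of \<open>arctan\<close> compactify the real line; the endpoints of the
  interval stand for divergence.\<close>

lemma filterlim_at_infinity_arctan:
  assumes "(\<lambda>k. arctan (f k)) \<longlonglongrightarrow> a" "\<bar>a\<bar> = pi / 2"
  shows "filterlim f at_infinity sequentially"
proof (cases "a = pi / 2")
  case True
  then show ?thesis using filterlim_at_top_arctan assms(1) filterlim_at_top_imp_at_infinity by blast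
next
  case False
  then have a: "a = - (pi / 2)" using assms(2) by linarith
  have "(\<lambda>k. arctan (- f k)) \<longlonglongrightarrow> pi / 2"
    using tendsto_minus[OF assms(1)] by (simp add: a arctan_minus)
  then have "filterlim (\<lambda>k. - f k) at_top sequentially" by (rule filterlim_at_top_arctan)
  then have "filterlim f at_bot sequentially" by (simp add: filterlim_uminus_at_top)
  then show ?thesis using filterlim_at_bot_imp_at_infinity by blast
qed

lemma merging_roots:
  fixes D :: "real poly poly"
  assumes b: "b \<longlonglongrightarrow> b1" and p: "p \<longlonglongrightarrow> s" and q: "q \<longlonglongrightarrow> s" and pq: "\<And>k. p k < (q k :: real)"
    and r: "\<And>k. poly (specialize (b k) D) (p k) = 0" "\<And>k. poly (specialize (b k) D) (q k) = 0"
  shows "poly (specialize b1 D) s = 0" "poly (pderiv (specialize b1 D)) s = 0"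
proof -
  have "(\<lambda>k. poly (specialize (b k) D) (p k)) \<longlonglongrightarrow> poly (specialize b1 D) s" by (intro tendsto_intros b p)
  then show "poly (specialize b1 D) s = 0" by (simp add: r LIMSEQ_const_iff)
  have "\<exists>z. p k < z \<and> z < q k \<and> poly (pderiv (specialize (b k) D)) z = 0" for k
    using poly_MVT[OF pq[of k], of "specialize (b k) D"] r[of k] pq[of k] by auto
  then obtain z where z: "\<And>k. p k < z k" "\<And>k. z k < q k" "\<And>k. poly (pderiv (specialize (b k) D)) (z k) = 0" by metis
  have "z \<longlonglongrightarrow> s"
    by (rule tendsto_sandwich[OF _ _ p q]) (use z in \<open>auto intro!: always_eventually less_imp_le\<close>)
  then have "(\<lambda>k. poly (specialize (b k) (pderiv D)) (z k)) \<longlonglongrightarrow> poly (specialize b1 (pderiv D)) s" by (intro tendsto_intros b)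
  then show "poly (pderiv (specialize b1 D)) s = 0" by (simp add: specialize_pderiv z LIMSEQ_const_iff)
qed

text \<open>A discriminant of formal degree 0 is \<open>1 div c\<close>, hence nonzero only for a unit \<open>c\<close>.\<close>

lemma discriminant2_const:
  fixes D :: "real poly poly"
  assumes "poly (discriminant D) b \<noteq> 0" "degree D = 0"
  obtains c where "c \<noteq> 0" "\<And>b. specialize b D = ([:of_real c:] :: 'a::real_normed_field poly)"
proof -
  obtain d where d: "D = [:d:]" using assms(2) by (rule degree_eq_zeroE)
  have nz: "1 div d \<noteq> 0" using assms(1) by (auto simp: discriminant_def d)
  have "degree d = 0"
  proof (rule ccontr)
    assume "degree d \<noteq> 0"
    then have "1 div d = 0" by (intro div_poly_less) simp
    with nz show False by simp
  qed
  then obtain c where c: "d = [:c:]" by (rule degree_eq_zeroE)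
  show thesis
    by (rule that[of c]) (use nz in \<open>auto simp: c d coeff_specialize coeff_pCons poly_eq_iff split: nat.split\<close>)
qed

lemma discriminant2_linear:
  fixes D :: "real poly poly"
  assumes "degree D = 1"
  shows "(specialize b D :: 'a::real_normed_field poly) = [:of_real (poly (coeff D 0) b), of_real (poly (coeff D 1) b):]"
proof (rule poly_eqI)
  fix k
  have "coeff D k = 0" if "k > 1" using that assms by (simp add: coeff_eq_0)
  then show "coeff (specialize b D) k = coeff [:of_real (poly (coeff D 0) b), of_real (poly (coeff D 1) b) :: 'a:] k"
    by (cases "k = 0"; cases "k = 1") (auto simp: coeff_specialize coeff_pCons split: nat.split)
qed

lemma sq_not_dvd_linear:
  fixes p :: "'a::field poly"
  assumes "[:-x, 1:]\<^sup>2 dvd p" "degree p \<le> 1"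
  shows "p = 0"
proof (rule ccontr)
  assume "p \<noteq> 0"
  then have "degree ([:-x, 1:]\<^sup>2) \<le> degree p" using dvd_imp_degree_le[OF assms(1)] by simp
  then show False using assms(2) by (simp add: degree_power_eq)
qed

lemma eventually_poly_nonzero:
  fixes a :: "real poly"
  assumes "a \<noteq> 0"
  shows "\<forall>\<^sub>F x in at b. poly a x \<noteq> 0"
proof -
  have "finite ({x. poly a x = 0} - {b})" using poly_roots_finite[OF assms] by simp
  then have "closed ({x. poly a x = 0} - {b})" by (rule finite_imp_closed)
  then have "open (- ({x. poly a x = 0} - {b}))" by (rule open_Compl)
  then have "\<forall>\<^sub>F x in at b. x \<in> - ({x. poly a x = 0} - {b})" by (intro eventually_at_in_open') auto
  then show ?thesis by (auto simp: eventually_at)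
qed

context curve_family
begin

section \<open>Zero sets under a convergent parameter\<close>

text \<open>The limit lies in the closure of \<open>\<Omega>\<close> only;
  \<open>zero_in_closure\<close> brings it back inside.\<close>

lemma Z_limit:
  assumes b: "b1 \<in> I" "b \<longlonglongrightarrow> b1" and p: "p \<longlonglongrightarrow> q" "\<And>k. p k \<in> Z (b k)"
  shows "q \<in> Z b1"
proof -
  have "p k \<in> \<Omega>" "value_at F (b k) (fst (p k)) (snd (p k)) = 0" for k
    using p(2)[of k] by (cases "p k"; auto simp: Z_iff)+
  moreover have "(\<lambda>k. value_at F (b k) (fst (p k)) (snd (p k))) \<longlonglongrightarrow> value_at F b1 (fst q) (snd q)"
    by (intro tendsto_intros b p)
  ultimately have "value_at F b1 (fst q) (snd q) = 0" by (simp add: LIMSEQ_const_iff)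
  moreover have "q \<in> closure \<Omega>" unfolding closure_sequential using p(1) \<open>\<And>k. p k \<in> \<Omega>\<close> by blast
  ultimately show ?thesis using zero_in_closure[OF b(1), of "fst q" "snd q"] by (cases q) (auto simp: Z_iff)
qed

text \<open>Zeros staying in a ball for infinitely many \<open>k\<close> would accumulate at a point
  of \<open>Z b1\<close>.\<close>

lemma Z_escapes:
  assumes b: "b1 \<in> I" "b \<longlonglongrightarrow> b1" and empty: "Z b1 = {}"
  shows "\<forall>\<^sub>F k in sequentially. \<forall>p\<in>Z (b k). norm p > R"
proof (rule ccontr)
  assume "\<not> ?thesis"
  then have inf: "infinite {k. \<exists>p\<in>Z (b k). norm p \<le> R}"
    by (auto simp: not_eventually frequently_cofinite cofinite_eq_sequentially[symmetric] not_less)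
  define r where "r = enumerate {k. \<exists>p\<in>Z (b k). norm p \<le> R}"
  have r: "strict_mono r" unfolding r_def by (rule strict_mono_enumerate[OF inf])
  have "\<exists>p\<in>Z (b (r k)). norm p \<le> R" for k using enumerate_in_set[OF inf] by (auto simp: r_def)
  then obtain p where p: "\<And>k. p k \<in> Z (b (r k))" "\<And>k. norm (p k) \<le> R" by metis
  have "compact (cball (0::real \<times> real) R)" by simp
  then obtain q t where q: "strict_mono (t::nat \<Rightarrow> nat)" "(p \<circ> t) \<longlonglongrightarrow> q"
    using p(2) unfolding compact_def by (metis mem_cball_0)
  have "(\<lambda>k. b (r (t k))) \<longlonglongrightarrow> b1"
    using LIMSEQ_subseq_LIMSEQ[OF LIMSEQ_subseq_LIMSEQ[OF b(2) r] q(1)] by (simp add: o_def)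
  from Z_limit[OF b(1) this q(2)] have "q \<in> Z b1" using p by simp
  with empty show False by simp
qed

lemma no_new_zeros_aux:
  assumes b: "b1 \<in> I" "b \<longlonglongrightarrow> b1" "\<And>k. b k \<in> I" and empty: "Z b1 = {}" and ne: "\<And>k. Z (b k) \<noteq> {}"
    and n: "degree D \<ge> 2" and disc: "poly (discriminant D) b1 \<noteq> 0"
    and sqf: "\<And>k x. \<not> [:-x, 1:]\<^sup>2 dvd (specialize (b k) D :: real poly)"
  shows False
proof -
  have "\<exists>p q. degree F \<ge> 2 \<and> p < q \<and> poly (specialize (b k) D) p = 0 \<and> poly (specialize (b k) D) q = 0 \<and> {p<..<q} \<subseteq> twofold (b k)" for k
    using two_discriminant_roots[OF b(3)[of k] sqf[of _ k] ne[of k]] by metis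
  then obtain p q where deg: "degree F \<ge> 2" and pq: "\<And>k. p k < q k" "\<And>k. poly (specialize (b k) D) (p k) = 0" "\<And>k. poly (specialize (b k) D) (q k) = 0"
     "\<And>k. {p k<..<q k} \<subseteq> twofold (b k)" by metis
  \<comment> \<open>Both ends of the twofold intervals are followed in the \<open>arctan\<close>
    scale, where a subsequence converges whether or not they stay bounded.\<close>
  define K where "K = {-(pi/2)..pi/2} \<times> {-(pi/2)..pi/2 :: real}"
  have "compact K" unfolding K_def by (intro compact_Times compact_Icc)
  moreover have "arctan x \<in> {-(pi/2)..pi/2}" for x
    using arctan_lbound[of x] arctan_ubound[of x] by (simp only: atLeastAtMost_iff less_imp_le)
  then have "(arctan (p k), arctan (q k)) \<in> K" for k by (simp only: K_def mem_Times_iff fst_conv snd_conv)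
  ultimately obtain l r where l: "l \<in> K" and r: "strict_mono (r::nat \<Rightarrow> nat)" and lim: "((\<lambda>k. (arctan (p k), arctan (q k))) \<circ> r) \<longlonglongrightarrow> l"
    unfolding compact_def by (metis (no_types, lifting))
  obtain \<alpha> \<beta> where l_eq: "l = (\<alpha>, \<beta>)" by (cases l)
  have \<alpha>\<beta>: "-(pi/2) \<le> \<alpha>" "\<alpha> \<le> pi/2" "-(pi/2) \<le> \<beta>" "\<beta> \<le> pi/2" using l by (auto simp: l_eq K_def)
  have \<alpha>: "(\<lambda>k. arctan (p (r k))) \<longlonglongrightarrow> \<alpha>" and \<beta>: "(\<lambda>k. arctan (q (r k))) \<longlonglongrightarrow> \<beta>"
    using tendsto_fst[OF lim] tendsto_snd[OF lim] by (auto simp: o_def l_eq)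
  have br: "(\<lambda>k. b (r k)) \<longlonglongrightarrow> b1" using LIMSEQ_subseq_LIMSEQ[OF b(2) r] by (simp add: o_def)
  have "\<alpha> \<le> \<beta>" using LIMSEQ_le[OF \<alpha> \<beta>] pq(1) by (auto simp: arctan_le_iff less_imp_le)
  then consider "\<alpha> < \<beta>" | "\<alpha> = \<beta>" "\<bar>\<alpha>\<bar> = pi / 2" | "\<alpha> = \<beta>" "\<bar>\<alpha>\<bar> < pi / 2" using \<alpha>\<beta> by linarith
  then show False
  proof cases
    case 1
    \<comment> \<open>The intervals eventually contain a fixed one. Over a point \<open>x\<close> of
      it that is not a root of \<open>D\<close> at \<open>b1\<close>, the two zeros escape to
      infinity, so the top two coefficients of the limit fibre vanish and \<open>D\<close> does
      vanish at \<open>x\<close>.\<close>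
    obtain u v where uv: "\<alpha> < u" "u < v" "v < \<beta>" using 1 dense by metis
    have tu: "arctan (tan u) = u" and tv: "arctan (tan v) = v"
      using uv \<alpha>\<beta> by (auto intro!: arctan_tan)
    have "tan u < tan v" using uv(2) tu tv by (metis arctan_less_iff)
    have "specialize b1 D \<noteq> (0 :: real poly)"
      using discriminant2_zero_double_root[OF n, of b1 0] disc by auto
    then have "finite {x. poly (specialize b1 D) x = (0::real)}" by (rule poly_roots_finite)
    moreover have "infinite {tan u<..<tan v}" using \<open>tan u < tan v\<close> by (rule infinite_Ioo)
    ultimately obtain x where x: "x \<in> {tan u<..<tan v}" "poly (specialize b1 D) x \<noteq> 0"
      by (metis (mono_tags, lifting) finite_subset mem_Collect_eq subsetI)
    have "\<forall>\<^sub>F k in sequentially. arctan (p (r k)) < arctan (tan u)" using order_tendstoD(2)[OF \<alpha>] uv tu by auto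
    moreover have "\<forall>\<^sub>F k in sequentially. arctan (tan v) < arctan (q (r k))" using order_tendstoD(1)[OF \<beta>] uv tv by auto
    ultimately have "\<forall>\<^sub>F k in sequentially. x \<in> twofold (b (r k))"
    proof eventually_elim
      case (elim k)
      then have "p (r k) < x" "x < q (r k)" using x by (auto simp: arctan_less_iff)
      then show ?case using pq(4)[of "r k"] by auto
    qed
    then obtain N where "\<And>k. k \<ge> N \<Longrightarrow> x \<in> twofold (b (r k))" by (auto simp: eventually_sequentially)
    then have "\<exists>y z. y \<noteq> z \<and> (x, y) \<in> Z (b (r (k + N))) \<and> (x, z) \<in> Z (b (r (k + N)))" for k
      by (auto simp: twofold_def)
    then obtain y z where yz: "\<And>k. y k \<noteq> z k" "\<And>k. (x, y k) \<in> Z (b (r (k + N)))" "\<And>k. (x, z k) \<in> Z (b (r (k + N)))"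
      by metis
    have bN: "(\<lambda>k. b (r (k + N))) \<longlonglongrightarrow> b1" using LIMSEQ_ignore_initial_segment[OF br] .
    have inf: "filterlim w at_infinity sequentially" if w: "\<And>k. (x, w k) \<in> Z (b (r (k + N)))" for w
      unfolding filterlim_at_infinity[OF order_refl]
    proof safe
      fix R :: real
      have "\<forall>\<^sub>F k in sequentially. \<forall>p\<in>Z (b (r (k + N))). norm p > R + \<bar>x\<bar>"
        by (rule Z_escapes[OF b(1) bN empty])
      then show "\<forall>\<^sub>F k in sequentially. R \<le> norm (w k)"
      proof eventually_elim
        case (elim k)
        then have "norm (x, w k) > R + \<bar>x\<bar>" using w by blast
        moreover have "norm (x, w k) \<le> norm x + norm (w k)" by (rule norm_Pair_le)
        ultimately show ?case by simp
      qed
    qed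
    have "poly (specialize b1 (coeff F (degree F))) x = 0" "poly (specialize b1 (coeff F (degree F - 1))) x = 0"
      using deg yz inf[OF yz(2)] inf[OF yz(3)]
      by (intro roots_to_infinity[where c = "\<lambda>k i. poly (specialize (b (r (k + N))) (coeff F i)) x" and m = "degree F"
            and l = "\<lambda>i. poly (specialize b1 (coeff F i)) x" and y = y and z = z];
          auto simp: Z_iff value_at_sum intro!: tendsto_intros bN)+
    from discriminant_zero_infinity[OF deg this] x(2) show False by simp
  next
    case 2
    \<comment> \<open>Both roots of \<open>D\<close> escape to infinity, so \<open>D\<close> has a
      double root at infinity at \<open>b1\<close>.\<close>
    have "poly (coeff D (degree D)) b1 = 0" "poly (coeff D (degree D - 1)) b1 = 0"
    proof -
      have *: "(\<Sum>i\<le>degree D. poly (coeff D i) (b (r k)) * p (r k) ^ i) = 0"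
              "(\<Sum>i\<le>degree D. poly (coeff D i) (b (r k)) * q (r k) ^ i) = 0" "p (r k) \<noteq> q (r k)" for k
        using pq(1)[of "r k"] pq(2)[of "r k"] pq(3)[of "r k"] by (auto simp: poly_specialize_sum)
      note i = filterlim_at_infinity_arctan[OF \<alpha> 2(2)] filterlim_at_infinity_arctan[OF \<beta>] 2
      show "poly (coeff D (degree D)) b1 = 0" "poly (coeff D (degree D - 1)) b1 = 0"
        using n i
        by (intro roots_to_infinity[where c = "\<lambda>k i. poly (coeff D i) (b (r k))" and m = "degree D"
              and l = "\<lambda>i. poly (coeff D i) b1", OF _ _ *(1) _ *(2) _ *(3)];
            auto intro!: tendsto_intros br)+
    qed
    from discriminant2_zero_infinity[OF n this] disc show False by simp
  next
    case 3
    \<comment> \<open>The two roots of \<open>D\<close> merge at the finite point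
      \<open>tan \<alpha>\<close>, which becomes a double root.\<close>
    have "- (pi / 2) < \<alpha>" "\<alpha> < pi / 2" using 3 by linarith+
    then have ct: "isCont tan \<alpha>" using cos_gt_zero_pi[of \<alpha>] by (intro isCont_tan) auto
    have "(\<lambda>k. tan (arctan (p (r k)))) \<longlonglongrightarrow> tan \<alpha>" "(\<lambda>k. tan (arctan (q (r k)))) \<longlonglongrightarrow> tan \<alpha>"
      using isCont_tendsto_compose[OF ct \<alpha>] isCont_tendsto_compose[OF ct, of "\<lambda>k. arctan (q (r k))"] \<beta> 3 by auto
    then have "(\<lambda>k. p (r k)) \<longlonglongrightarrow> tan \<alpha>" "(\<lambda>k. q (r k)) \<longlonglongrightarrow> tan \<alpha>" by (simp_all add: tan_arctan)
    from merging_roots[OF br this pq(1) pq(2,3)]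
    show False using discriminant2_zero_double_root[OF n] disc by blast
  qed
qed

text \<open>Nonempty zero sets require two distinct roots of \<open>D\<close>. In formal degree 0
  there is none and in degree 1 at most one for a suitable \<open>k\<close>; from degree 2 on,
  \<open>disc\<close> remains nonzero near \<open>b1\<close> and provides square-freeness.\<close>

lemma no_new_zeros:
  assumes b: "b1 \<in> I" "b \<longlonglongrightarrow> b1" "\<And>k. b k \<in> I" and empty: "Z b1 = {}" and ne: "\<And>k. Z (b k) \<noteq> {}"
    and disc: "poly (discriminant D) b1 \<noteq> 0"
  shows False
proof -
  consider "degree D = 0" | "degree D = 1" | "degree D \<ge> 2" by linarith
  then show False
  proof cases
    case 1
    then obtain c where c: "c \<noteq> 0" "\<And>b. specialize b D = ([:of_real c:] :: real poly)" using discriminant2_const[OF disc] by metis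
    have "\<not> [:-x, 1:]\<^sup>2 dvd (specialize (b 0) D :: real poly)" for x
      using sq_not_dvd_linear[of x "specialize (b 0) D"] c by auto
    from two_discriminant_roots[OF b(3) this ne] show False using c by auto
  next
    case 2
    have "coeff D 1 \<noteq> 0" using 2 by (metis leading_coeff_neq_0 degree_0 zero_neq_one)
    then have "\<forall>\<^sub>F x in at b1. poly (coeff D 1) x \<noteq> 0" by (rule eventually_poly_nonzero)
    \<comment> \<open>The parameters differ from \<open>b1\<close>, since \<open>Z (b k)\<close> is
      nonempty and \<open>Z b1\<close> is empty.\<close>
    moreover have "filterlim b (at b1) sequentially"
      using b(2) ne empty by (auto simp: filterlim_at intro!: always_eventually)
    ultimately have "\<forall>\<^sub>F k in sequentially. poly (coeff D 1) (b k) \<noteq> 0" by (rule eventually_compose_filterlim)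
    then obtain k where k: "poly (coeff D 1) (b k) \<noteq> 0"
      using eventually_happens'[OF sequentially_bot] by blast
    note s = discriminant2_linear[OF 2, of "b k", where 'a = real]
    have "\<not> [:-x, 1:]\<^sup>2 dvd (specialize (b k) D :: real poly)" for x
      using sq_not_dvd_linear[of x "specialize (b k) D"] k s by auto
    from two_discriminant_roots[OF b(3) this ne] obtain p q :: real
      where "p < q" "poly (specialize (b k) D) p = 0" "poly (specialize (b k) D) q = 0" by metis
    then have "poly (coeff D 0) (b k) + p * poly (coeff D 1) (b k) = 0"
      "poly (coeff D 0) (b k) + q * poly (coeff D 1) (b k) = 0" by (simp_all add: s)
    then have "(q - p) * poly (coeff D 1) (b k) = 0" unfolding left_diff_distrib by linarith
    then show False using k \<open>p < q\<close> by simp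
  next
    case 3
    have "(\<lambda>k. poly (discriminant D) (b k)) \<longlonglongrightarrow> poly (discriminant D) b1" by (intro tendsto_intros b)
    then have "\<forall>\<^sub>F k in sequentially. poly (discriminant D) (b k) \<noteq> 0" using disc by (rule tendsto_imp_eventually_ne)
    then obtain N where N: "\<And>k. k \<ge> N \<Longrightarrow> poly (discriminant D) (b k) \<noteq> 0" by (auto simp: eventually_sequentially)
    show False
    proof (rule no_new_zeros_aux[of b1 "\<lambda>k. b (k + N)"])
      show "(\<lambda>k. b (k + N)) \<longlonglongrightarrow> b1" by (rule LIMSEQ_ignore_initial_segment[OF b(2)])
      show "\<not> [:-x, 1:]\<^sup>2 dvd (specialize (b (k + N)) D :: real poly)" for k x
        using N[of "k + N"] discriminant2_zero_double_root[OF 3, of "b (k + N)" x] sq_dvd_imp_double_root[of x "specialize (b (k + N)) D"] by auto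
    qed (use assms 3 in auto)
  qed
qed

section \<open>Zeros of a nonnegative limit\<close>

lemma singular_zero:
  assumes nonneg: "\<And>x y. (x, y) \<in> \<Omega> \<Longrightarrow> value_at F b x y \<ge> 0" and xy: "(x0, y0) \<in> Z b"
  shows "value_at (pderiv_x F) b x0 y0 = 0" "value_at (pderiv F) b x0 y0 = 0"
proof -
  have 0: "value_at F b x0 y0 = 0" "(x0, y0) \<in> \<Omega>" using xy by (auto simp: Z_iff)
  obtain r where r: "r > 0" "\<And>x y. \<bar>x - x0\<bar> < r \<Longrightarrow> \<bar>y - y0\<bar> < r \<Longrightarrow> (x, y) \<in> \<Omega>"
    using box_in_Omega[OF 0(2)] by blast
  show "value_at (pderiv_x F) b x0 y0 = 0"
    by (rule DERIV_local_min[OF DERIV_value_at_x r(1)]) (use r nonneg 0 in \<open>auto simp: abs_minus_commute\<close>)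
  show "value_at (pderiv F) b x0 y0 = 0"
    by (rule DERIV_local_min[OF DERIV_value_at_y r(1)]) (use r nonneg 0 in \<open>auto simp: abs_minus_commute\<close>)
qed

text \<open>A zero is an interior minimum, hence singular, hence a double root of \<open>D\<close>.
  Formal degree at least 2 contradicts \<open>disc\<close>, and in degree 0 the specialization is a
  nonzero constant.\<close>

lemma nonneg_zero_discriminant:
  assumes b: "b \<in> I" and disc: "poly (discriminant D) b \<noteq> 0"
    and nonneg: "\<And>x y. (x, y) \<in> \<Omega> \<Longrightarrow> value_at F b x y \<ge> 0" and xy: "(x0, y0) \<in> Z b"
  shows "degree F \<ge> 2" "degree D = 1"
proof -
  note sing = singular_zero[OF nonneg xy]
  show deg: "degree F \<ge> 2" by (rule critical_point_discriminant[OF b xy sing(2)])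
  have sq: "[:-x0, 1:]\<^sup>2 dvd (specialize b D :: real poly)"
    using discriminant_sq_dvd_singular[OF deg _ sing(2)] sing xy by (auto simp: Z_iff)
  have "\<not> degree D \<ge> 2" using discriminant2_zero_double_root[of D b x0] sq_dvd_imp_double_root[OF sq] disc by blast
  moreover have "degree D \<noteq> 0"
  proof
    assume "degree D = 0"
    from discriminant2_const[OF disc this] obtain c where "c \<noteq> 0" "\<And>b. specialize b D = ([:of_real c:] :: real poly)" by metis
    then show False using sq_not_dvd_linear[OF sq] by auto
  qed
  ultimately show "degree D = 1" by linarith
qed

end

section \<open>Sections of an unramified family of roots\<close>

lemma value_at_of_real: "value_at F b (of_real x) (of_real y) = (of_real (value_at F b x y) :: 'a::real_normed_field)"
  unfolding value_at_sum poly_specialize_sum by simp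

lemma value_at_cnj: "value_at F b (cnj x) (cnj y) = cnj (value_at F b x y)"
  unfolding value_at_sum poly_specialize_sum by simp

section \<open>Localization of complex roots\<close>

lemma eventually_norm_gt_on_compact:
  fixes f :: "'s::metric_space \<Rightarrow> 'a::metric_space \<Rightarrow> 'b::real_normed_vector"
  assumes K: "compact K" and cont: "continuous_on UNIV (\<lambda>(s, y). f s y)"
    and gt: "\<And>y. y \<in> K \<Longrightarrow> norm (f s0 y) > B"
  shows "\<forall>\<^sub>F s in nhds s0. \<forall>y\<in>K. norm (f s y) > B"
proof (rule ccontr)
  assume "\<not> ?thesis"
  then have "\<exists>s. dist s s0 < inverse (real (Suc n)) \<and> (\<exists>y\<in>K. norm (f s y) \<le> B)" for n
    unfolding eventually_nhds_metric by (metis not_less inverse_positive_iff_positive of_nat_0_less_iff zero_less_Suc)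
  then obtain s y where s: "\<And>n. dist (s n) s0 < inverse (real (Suc n))" and y: "\<And>n. y n \<in> K" "\<And>n. norm (f (s n) (y n)) \<le> B"
    by metis
  obtain l r where l: "l \<in> K" "strict_mono (r :: nat \<Rightarrow> nat)" "(y \<circ> r) \<longlonglongrightarrow> l"
    using K y(1) unfolding compact_def by metis
  have "s \<longlonglongrightarrow> s0"
  proof (rule metric_LIMSEQ_I)
    fix d :: real assume "d > 0"
    then obtain N where N: "inverse (real (Suc N)) < d" using reals_Archimedean by blast
    have "dist (s n) s0 < d" if "n \<ge> N" for n
    proof -
      have "inverse (real (Suc n)) \<le> inverse (real (Suc N))" using that by (intro le_imp_inverse_le) auto
      then show ?thesis using s[of n] N by linarith
    qed
    then show "\<exists>N. \<forall>n\<ge>N. dist (s n) s0 < d" by blast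
  qed
  then have "(s \<circ> r) \<longlonglongrightarrow> s0" using l(2) by (rule LIMSEQ_subseq_LIMSEQ)
  then have "(\<lambda>n. ((s \<circ> r) n, (y \<circ> r) n)) \<longlonglongrightarrow> (s0, l)" using l(3) by (rule tendsto_Pair)
  moreover have "isCont (\<lambda>(s, y). f s y) (s0, l)" using cont by (simp add: continuous_on_eq_continuous_at)
  ultimately have "(\<lambda>n. case ((s \<circ> r) n, (y \<circ> r) n) of (s, y) \<Rightarrow> f s y) \<longlonglongrightarrow> (case (s0, l) of (s, y) \<Rightarrow> f s y)"
    by (rule isCont_tendsto_compose[rotated])
  then have "(\<lambda>n. norm (f (s (r n)) (y (r n)))) \<longlonglongrightarrow> norm (f s0 l)" by (auto simp: o_def intro: tendsto_norm)
  then have "norm (f s0 l) \<le> B" by (rule LIMSEQ_le_const2) (use y(2) in auto)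
  with gt[OF l(1)] show False by simp
qed

text \<open>Without a zero, the maximum modulus principle for the inverse of \<open>f\<close>
  contradicts the smaller value at the centre.\<close>

lemma holomorphic_zero_in_ball:
  assumes hol: "f holomorphic_on UNIV" and r: "r > 0"
    and B: "\<And>y. dist c y = r \<Longrightarrow> norm (f y) > B" "norm (f c) < B"
  shows "\<exists>y\<in>ball c r. f y = 0"
proof (rule ccontr)
  assume "\<not> ?thesis"
  have B0: "B > 0" using B(2) norm_ge_zero[of "f c"] by linarith
  have nz: "f y \<noteq> 0" if "y \<in> cball c r" for y
  proof (cases "dist c y = r")
    case True
    then show ?thesis using B(1)[of y] B0 by auto
  next
    case False
    then show ?thesis using that \<open>\<not> (\<exists>y\<in>ball c r. f y = 0)\<close> by auto
  qed
  have hol': "(\<lambda>y. inverse (f y)) holomorphic_on cball c r"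
    by (intro holomorphic_on_inverse holomorphic_on_subset[OF hol]) (use nz in auto)
  have "norm (inverse (f c)) \<le> inverse B"
  proof (rule maximum_modulus_frontier[of "\<lambda>y. inverse (f y)" "cball c r"])
    show "norm (inverse (f z)) \<le> inverse B" if "z \<in> frontier (cball c r)" for z
    proof -
      have "norm (f z) > B" using that r by (intro B) auto
      then show ?thesis using B0 by (simp add: norm_inverse le_imp_inverse_le)
    qed
  qed (use hol' r in \<open>auto intro: holomorphic_on_subset holomorphic_on_imp_continuous_on\<close>)
  moreover have "norm (inverse (f c)) > inverse B"
    using B(2) nz[of c] r by (simp add: norm_inverse less_imp_inverse_less)
  ultimately show False by simp
qed

lemma holomorphic_value_at: "value_at F b x holomorphic_on S"
  unfolding holomorphic_on_def field_differentiable_def using DERIV_value_at_y by blast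

text \<open>The divided difference in the last variable, written as a polynomial so that it remains
  continuous across \<open>y = y'\<close>.\<close>

definition value_quotient :: "real poly poly poly \<Rightarrow> real \<Rightarrow> complex \<Rightarrow> complex \<Rightarrow> complex \<Rightarrow> complex" where
  "value_quotient F b x y y' = (\<Sum>j\<le>degree F. poly (specialize b (coeff F j)) x * (\<Sum>i<j. y' ^ (j - Suc i) * y ^ i))"

lemma value_at_diff: "value_at F b x y - value_at F b x y' = (y - y') * value_quotient F b x y y'"
proof -
  have "value_at F b x y - value_at F b x y' = (\<Sum>j\<le>degree F. poly (specialize b (coeff F j)) x * (y ^ j - y' ^ j))"
    by (simp add: value_at_sum right_diff_distrib sum_subtractf)
  then show ?thesis
    by (simp add: value_quotient_def power_diff_sumr2 sum_distrib_left algebra_simps)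
qed

lemma continuous_on_value_quotient [continuous_intros]:
  assumes "continuous_on S f" "continuous_on S g" "continuous_on S h"
  shows "continuous_on S (\<lambda>s. value_quotient F b (f s) (g s) (h s))"
  unfolding value_quotient_def by (intro continuous_intros assms)

lemma tendsto_value_quotient:
  assumes "(f \<longlongrightarrow> x) A" "(g \<longlongrightarrow> y) A" "(h \<longlongrightarrow> z) A"
  shows "((\<lambda>s. value_quotient F b (f s) (g s) (h s)) \<longlongrightarrow> value_quotient F b x y z) A"
  unfolding value_quotient_def by (intro tendsto_intros assms)

lemma value_quotient_diag: "value_quotient F b x y y = value_at (pderiv F) b x y"
proof -
  have "((\<lambda>y. value_at F b x y) has_field_derivative value_quotient F b x y y) (at y)"
    unfolding has_field_derivative_iff
  proof (rule Lim_transform_eventually)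
    show "((\<lambda>z. value_quotient F b x z y) \<longlongrightarrow> value_quotient F b x y y) (at y)"
      by (intro tendsto_value_quotient tendsto_intros)
    show "\<forall>\<^sub>F z in at y. value_quotient F b x z y = (value_at F b x z - value_at F b x y) / (z - y)"
      by (auto simp: eventually_at value_at_diff intro!: exI[of _ 1])
  qed
  then show ?thesis using DERIV_unique DERIV_value_at_y by blast
qed

text \<open>Near a simple root the divided difference is bounded below by \<open>c\<close>, half the
  modulus of the derivative. This bound yields both uniqueness of the nearby root and its continuity
  in \<open>x'\<close>.\<close>

lemma simple_root_nbhd:
  assumes 0: "value_at F b x y = 0" "value_at (pderiv F) b x y \<noteq> 0" and r: "r > 0"
  obtains \<eta> \<epsilon> c where "0 < \<eta>" "\<eta> < r" "0 < \<epsilon>" "0 < c"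
    "\<And>x' y1 y2. x' \<in> ball x \<epsilon> \<Longrightarrow> y1 \<in> ball y \<eta> \<Longrightarrow> y2 \<in> ball y \<eta> \<Longrightarrow> norm (value_quotient F b x' y1 y2) \<ge> c"
    "\<And>x'. x' \<in> ball x \<epsilon> \<Longrightarrow> \<exists>y'\<in>ball y \<eta>. value_at F b x' y' = 0"
proof -
  define c where "c = norm (value_at (pderiv F) b x y) / 2"
  have c: "c > 0" using 0 by (simp add: c_def)
  have id: "((\<lambda>p. p) \<longlongrightarrow> (x, y, y)) (nhds (x, y, y))" by (rule filterlim_ident)
  have "((\<lambda>(u, v, w). norm (value_quotient F b u v w)) \<longlongrightarrow> norm (value_quotient F b x y y)) (nhds (x, y, y))"
    unfolding case_prod_unfold
    using tendsto_fst[OF id] tendsto_fst[OF tendsto_snd[OF id]] tendsto_snd[OF tendsto_snd[OF id]]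
    by (intro tendsto_norm tendsto_value_quotient) simp_all
  then have "\<forall>\<^sub>F p in nhds (x, y, y). (case p of (u, v, w) \<Rightarrow> norm (value_quotient F b u v w)) > c"
    by (rule order_tendstoD) (use c in \<open>auto simp: value_quotient_diag c_def\<close>)
  then obtain P Q where P: "eventually P (nhds x)" and Q: "eventually Q (nhds (y, y))"
      and PQ: "\<And>u v w. P u \<Longrightarrow> Q (v, w) \<Longrightarrow> norm (value_quotient F b u v w) > c"
    unfolding nhds_prod[of x "(y, y)"] eventually_prod_filter by auto
  from Q obtain Q1 Q2 where Q12: "eventually Q1 (nhds y)" "eventually Q2 (nhds y)" "\<And>v w. Q1 v \<Longrightarrow> Q2 w \<Longrightarrow> Q (v, w)"
    unfolding nhds_prod eventually_prod_filter by auto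
  obtain \<epsilon>1 where e1: "\<epsilon>1 > 0" "\<And>u. dist u x < \<epsilon>1 \<Longrightarrow> P u" using P unfolding eventually_nhds_metric by blast
  from eventually_conj[OF Q12(1,2)] obtain e2 where e2: "e2 > 0" "\<And>v. dist v y < e2 \<Longrightarrow> Q1 v \<and> Q2 v"
    unfolding eventually_nhds_metric by blast
  define \<eta> where "\<eta> = min r e2 / 2"
  have \<eta>: "0 < \<eta>" "\<eta> < r" "\<eta> < e2" using r e2 by (auto simp: \<eta>_def min_def)
  have dq: "norm (value_quotient F b x' y1 y2) > c" if "dist x' x < \<epsilon>1" "dist y1 y \<le> \<eta>" "dist y2 y \<le> \<eta>" for x' y1 y2
    using that \<eta> e1 e2 Q12(3) PQ by simp
  have "\<forall>\<^sub>F x' in nhds x. \<forall>v\<in>sphere y \<eta>. norm (value_at F b x' v) > c * \<eta> / 2"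
  proof (rule eventually_norm_gt_on_compact)
    show "continuous_on UNIV (\<lambda>(s, y). value_at F b s y)" unfolding case_prod_unfold by (intro continuous_intros)
    fix v assume v: "v \<in> sphere y \<eta>"
    \<comment> \<open>On the sphere the modulus exceeds \<open>c * \<eta>\<close> and at the centre
      it is 0, so the threshold \<open>c * \<eta> / 2\<close> separates them also for nearby
      \<open>x'\<close>.\<close>
    have "norm (value_at F b x v) = \<eta> * norm (value_quotient F b x v y)"
      using value_at_diff[of F b x v y] v 0 by (simp add: norm_mult dist_norm norm_minus_commute)
    moreover have "norm (value_quotient F b x v y) > c" using v \<eta> e1 by (intro dq) (auto simp: dist_commute)
    ultimately have "norm (value_at F b x v) > \<eta> * c" using \<eta> by simp
    moreover have "c * \<eta> / 2 < \<eta> * c" using c \<eta> by (simp add: field_simps)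
    ultimately show "norm (value_at F b x v) > c * \<eta> / 2" by linarith
  qed simp
  moreover have "\<forall>\<^sub>F x' in nhds x. norm (value_at F b x' y) < c * \<eta> / 2"
  proof (rule order_tendstoD(2))
    show "((\<lambda>x'. norm (value_at F b x' y)) \<longlongrightarrow> norm (value_at F b x y)) (nhds x)"
      by (intro tendsto_norm tendsto_value_at tendsto_const filterlim_ident)
  qed (use 0 c \<eta> in auto)
  ultimately have "\<forall>\<^sub>F x' in nhds x. \<exists>y'\<in>ball y \<eta>. value_at F b x' y' = 0"
    by eventually_elim (rule holomorphic_zero_in_ball[OF holomorphic_value_at \<eta>(1), where B = "c * \<eta> / 2"], auto)
  then obtain \<epsilon>2 where e3: "\<epsilon>2 > 0" "\<And>x'. dist x' x < \<epsilon>2 \<Longrightarrow> \<exists>y'\<in>ball y \<eta>. value_at F b x' y' = 0"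
    unfolding eventually_nhds_metric by blast
  show thesis
    by (rule that[of \<eta> "min \<epsilon>1 \<epsilon>2" c])
       (use \<eta> e1 e3 c dq in \<open>auto simp: dist_commute less_imp_le\<close>)
qed

section \<open>The covering formed by simple roots\<close>

text \<open>No root crosses the sphere of radius \<open>\<rho>\<close> and none ramifies, so the
  roots in the ball form a covering of the disc around \<open>x0\<close>.\<close>

locale simple_roots =
  fixes F :: "real poly poly poly" and b :: real and x0 y0 :: complex and \<delta> \<rho> :: real
  assumes \<delta>: "\<delta> > 0" and \<rho>: "\<rho> > 0"
    and boundary: "\<And>x y. x \<in> ball x0 \<delta> \<Longrightarrow> dist y0 y = \<rho> \<Longrightarrow> value_at F b x y \<noteq> 0"
    and simple: "\<And>x y. x \<in> ball x0 \<delta> \<Longrightarrow> y \<in> ball y0 \<rho> \<Longrightarrow> value_at F b x y = 0 \<Longrightarrow> value_at (pderiv F) b x y \<noteq> 0"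
    and nonempty: "\<exists>y\<in>ball y0 \<rho>. value_at F b x0 y = 0"
begin

definition E :: "(complex \<times> complex) set" where
  "E = {(x, y). x \<in> ball x0 \<delta> \<and> y \<in> ball y0 \<rho> \<and> value_at F b x y = 0}"

text \<open>Each root over \<open>x\<close> gets a small ball holding exactly one root over every
  nearby \<open>x'\<close>, and no other roots occur. The sheets are the parts of \<open>E\<close>
  over \<open>T\<close> in these balls.\<close>

lemma evenly_covered:
  assumes x: "x \<in> ball x0 \<delta>"
  shows "\<exists>T v. x \<in> T \<and> open T \<and> T \<subseteq> ball x0 \<delta> \<and> \<Union>v = E \<inter> fst -` T \<and>
    (\<forall>u\<in>v. openin (top_of_set E) u) \<and> pairwise disjnt v \<and> (\<forall>u\<in>v. \<exists>q. homeomorphism u T fst q)"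
proof -
  define S where "S = {y \<in> ball y0 \<rho>. value_at F b x y = 0}"
  have "fibre F b x \<noteq> 0"
    using boundary[OF x, of "y0 + of_real \<rho>"] \<rho> by (auto simp: value_at_fibre dist_norm)
  then have "finite {y. value_at F b x y = 0}" unfolding value_at_fibre by (rule poly_roots_finite)
  then have finS: "finite S" by (rule rev_finite_subset) (auto simp: S_def)
  have "\<exists>e>0. \<forall>w\<in>ball y e. w \<in> ball y0 \<rho> \<and> (w \<noteq> y \<longrightarrow> w \<notin> S)" if "y \<in> S" for y
    using finite_ball_avoid[of "ball y0 \<rho>" S y] finS that by (auto simp: S_def)
  then obtain e where e: "\<And>y. y \<in> S \<Longrightarrow> e y > 0" "\<And>y w. y \<in> S \<Longrightarrow> w \<in> ball y (e y) \<Longrightarrow> w \<in> ball y0 \<rho> \<and> (w \<noteq> y \<longrightarrow> w \<notin> S)"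
    by metis
  \<comment> \<open>Balls of radius below \<open>r\<close> around different roots are disjoint. The
    inserted 1 covers the case that \<open>S\<close> is empty.\<close>
  define r where "r = Min (insert 1 (e ` S)) / 2"
  have r: "r > 0" using finS e(1) by (auto simp: r_def)
  have re: "2 * r \<le> e y" if "y \<in> S" for y using finS that by (auto simp: r_def)
  have sep: "2 * r \<le> dist y y'" if "y \<in> S" "y' \<in> S" "y \<noteq> y'" for y y'
    using e(2)[OF that(1), of y'] that re[OF that(1)] by force
  have "\<exists>\<eta> \<epsilon> c. 0 < \<eta> \<and> \<eta> < r \<and> 0 < \<epsilon> \<and> 0 < c \<and>
      (\<forall>x'\<in>ball x \<epsilon>. \<forall>y1\<in>ball y \<eta>. \<forall>y2\<in>ball y \<eta>. norm (value_quotient F b x' y1 y2) \<ge> c) \<and>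
      (\<forall>x'\<in>ball x \<epsilon>. \<exists>y'\<in>ball y \<eta>. value_at F b x' y' = 0)" if "y \<in> S" for y
  proof -
    have "value_at F b x y = 0" "value_at (pderiv F) b x y \<noteq> 0" using simple[OF x] that by (auto simp: S_def)
    from simple_root_nbhd[OF this r] show ?thesis by metis
  qed
  then obtain \<eta> \<epsilon> c where loc: "\<And>y. y \<in> S \<Longrightarrow> 0 < \<eta> y \<and> \<eta> y < r \<and> 0 < \<epsilon> y \<and> (0::real) < c y"
      "\<And>y x' y1 y2. y \<in> S \<Longrightarrow> x' \<in> ball x (\<epsilon> y) \<Longrightarrow> y1 \<in> ball y (\<eta> y) \<Longrightarrow> y2 \<in> ball y (\<eta> y) \<Longrightarrow> norm (value_quotient F b x' y1 y2) \<ge> c y"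
      "\<And>y x'. y \<in> S \<Longrightarrow> x' \<in> ball x (\<epsilon> y) \<Longrightarrow> \<exists>y'\<in>ball y (\<eta> y). value_at F b x' y' = 0"
    by metis
  \<comment> \<open>The closed ball outside the chosen neighbourhoods: free of roots at
    \<open>x\<close>, hence by compactness also near \<open>x\<close>.\<close>
  define K where "K = cball y0 \<rho> - (\<Union>y\<in>S. ball y (\<eta> y))"
  have "compact K" unfolding K_def by (intro compact_diff compact_cball open_UN ballI open_ball)
  moreover have "continuous_on UNIV (\<lambda>(s, y). value_at F b s y)" unfolding case_prod_unfold by (intro continuous_intros)
  moreover have "norm (value_at F b x y) > 0" if "y \<in> K" for y
  proof -
    have "y \<notin> S" using that loc(1) by (auto simp: K_def)
    moreover have "dist y0 y \<noteq> \<rho> \<Longrightarrow> y \<in> ball y0 \<rho>" using that by (auto simp: K_def)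
    ultimately show ?thesis using boundary[OF x, of y] by (auto simp: S_def)
  qed
  ultimately have "\<forall>\<^sub>F x' in nhds x. \<forall>y\<in>K. norm (value_at F b x' y) > 0" by (rule eventually_norm_gt_on_compact)
  then obtain \<epsilon>' where e': "\<epsilon>' > 0" "\<And>x' y. dist x' x < \<epsilon>' \<Longrightarrow> y \<in> K \<Longrightarrow> value_at F b x' y \<noteq> 0"
    unfolding eventually_nhds_metric by auto
  define \<epsilon>0 where "\<epsilon>0 = Min (insert \<epsilon>' (\<epsilon> ` S))"
  have e0: "\<epsilon>0 > 0" using finS loc(1) e' by (auto simp: \<epsilon>0_def)
  have e0': "\<epsilon>0 \<le> \<epsilon>'" "\<And>y. y \<in> S \<Longrightarrow> \<epsilon>0 \<le> \<epsilon> y" using finS by (auto simp: \<epsilon>0_def)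
  define T where "T = ball x \<epsilon>0 \<inter> ball x0 \<delta>"
  define u where "u = (\<lambda>y. E \<inter> (T \<times> ball y (\<eta> y)))"
  have Tsub: "T \<subseteq> ball x (\<epsilon> y)" if "y \<in> S" for y using e0'(2)[OF that] by (auto simp: T_def)
  have inball: "y' \<in> ball y0 \<rho>" if "y \<in> S" "y' \<in> ball y (\<eta> y)" for y y'
    using e(2)[OF that(1), of y'] re[OF that(1)] loc(1)[OF that(1)] that r by auto
  show ?thesis
  proof (intro exI[of _ T] exI[of _ "u ` S"] conjI ballI)
    show "x \<in> T" "open T" "T \<subseteq> ball x0 \<delta>" using x e0 by (auto simp: T_def)
    show "\<Union> (u ` S) = E \<inter> fst -` T"
    proof (intro equalityI subsetI)
      fix p assume p: "p \<in> E \<inter> fst -` T"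
      obtain x' y' where p_eq: "p = (x', y')" by (cases p)
      have "y' \<notin> K" using p e'(2)[of x' y'] e0'(1) by (auto simp: p_eq E_def T_def dist_commute)
      then obtain y where "y \<in> S" "y' \<in> ball y (\<eta> y)" using p by (auto simp: K_def p_eq E_def)
      then show "p \<in> \<Union> (u ` S)" using p by (auto simp: u_def p_eq)
    qed (auto simp: u_def)
    show "openin (top_of_set E) w" if "w \<in> u ` S" for w
      using that unfolding u_def by (auto simp: T_def intro!: openin_open_Int open_Times)
    show "pairwise disjnt (u ` S)"
    proof (rule pairwiseI)
      fix w1 w2 assume w: "w1 \<in> u ` S" "w2 \<in> u ` S" "w1 \<noteq> w2"
      then obtain y1 y2 where y: "y1 \<in> S" "y2 \<in> S" "w1 = u y1" "w2 = u y2" "y1 \<noteq> y2" by auto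
      show "disjnt w1 w2"
        unfolding disjnt_iff
      proof safe
        fix a z assume "(a, z) \<in> w1" "(a, z) \<in> w2"
        then have "dist y1 z < r" "dist y2 z < r" using y loc(1)[OF y(1)] loc(1)[OF y(2)] by (auto simp: u_def)
        then have "dist y1 y2 < 2 * r" using dist_triangle2[of y1 y2 z] by simp
        then show False using sep[OF y(1,2,5)] by simp
      qed
    qed
    show "\<exists>q. homeomorphism w T fst q" if w: "w \<in> u ` S" for w
    proof -
      obtain y where y: "y \<in> S" "w = u y" using w by auto
      have "\<exists>y'\<in>ball y (\<eta> y). value_at F b x' y' = 0" if "x' \<in> T" for x'
        using loc(3)[OF y(1)] Tsub[OF y(1)] that by blast
      then obtain \<phi> where \<phi>: "\<And>x'. x' \<in> T \<Longrightarrow> \<phi> x' \<in> ball y (\<eta> y)" "\<And>x'. x' \<in> T \<Longrightarrow> value_at F b x' (\<phi> x') = 0"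
        by metis
      \<comment> \<open>Gives uniqueness of the root \<open>\<phi> x'\<close> in its ball, and
        continuity of \<open>\<phi>\<close> by comparison with the fixed value
        \<open>\<phi> a\<close>.\<close>
      have est: "c y * norm (y1 - y2) \<le> norm (value_at F b x' y1 - value_at F b x' y2)"
        if "x' \<in> T" "y1 \<in> ball y (\<eta> y)" "y2 \<in> ball y (\<eta> y)" for x' y1 y2
      proof -
        have "c y \<le> norm (value_quotient F b x' y1 y2)" using loc(2)[OF y(1)] Tsub[OF y(1)] that by blast
        from mult_left_mono[OF this norm_ge_zero[of "y1 - y2"]] show ?thesis
          by (simp add: value_at_diff norm_mult mult.commute)
      qed
      have cy: "c y > 0" using loc(1)[OF y(1)] by simp
      have uniq: "y1 = \<phi> x'" if "x' \<in> T" "y1 \<in> ball y (\<eta> y)" "value_at F b x' y1 = 0" for x' y1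
        using est[OF that(1,2) \<phi>(1)[OF that(1)]] that \<phi>(2)[OF that(1)] cy by (simp add: mult_le_0_iff)
      have cont: "continuous_on T \<phi>"
        unfolding continuous_on_def
      proof
        fix a assume a: "a \<in> T"
        have "((\<lambda>x'. norm (value_at F b x' (\<phi> a)) / c y) \<longlongrightarrow> norm (value_at F b a (\<phi> a)) / c y) (at a within T)"
          using cy by (intro tendsto_intros) auto
        then have lim: "((\<lambda>x'. norm (value_at F b x' (\<phi> a)) / c y) \<longlongrightarrow> 0) (at a within T)" by (simp add: \<phi>(2)[OF a])
        have "((\<lambda>x'. \<phi> x' - \<phi> a) \<longlongrightarrow> 0) (at a within T)"
        proof (rule Lim_null_comparison[OF _ lim])
          have "norm (\<phi> x' - \<phi> a) \<le> norm (value_at F b x' (\<phi> a)) / c y" if "x' \<in> T" for x'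
            using est[OF that \<phi>(1)[OF that] \<phi>(1)[OF a]] \<phi>(2)[OF that] cy by (simp add: field_simps)
          then show "\<forall>\<^sub>F x' in at a within T. norm (\<phi> x' - \<phi> a) \<le> norm (value_at F b x' (\<phi> a)) / c y"
            by (auto simp: eventually_at_filter)
        qed
        then show "(\<phi> \<longlongrightarrow> \<phi> a) (at a within T)" by (rule LIM_zero_cancel)
      qed
      have inw: "(x', \<phi> x') \<in> w" if "x' \<in> T" for x'
        using that \<phi> inball[OF y(1)] by (auto simp: y u_def E_def T_def)
      have "homeomorphism w T fst (\<lambda>x'. (x', \<phi> x'))"
        unfolding homeomorphism_def
      proof (intro conjI ballI)
        have *: "fst p \<in> T \<and> (fst p, \<phi> (fst p)) = p" if "p \<in> w" for p
          using that uniq by (cases p) (auto simp: y u_def E_def)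
        then show "\<And>p. p \<in> w \<Longrightarrow> (fst p, \<phi> (fst p)) = p" by blast
        show "fst ` w = T" using * inw by force
        show "(\<lambda>x'. (x', \<phi> x')) ` T = w" using * inw by force
      qed (auto intro!: continuous_intros cont)
      then show ?thesis by blast
    qed
  qed
qed

text \<open>Surjectivity: over each \<open>T\<close> there is either a sheet covering all of
  \<open>T\<close> or no root at all. The image is thus clopen in the connected disc, and nonempty
  by \<open>nonempty\<close>.\<close>

lemma covering_space_E: "covering_space E fst (ball x0 \<delta>)"
proof
  show "continuous_on E fst" by (intro continuous_intros)
  let ?P = "fst ` E" and ?B = "ball x0 \<delta>"
  have sub: "?P \<subseteq> ?B" by (auto simp: E_def)
  have loc: "\<exists>T. x \<in> T \<and> open T \<and> T \<subseteq> ?B \<and> (T \<subseteq> ?P \<or> T \<inter> ?P = {})" if x: "x \<in> ?B" for x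
  proof -
    from evenly_covered[OF x] obtain T v where T: "x \<in> T" "open T" "T \<subseteq> ?B" "\<Union>v = E \<inter> fst -` T"
      "\<forall>u\<in>v. \<exists>q. homeomorphism u T fst q" by blast
    have "T \<subseteq> ?P" if ne: "v \<noteq> {}"
    proof -
      obtain u q where u: "u \<in> v" "homeomorphism u T fst q" using ne T(5) by blast
      then have "T = fst ` u" by (simp add: homeomorphism_def)
      moreover have "u \<subseteq> E" using u(1) T(4) by blast
      ultimately show ?thesis by blast
    qed
    moreover have "T \<inter> ?P = {}" if "v = {}" using that T(4) by auto
    ultimately show ?thesis using T(1,2,3) by blast
  qed
  have "open ?P"
  proof (subst open_subopen, rule ballI)
    fix x assume "x \<in> ?P"
    then show "\<exists>T. open T \<and> x \<in> T \<and> T \<subseteq> ?P" using loc[of x] sub by blast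
  qed
  moreover have "open (?B - ?P)"
  proof (subst open_subopen, rule ballI)
    fix x assume "x \<in> ?B - ?P"
    then show "\<exists>T. open T \<and> x \<in> T \<and> T \<subseteq> ?B - ?P" using loc[of x] by blast
  qed
  moreover have "?P \<noteq> {}" using nonempty \<delta> by (force simp: E_def)
  moreover have "connected ?B" by simp
  ultimately show "?P = ?B" using sub unfolding connected_def by blast
  fix x assume x: "x \<in> ?B"
  from evenly_covered[OF x] obtain T v where T: "x \<in> T" "open T" "T \<subseteq> ?B" "\<Union>v = E \<inter> fst -` T"
    "\<forall>u\<in>v. openin (top_of_set E) u" "pairwise disjnt v" "\<forall>u\<in>v. \<exists>q. homeomorphism u T fst q" by blast
  moreover have "openin (top_of_set ?B) T" using T(2,3) by (metis openin_open_eq open_ball)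
  ultimately show "\<exists>T. x \<in> T \<and> openin (top_of_set ?B) T \<and> (\<exists>v. \<Union>v = E \<inter> fst -` T \<and>
      (\<forall>u\<in>v. openin (top_of_set E) u) \<and> pairwise disjnt v \<and> (\<forall>u\<in>v. \<exists>q. homeomorphism u T fst q))"
    by blast
qed

lemma section_unique:
  assumes g: "continuous_on (ball x0 \<delta>) g" "\<And>x. x \<in> ball x0 \<delta> \<Longrightarrow> (x, g x) \<in> E"
    and h: "continuous_on (ball x0 \<delta>) h" "\<And>x. x \<in> ball x0 \<delta> \<Longrightarrow> (x, h x) \<in> E"
    and a: "a \<in> ball x0 \<delta>" "g a = h a" and x: "x \<in> ball x0 \<delta>"
  shows "g x = h x"
proof -
  have "(x, g x) = (x, h x)"
    by (rule covering_space_lift_unique[OF covering_space_E, of "\<lambda>x. (x, g x)" a "\<lambda>x. (x, h x)" "ball x0 \<delta>" "\<lambda>x. x"])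
       (use assms in \<open>auto intro!: continuous_intros\<close>)
  then show ?thesis by simp
qed

text \<open>The disc is simply connected, so its identity map lifts through the covering with
  prescribed value over \<open>x0\<close>.\<close>

lemma section_exists:
  assumes y1: "y1 \<in> ball y0 \<rho>" "value_at F b x0 y1 = 0"
  obtains g where "g holomorphic_on ball x0 \<delta>" "g x0 = y1" "\<And>x. x \<in> ball x0 \<delta> \<Longrightarrow> (x, g x) \<in> E"
proof -
  have a: "(x0, y1) \<in> E" using y1 \<delta> by (simp add: E_def)
  have x0: "x0 \<in> ball x0 \<delta>" using \<delta> by simp
  obtain L where L: "continuous_on (ball x0 \<delta>) L" "L \<in> ball x0 \<delta> \<rightarrow> E" "L x0 = (x0, y1)" "\<And>x. x \<in> ball x0 \<delta> \<Longrightarrow> fst (L x) = x"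
    by (rule covering_space_lift_strong[OF covering_space_E a x0, of "\<lambda>x. x"])
       (auto intro: convex_imp_simply_connected convex_imp_locally_path_connected)
  define g where "g = (\<lambda>x. snd (L x))"
  have gE: "(x, g x) \<in> E" if "x \<in> ball x0 \<delta>" for x
    using L(2,4) that by (metis Pi_iff g_def prod.collapse)
  have cont: "continuous_on (ball x0 \<delta>) g" unfolding g_def by (intro continuous_intros L)
  have "g field_differentiable (at x)" if x: "x \<in> ball x0 \<delta>" for x
  proof -
    have gx: "value_at F b x (g x) = 0" "value_at (pderiv F) b x (g x) \<noteq> 0"
      using gE[OF x] simple[OF x] by (auto simp: E_def)
    obtain R where R: "\<And>z. value_at F b z (g x) - value_at F b x (g x) = R z * (z - x)" "isCont R x"
      using DERIV_value_at_x[of F b "g x" x UNIV] unfolding CARAT_DERIV by auto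
    have "isCont g x" using cont x by (simp add: continuous_on_eq_continuous_at)
    then have lim: "((\<lambda>z. value_quotient F b z (g z) (g x)) \<longlongrightarrow> value_quotient F b x (g x) (g x)) (at x)"
      by (intro tendsto_value_quotient tendsto_intros) (auto simp: isCont_def)
    have nz: "\<forall>\<^sub>F z in at x. value_quotient F b z (g z) (g x) \<noteq> 0"
      by (rule tendsto_imp_eventually_ne[OF lim]) (simp add: value_quotient_diag gx)
    \<comment> \<open>Implicit differentiation: \<open>R\<close> is the slope in the first variable,
      the divided difference is the slope in the second, and both values of the member along
      \<open>g\<close> are 0.\<close>
    have "(g has_field_derivative - R x / value_quotient F b x (g x) (g x)) (at x)"
      unfolding has_field_derivative_iff
    proof (rule Lim_transform_eventually)
      show "((\<lambda>z. - R z / value_quotient F b z (g z) (g x)) \<longlongrightarrow> - R x / value_quotient F b x (g x) (g x)) (at x)"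
        using R(2) by (intro tendsto_intros lim) (auto simp: isCont_def value_quotient_diag gx)
      have "\<forall>\<^sub>F z in at x. z \<in> ball x0 \<delta>" using x by (intro eventually_at_in_open') auto
      moreover have "\<forall>\<^sub>F z in at x. z \<noteq> x" by (simp add: eventually_at_filter)
      ultimately show "\<forall>\<^sub>F z in at x. - R z / value_quotient F b z (g z) (g x) = (g z - g x) / (z - x)"
        using nz
      proof eventually_elim
        case (elim z)
        have "value_at F b z (g z) = 0" using gE[OF elim(1)] by (simp add: E_def)
        then have "(g z - g x) * value_quotient F b z (g z) (g x) = - (R z * (z - x))"
          using value_at_diff[of F b z "g z" "g x"] R(1)[of z] gx by (simp add: algebra_simps)
        then show ?case using elim by (simp add: field_simps)
      qed
    qed
    then show ?thesis unfolding field_differentiable_def by blast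
  qed
  then have "g holomorphic_on ball x0 \<delta>" by (simp add: holomorphic_on_open field_differentiable_def open_ball)
  then show thesis using that[of g] gE L(3) by (simp add: g_def)
qed

end

section \<open>Zeros cannot appear in the interior\<close>

context curve_family
begin

text \<open>A nonzero real polynomial \<open>D\<close> of degree at most 1 has at most one root, and
  it is real. If \<open>y\<close> were not real, \<open>y\<close> and its conjugate would be two
  double roots over the same \<open>x\<close>, giving \<open>D\<close> a double root.\<close>

lemma double_root_linear_discriminant:
  fixes x y :: complex
  assumes D: "degree D = 1" "specialize b D \<noteq> (0 :: complex poly)" and deg: "degree F \<ge> 2"
    and 0: "value_at F b x y = 0" "value_at (pderiv F) b x y = 0"
  obtains u v where "x = of_real u" "y = of_real v" "value_at F b u v = 0"
proof -
  have x: "x \<in> \<real>"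
  proof -
    define a0 a1 where "a0 = poly (coeff D 0) b" and "a1 = poly (coeff D 1) b"
    have s: "specialize b D = [:of_real a0, of_real a1 :: complex:]" unfolding a0_def a1_def by (rule discriminant2_linear[OF D(1)])
    have e: "of_real a0 + x * of_real a1 = 0" using discriminant_zero_double_root[OF deg 0] by (simp add: s)
    have "a1 \<noteq> 0" using e D(2) by (auto simp: s)
    then have "x = of_real (- a0 / a1)" using e by (simp add: field_simps eq_neg_iff_add_eq_0)
    then show ?thesis by (metis Reals_of_real)
  qed
  then have cx: "cnj x = x" by (simp add: Reals_cnj_iff)
  have "y = cnj y"
  proof (rule ccontr)
    assume "y \<noteq> cnj y"
    moreover have "value_at F b x (cnj y) = 0" "value_at (pderiv F) b x (cnj y) = 0"
      using value_at_cnj[of F b x y] value_at_cnj[of "pderiv F" b x y] 0 by (simp_all add: cx)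
    ultimately have "[:-x, 1:]\<^sup>2 dvd specialize b D" using discriminant_sq_dvd_two_double_roots[OF deg 0] by blast
    moreover have "degree (specialize b D :: complex poly) \<le> 1" using D(1) by (metis specialize_def degree_map_poly_le)
    ultimately show False using sq_not_dvd_linear D(2) by blast
  qed
  then have "y \<in> \<real>" by (simp add: Reals_cnj_iff)
  with x obtain u v where uv: "x = of_real u" "y = of_real v" by (auto elim!: Reals_cases)
  then have "of_real (value_at F b u v) = (0 :: complex)" using 0(1) by (simp add: value_at_of_real)
  then show thesis using that uv by simp
qed

lemma linear_discriminant_no_zeros:
  assumes b: "b1 \<in> I" "b \<longlonglongrightarrow> b1" and no_zeros: "\<And>k. Z (b k) = {}"
    and D: "degree D = 1" "\<And>k. specialize (b k) D \<noteq> (0 :: complex poly)" and deg: "degree F \<ge> 2"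
  shows "Z b1 = {}"
proof (rule ccontr)
  assume ne: "Z b1 \<noteq> {}"
  obtain P where P: "P \<in> Z b1" "\<And>R. R \<in> Z b1 \<Longrightarrow> fst R \<le> fst P"
    using continuous_attains_sup[OF compact_Z[OF b(1)] ne continuous_on_fst[OF continuous_on_id]] by blast
  obtain x0 y0 where P_eq: "P = (x0, y0)" by (cases P)
  define X Y :: complex where "X = of_real x0" and "Y = of_real y0"
  have 0: "(x0, y0) \<in> \<Omega>" "value_at F b1 x0 y0 = 0" using P(1) by (auto simp: P_eq Z_iff)
  have max: "x \<le> x0" if "(x, y) \<in> Z b1" for x y using P(2)[OF that] by (simp add: P_eq)
  obtain r where r: "r > 0" "\<And>x y. \<bar>x - x0\<bar> < r \<Longrightarrow> \<bar>y - y0\<bar> < r \<Longrightarrow> (x, y) \<in> \<Omega>"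
    using box_in_Omega[OF 0(1)] by blast
  have "fibre F b1 X \<noteq> 0"
  proof
    assume "fibre F b1 X = 0"
    then have "value_at F b1 X (of_real y) = 0" for y by (simp add: value_at_fibre)
    moreover have "value_at F b1 X (of_real y) = of_real (value_at F b1 x0 y)" for y unfolding X_def by (rule value_at_of_real)
    ultimately have "(of_real (value_at F b1 x0 y) :: complex) = 0" for y by metis
    then show False using no_vertical_line[OF b(1) 0(1)] by auto
  qed
  then have fin: "finite {y. value_at F b1 X y = 0}" unfolding value_at_fibre by (rule poly_roots_finite)
  obtain e where e: "e > 0" "\<And>w. w \<in> ball Y e \<Longrightarrow> w \<noteq> Y \<Longrightarrow> value_at F b1 X w \<noteq> 0"
    using finite_ball_avoid[of UNIV "{y. value_at F b1 X y = 0}" Y] fin by auto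
  define \<rho> where "\<rho> = min e r / 2"
  have rho: "\<rho> > 0" "\<rho> < e" "\<rho> < r" using e r by (auto simp: \<rho>_def min_def)
  have XY0: "value_at F b1 X Y = 0" using 0(2) by (simp add: X_def Y_def value_at_of_real)
  have "sphere Y \<rho> \<noteq> {}" using rho by simp
  moreover have "continuous_on (sphere Y \<rho>) (\<lambda>y. norm (value_at F b1 X y))" by (intro continuous_intros)
  ultimately obtain y' where y': "y' \<in> sphere Y \<rho>" "\<And>y. y \<in> sphere Y \<rho> \<Longrightarrow> norm (value_at F b1 X y') \<le> norm (value_at F b1 X y)"
    using continuous_attains_inf[of "sphere Y \<rho>" "\<lambda>y. norm (value_at F b1 X y)"] by auto
  \<comment> \<open>Half the minimum of the modulus on the sphere, where no root of the limit fibre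
    over \<open>X\<close> lies. The bound persists for parameters near \<open>b1\<close> and points
    near \<open>X\<close>, keeping roots off the sphere.\<close>
  define B where "B = norm (value_at F b1 X y') / 2"
  have nz': "value_at F b1 X y' \<noteq> 0" using y'(1) rho by (intro e) auto
  have B0: "B > 0" using nz' by (simp add: B_def)
  have B: "norm (value_at F b1 X y) > B" if "y \<in> sphere Y \<rho>" for y
    using y'(2)[OF that] B0 unfolding B_def by linarith
  have "\<forall>\<^sub>F s in nhds (b1, X). \<forall>y\<in>sphere Y \<rho>. norm ((\<lambda>(b, x). value_at F b x) s y) > B"
    by (rule eventually_norm_gt_on_compact) (use B in \<open>auto simp: case_prod_unfold intro!: continuous_intros\<close>)
  then obtain Q1 Q2 where Q: "eventually Q1 (nhds b1)" "eventually Q2 (nhds X)"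
      "\<And>b x. Q1 b \<Longrightarrow> Q2 x \<Longrightarrow> \<forall>y\<in>sphere Y \<rho>. norm (value_at F b x y) > B"
    unfolding nhds_prod eventually_prod_filter by auto
  obtain d where d: "d > 0" "\<And>x. dist x X < d \<Longrightarrow> Q2 x" using Q(2) unfolding eventually_nhds_metric by blast
  \<comment> \<open>The bound by \<open>r\<close> keeps real points of the disc inside the box
    contained in \<open>\<Omega>\<close>.\<close>
  define \<delta> where "\<delta> = min d r"
  have delta: "\<delta> > 0" "\<delta> \<le> r" using d r by (auto simp: \<delta>_def)
  have "\<forall>\<^sub>F k in sequentially. Q1 (b k)" using Q(1) b(2) by (simp add: filterlim_iff)
  moreover have "(\<lambda>k. norm (value_at F (b k) X Y)) \<longlonglongrightarrow> norm (value_at F b1 X Y)" by (intro tendsto_intros b)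
  then have "\<forall>\<^sub>F k in sequentially. norm (value_at F (b k) X Y) < B"
    by (rule order_tendstoD) (use XY0 B0 in simp)
  ultimately have "\<forall>\<^sub>F k in sequentially. Q1 (b k) \<and> norm (value_at F (b k) X Y) < B" by eventually_elim simp
  then obtain N where N: "\<And>k. k \<ge> N \<Longrightarrow> Q1 (b k) \<and> norm (value_at F (b k) X Y) < B" by (auto simp: eventually_sequentially)
  define c where "c = (\<lambda>k. b (k + N))"
  have c: "c \<longlonglongrightarrow> b1" unfolding c_def by (rule LIMSEQ_ignore_initial_segment[OF b(2)])
  have cN: "Q1 (c k)" "norm (value_at F (c k) X Y) < B" for k using N[of "k + N"] by (auto simp: c_def)
  have far: "norm (value_at F (c k) x y) > B" if "x \<in> ball X \<delta>" "dist Y y = \<rho>" for k x y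
    using Q(3)[OF cN(1)[of k] d(2)[of x]] that by (auto simp: \<delta>_def dist_commute)
  have no_real: False if "u \<in> ball x0 r" "v \<in> ball y0 r" "value_at F (c k) u v = 0" for u v k
  proof -
    have "(u, v) \<in> Z (b (k + N))" using r(2)[of u v] that by (simp add: Z_iff c_def dist_real_def abs_minus_commute)
    then show False using no_zeros by simp
  qed
  have root: "\<exists>y\<in>ball Y \<rho>. value_at F (c k) X y = 0" for k
    by (rule holomorphic_zero_in_ball[OF holomorphic_value_at rho(1) far cN(2)]) (use delta in auto)
  \<comment> \<open>A multiple root in the bidisc would be a real point of the box, hence a zero in
    \<open>\<Omega>\<close> at a parameter without zeros.\<close>
  have sr: "simple_roots F (c k) X Y \<delta> \<rho>" for k
  proof
    show "value_at (pderiv F) (c k) x y \<noteq> 0" if xy: "x \<in> ball X \<delta>" "y \<in> ball Y \<rho>" "value_at F (c k) x y = 0" for x y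
    proof
      assume "value_at (pderiv F) (c k) x y = 0"
      with xy(3) obtain u v where uv: "x = of_real u" "y = of_real v" "value_at F (c k) u v = 0"
        using double_root_linear_discriminant[OF D(1) _ deg, of "c k" x y] D(2) by (auto simp: c_def)
      have "u \<in> ball x0 r" "v \<in> ball y0 r"
        using xy delta rho by (auto simp: uv X_def Y_def dist_of_real)
      then show False using no_real uv by blast
    qed
    show "value_at F (c k) x y \<noteq> 0" if "x \<in> ball X \<delta>" "dist Y y = \<rho>" for x y
      using far[OF that, of k] B0 by auto
  qed (use delta rho root in auto)
  have "\<exists>g. g holomorphic_on ball X \<delta> \<and> (\<forall>x\<in>ball X \<delta>. g x \<in> ball Y \<rho> \<and> value_at F (c k) x (g x) = 0)" for k
  proof -
    obtain y1 where "y1 \<in> ball Y \<rho>" "value_at F (c k) X y1 = 0" using root by blast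
    interpret simple_roots F "c k" X Y \<delta> \<rho> by (rule sr)
    obtain g where "g holomorphic_on ball X \<delta>" and gE: "\<And>x. x \<in> ball X \<delta> \<Longrightarrow> (x, g x) \<in> E"
      using section_exists[OF \<open>y1 \<in> ball Y \<rho>\<close> \<open>value_at F (c k) X y1 = 0\<close>] by blast
    then show ?thesis by (intro exI[of _ g]) (simp add: E_def)
  qed
  then obtain g where g: "\<And>k. g k holomorphic_on ball X \<delta>"
      "\<And>k x. x \<in> ball X \<delta> \<Longrightarrow> g k x \<in> ball Y \<rho>" "\<And>k x. x \<in> ball X \<delta> \<Longrightarrow> value_at F (c k) x (g k x) = 0" by metis
  define \<H> where "\<H> = {h. h holomorphic_on ball X \<delta> \<and> (\<forall>x\<in>ball X \<delta>. h x \<in> ball Y \<rho>)}"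
  have bnd: "norm z \<le> norm Y + \<rho>" if "z \<in> ball Y \<rho>" for z
    using that norm_triangle_ineq2[of z Y] by (simp add: dist_norm norm_minus_commute)
  \<comment> \<open>All sections take values in one bounded ball, so Montel's theorem
    applies.\<close>
  obtain G t where G: "G holomorphic_on ball X \<delta>" "strict_mono (t :: nat \<Rightarrow> nat)"
      "\<And>x. x \<in> ball X \<delta> \<Longrightarrow> ((\<lambda>n. g (t n) x) \<longlongrightarrow> G x) sequentially"
      "\<And>K. \<lbrakk>compact K; K \<subseteq> ball X \<delta>\<rbrakk> \<Longrightarrow> uniform_limit K (g \<circ> t) G sequentially"
  proof (rule Montel[of "ball X \<delta>" \<H> g])
    show "\<exists>B. \<forall>h\<in>\<H>. \<forall>z\<in>K. norm (h z) \<le> B" if "compact K" "K \<subseteq> ball X \<delta>" for K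
      using that bnd by (intro exI[of _ "norm Y + \<rho>"]) (auto simp: \<H>_def subset_iff)
  qed (use g in \<open>auto simp: \<H>_def\<close>)
  have ct: "(\<lambda>n. c (t n)) \<longlonglongrightarrow> b1" using LIMSEQ_subseq_LIMSEQ[OF c G(2)] by (simp add: o_def)
  have Groot: "value_at F b1 x (G x) = 0" "G x \<in> cball Y \<rho>" if "x \<in> ball X \<delta>" for x
  proof -
    have "(\<lambda>n. value_at F (c (t n)) x (g (t n) x)) \<longlonglongrightarrow> value_at F b1 x (G x)" by (intro tendsto_intros ct G(3) that)
    then show "value_at F b1 x (G x) = 0" by (simp add: g(3)[OF that] LIMSEQ_const_iff)
    show "G x \<in> cball Y \<rho>"
      by (rule Lim_in_closed_set[OF closed_cball _ _ G(3)[OF that]])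
         (use g(2)[OF that] in \<open>auto intro: always_eventually less_imp_le\<close>)
  qed
  have X: "X \<in> ball X \<delta>" using delta by simp
  \<comment> \<open>\<open>Y\<close> is the only root of the limit fibre over \<open>X\<close>
    within distance \<open>e\<close>, and \<open>\<rho> < e\<close>.\<close>
  have "G X = Y"
    using Groot[OF X] e(2)[of "G X"] rho by force
  have cnj_ball: "cnj x \<in> ball X \<delta>" if "x \<in> ball X \<delta>" for x
  proof -
    have "dist X (cnj x) = dist (cnj X) (cnj x)" by (simp add: X_def)
    also have "\<dots> = dist X x" by (metis complex_cnj_diff complex_mod_cnj dist_norm)
    finally show ?thesis using that by simp
  qed
  have cnj_im: "cnj ` ball X \<delta> = ball X \<delta>"
  proof (intro equalityI subsetI)
    fix x assume "x \<in> ball X \<delta>"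
    then have "cnj (cnj x) \<in> cnj ` ball X \<delta>" by (intro imageI cnj_ball)
    then show "x \<in> cnj ` ball X \<delta>" by simp
  qed (use cnj_ball in blast)
  \<comment> \<open>Twice the imaginary part on the real axis, up to the factor \<open>\<i>\<close>,
    extended holomorphically by reflection.\<close>
  define H where "H = (\<lambda>h x. h x - cnj (h (cnj x)))"
  have holH: "H h holomorphic_on ball X \<delta>" if "h holomorphic_on ball X \<delta>" for h
  proof -
    have "(cnj \<circ> h \<circ> cnj) holomorphic_on ball X \<delta>"
      using that by (intro holomorphic_on_compose_cnj_cnj) (auto simp: cnj_im)
    then show ?thesis unfolding H_def using that by (intro holomorphic_on_diff) (auto simp: o_def)
  qed
  \<comment> \<open>At a zero of \<open>H (g k)\<close> the section and its reflection meet, so they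
    coincide. Then \<open>g k X\<close> is real and gives a forbidden real zero over
    \<open>x0\<close>.\<close>
  have Hnz: "H (g k) x \<noteq> 0" if x: "x \<in> ball X \<delta>" for k x
  proof
    assume H0: "H (g k) x = 0"
    interpret simple_roots F "c k" X Y \<delta> \<rho> by (rule sr)
    have "dist Y (cnj y) = dist Y y" for y
    proof -
      have "dist Y (cnj y) = dist (cnj Y) (cnj y)" by (simp add: Y_def)
      then show ?thesis by (metis complex_cnj_diff complex_mod_cnj dist_norm)
    qed
    moreover have "value_at F (c k) z (cnj (g k (cnj z))) = 0" if "z \<in> ball X \<delta>" for z
      using value_at_cnj[of F "c k" "cnj z" "g k (cnj z)"] g(3)[OF cnj_ball[OF that]] by simp
    ultimately have E2: "(z, cnj (g k (cnj z))) \<in> E" if "z \<in> ball X \<delta>" for z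
      using that g(2)[OF cnj_ball[OF that], of k] by (auto simp: E_def)
    have cg: "continuous_on (ball X \<delta>) (g k)" by (rule holomorphic_on_imp_continuous_on[OF g(1)])
    have "continuous_on (ball X \<delta>) (\<lambda>z. g k (cnj z))"
      by (rule continuous_on_compose2[OF cg]) (auto intro!: continuous_intros cnj_ball simp del: mem_ball)
    then have cg2: "continuous_on (ball X \<delta>) (\<lambda>z. cnj (g k (cnj z)))" by (intro continuous_intros)
    have "g k X = cnj (g k (cnj X))"
      by (rule section_unique[OF cg _ cg2 E2 x _ X]) (use g H0 in \<open>auto simp: E_def H_def\<close>)
    then have "g k X = cnj (g k X)" by (simp add: X_def)
    then have "g k X \<in> \<real>" by (simp add: Reals_cnj_iff)
    then obtain v where v: "g k X = of_real v" by (auto elim: Reals_cases)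
    have "v \<in> ball y0 r" using g(2)[OF X, of k] rho by (auto simp: v Y_def dist_of_real)
    moreover have "of_real (value_at F (c k) x0 v) = (0::complex)" using g(3)[OF X, of k] unfolding v by (simp add: X_def value_at_of_real)
    ultimately show False using no_real[of x0 v k] r(1) by simp
  qed
  \<comment> \<open>By Hurwitz a nonconstant limit of zero-free functions is zero-free, but
    \<open>H G\<close> vanishes at \<open>X\<close>.\<close>
  have "H G constant_on ball X \<delta>"
  proof (rule ccontr)
    assume "\<not> H G constant_on ball X \<delta>"
    then have "H G X \<noteq> 0"
    proof (rule Hurwitz_no_zeros[OF open_ball connected_ball, rotated -3])
      show "uniform_limit K (\<lambda>n. H (g (t n))) (H G) sequentially" if K: "compact K" "K \<subseteq> ball X \<delta>" for K
      proof -
        have "compact (cnj ` K)" using K(1) by (intro compact_continuous_image continuous_intros)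
        moreover have "cnj ` K \<subseteq> ball X \<delta>" using K(2) cnj_ball by blast
        ultimately have u: "uniform_limit (cnj ` K) (g \<circ> t) G sequentially" by (rule G(4))
        have "uniform_limit K (\<lambda>n x. cnj (g (t n) (cnj x))) (\<lambda>x. cnj (G (cnj x))) sequentially"
          unfolding uniform_limit_iff
        proof safe
          fix e :: real assume "e > 0"
          with u have "\<forall>\<^sub>F n in sequentially. \<forall>x\<in>cnj ` K. dist ((g \<circ> t) n x) (G x) < e" by (simp add: uniform_limit_iff)
          then show "\<forall>\<^sub>F n in sequentially. \<forall>x\<in>K. dist (cnj (g (t n) (cnj x))) (cnj (G (cnj x))) < e"
            by eventually_elim (auto simp: dist_norm simp flip: complex_cnj_diff)
        qed
        moreover have "uniform_limit K (\<lambda>n x. g (t n) x) G sequentially" using G(4)[OF K] by (simp add: o_def)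
        ultimately show ?thesis unfolding H_def by (rule uniform_limit_minus[rotated])
      qed
    qed (use holH g G Hnz X in auto)
    moreover have "H G X = 0" by (simp add: H_def X_def[symmetric] \<open>G X = Y\<close>) (simp add: X_def Y_def \<open>G X = Y\<close>[unfolded X_def Y_def])
    ultimately show False by simp
  qed
  then have H0: "H G x = 0" if "x \<in> ball X \<delta>" for x
  proof -
    have "H G x = H G X" using \<open>H G constant_on ball X \<delta>\<close> that X unfolding constant_on_def by metis
    also have "\<dots> = 0" using \<open>G X = Y\<close> by (simp add: H_def X_def Y_def)
    finally show ?thesis .
  qed
  \<comment> \<open>A real point of the disc to the right of \<open>x0\<close>; the real value of
    \<open>G\<close> there is a zero beyond the rightmost one.\<close>
  define x where "x = x0 + \<delta> / 2"
  have x: "(of_real x :: complex) \<in> ball X \<delta>" 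
  proof -
    have "dist x0 x < \<delta>" using delta by (simp add: x_def dist_real_def)
    then show ?thesis by (simp only: X_def mem_ball dist_of_real)
  qed
  have "cnj (G (of_real x)) = G (of_real x)" using H0[OF x] by (simp add: H_def)
  then have "G (of_real x) \<in> \<real>" by (simp add: Reals_cnj_iff)
  then obtain v where v: "G (of_real x) = of_real v" by (auto elim: Reals_cases)
  have "of_real (value_at F b1 x v) = (0::complex)" using Groot(1)[OF x] by (simp add: v value_at_of_real)
  moreover have "\<bar>v - y0\<bar> < r" using Groot(2)[OF x] rho by (simp add: v Y_def dist_of_real dist_real_def abs_minus_commute)
  moreover have "\<bar>x - x0\<bar> < r" using delta by (simp add: x_def)
  ultimately have "(x, v) \<in> Z b1" using r(2) by (simp add: Z_iff)
  then show False using max[of x v] delta by (simp add: x_def)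
qed

lemma zeros_stay_away:
  assumes b: "b1 \<in> I" "b \<longlonglongrightarrow> b1" and pos: "\<And>k x y. (x, y) \<in> \<Omega> \<Longrightarrow> value_at F (b k) x y > 0"
    and disc: "poly (discriminant D) b1 \<noteq> 0"
  shows "Z b1 = {}"
proof (rule ccontr)
  assume ne: "Z b1 \<noteq> {}"
  then obtain x0 y0 where xy: "(x0, y0) \<in> Z b1" by auto
  have nonneg: "value_at F b1 x y \<ge> 0" if "(x, y) \<in> \<Omega>" for x y
  proof (rule LIMSEQ_le_const)
    show "(\<lambda>k. value_at F (b k) x y) \<longlonglongrightarrow> value_at F b1 x y" by (intro tendsto_intros b)
  qed (use pos[OF that] in \<open>auto intro!: exI[of _ 0] less_imp_le\<close>)
  note * = nonneg_zero_discriminant[OF b(1) disc nonneg xy]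
  have no: "Z (b k) = {}" for k using pos[of _ _ k] by (auto simp: Z_def less_le)
  have "coeff D 1 \<noteq> 0" using *(2) by (metis leading_coeff_neq_0 degree_0 zero_neq_one)
  then have "\<forall>\<^sub>F x in at b1. poly (coeff D 1) x \<noteq> 0" by (rule eventually_poly_nonzero)
  moreover have "filterlim b (at b1) sequentially"
  proof -
    have "b k \<noteq> b1" for k using no[of k] ne by auto
    then show ?thesis using b(2) by (simp add: filterlim_at)
  qed
  ultimately have "\<forall>\<^sub>F k in sequentially. poly (coeff D 1) (b k) \<noteq> 0" by (rule eventually_compose_filterlim)
  then obtain N where N: "\<And>k. k \<ge> N \<Longrightarrow> poly (coeff D 1) (b k) \<noteq> 0" by (auto simp: eventually_sequentially)
  have "Z b1 = {}"
  proof (rule linear_discriminant_no_zeros[of b1 "\<lambda>k. b (k + N)"])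
    show "(\<lambda>k. b (k + N)) \<longlonglongrightarrow> b1" by (rule LIMSEQ_ignore_initial_segment[OF b(2)])
    show "specialize (b (k + N)) D \<noteq> (0 :: complex poly)" for k
      using N[of "k + N"] by (simp add: discriminant2_linear[OF *(2)])
  qed (use b no * in auto)
  with ne show False by simp
qed

end

section \<open>Points at infinity and the conclusion\<close>

lemma coeff_family_at: "coeff (coeff (family_at F b) j) i = poly (coeff (coeff F j) i) b"
  by (simp add: family_at_def coeff_map_poly)

lemma eval2_double_sum:
  assumes N: "\<And>i j. coeff (coeff G j) i \<noteq> 0 \<Longrightarrow> i \<le> N \<and> j \<le> N"
  shows "eval2 G x y = (\<Sum>j\<le>N. \<Sum>i\<le>N. coeff (coeff G j) i * x ^ i * y ^ j)"
proof -
  have "degree (coeff G j) \<le> N" for j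
    by (rule degree_le) (use N in \<open>auto simp: not_less[symmetric]\<close>)
  then have inner: "poly (coeff G j) x = (\<Sum>i\<le>N. coeff (coeff G j) i * x ^ i)" for j
    unfolding poly_altdef by (intro sum.mono_neutral_left) (auto simp: coeff_eq_0)
  have "degree G \<le> N"
  proof (rule degree_le, safe)
    fix j assume "N < j"
    then have "coeff (coeff G j) i = 0" for i using N[of j i] by (meson not_less)
    then show "coeff G j = 0" by (simp add: poly_eq_iff)
  qed
  then have "poly G [:y:] = (\<Sum>j\<le>N. coeff G j * [:y:] ^ j)"
    unfolding poly_altdef by (intro sum.mono_neutral_left) (auto simp: coeff_eq_0)
  then show ?thesis
    by (simp add: eval2_def poly_sum inner sum_distrib_right)
qed

lemma total_degree_ge: "coeff (coeff G j) i \<noteq> 0 \<Longrightarrow> i + j \<le> total_degree G"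
  unfolding total_degree_def by (rule Max_ge) (use finite_total_degree_set[of G] in auto)

lemma homogenization_1: "homogenization G x y 1 = eval2 G x y"
proof -
  let ?d = "total_degree G"
  let ?f = "\<lambda>j i. coeff (coeff G j) i * x ^ i * y ^ j"
  have "eval2 G x y = (\<Sum>j\<le>?d. \<Sum>i\<le>?d. ?f j i)"
    by (rule eval2_double_sum) (use total_degree_ge in \<open>fastforce dest: total_degree_ge\<close>)
  also have "\<dots> = (\<Sum>(j, i)\<in>{..?d} \<times> {..?d}. ?f j i)" by (rule sum.cartesian_product)
  also have "\<dots> = (\<Sum>(j, i)\<in>{(j, i). j + i \<le> ?d}. ?f j i)"
  proof (rule sum.mono_neutral_right)
    have "j + i \<le> ?d" if "coeff (coeff G j) i \<noteq> 0" for j i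
      using total_degree_ge[OF that] by simp
    then show "\<forall>p\<in>{..?d} \<times> {..?d} - {(j, i). j + i \<le> ?d}. (case p of (j, i) \<Rightarrow> ?f j i) = 0" by auto
  qed auto
  also have "\<dots> = (\<Sum>k\<le>?d. \<Sum>j\<le>k. ?f j (k - j))" by (rule sum.triangle_reindex_eq)
  finally show ?thesis by (simp add: homogenization_def homogeneous_part_def)
qed

lemma homogeneous_part_scale: "homogeneous_part G k (t * x) (t * y) = t ^ k * homogeneous_part G k x y"
  unfolding homogeneous_part_def sum_distrib_left
proof (rule sum.cong)
  fix j assume "j \<in> {..k}"
  then have "t ^ k = t ^ (k - j) * t ^ j" by (simp flip: power_add)
  then show "coeff (coeff G j) (k - j) * (t * x) ^ (k - j) * (t * y) ^ j = t ^ k * (coeff (coeff G j) (k - j) * x ^ (k - j) * y ^ j)"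
    by (simp add: power_mult_distrib)
qed simp

lemma homogenization_scale: "homogenization G (t * x) (t * y) (t * z) = t ^ total_degree G * homogenization G x y z"
  unfolding homogenization_def sum_distrib_left homogeneous_part_scale
proof (rule sum.cong)
  fix k assume "k \<in> {..total_degree G}"
  then have "t ^ total_degree G = t ^ (total_degree G - k) * t ^ k" by (simp flip: power_add)
  then show "(t * z) ^ (total_degree G - k) * (t ^ k * homogeneous_part G k x y) =
      t ^ total_degree G * (z ^ (total_degree G - k) * homogeneous_part G k x y)"
    by (simp add: power_mult_distrib)
qed simp

lemma homogenization_0: "homogenization G x y 0 = homogeneous_part G (total_degree G) x y"
proof -
  have "homogenization G x y 0 = (\<Sum>k\<in>{total_degree G}. 0 ^ (total_degree G - k) * homogeneous_part G k x y)"
    unfolding homogenization_def by (rule sum.mono_neutral_right) auto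
  then show ?thesis by simp
qed

lemma tendsto_homogenization:
  assumes "(f \<longlongrightarrow> x) A" "(g \<longlongrightarrow> y) A" "(h \<longlongrightarrow> z) A"
  shows "((\<lambda>s. homogenization G (f s) (g s) (h s)) \<longlongrightarrow> homogenization G x y z) A"
  unfolding homogenization_def homogeneous_part_def by (intro tendsto_intros assms)

lemma isolated_in_limit:
  fixes p :: "'a::topological_space"
  assumes "p isolated_in S" "f \<longlonglongrightarrow> p" "\<And>k::nat. f k \<in> S"
  shows "\<forall>\<^sub>F k in sequentially. f k = p"
proof -
  obtain T where T: "open T" "T \<inter> S = {p}" using assms(1) by (auto simp: isolated_in_def)
  then have "\<forall>\<^sub>F k in sequentially. f k \<in> T" using assms(2) by (intro topological_tendstoD) auto
  then show ?thesis by eventually_elim (use T assms(3) in blast)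
qed

lemma proj_pt_scale:
  assumes "t \<noteq> 0"
  shows "proj_pt (t *\<^sub>R v) = proj_pt v"
proof -
  have "k *\<^sub>R v = (k / t) *\<^sub>R t *\<^sub>R v" for k using assms by simp
  moreover have "k *\<^sub>R t *\<^sub>R v = (k * t) *\<^sub>R v" for k by simp
  ultimately show ?thesis unfolding proj_pt_def span_singleton by blast
qed

lemma proj_pt_eqE:
  assumes "proj_pt (x, y, 0) = proj_pt v"
  obtains t where "v = t *\<^sub>R (x, y, 0)"
proof -
  have "v \<in> proj_pt (x, y, 0)" unfolding assms by (simp add: proj_pt_def span_base)
  then show thesis using that by (auto simp: proj_pt_def span_singleton)
qed

lemma unbounded_sequence:
  assumes "\<not> bounded S"
  shows "\<exists>p. \<forall>k. p k \<in> S \<and> norm (p k) > real (Suc k)"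
proof -
  have "\<exists>p. p \<in> S \<and> norm p > real (Suc k)" for k
    using assms unfolding bounded_iff by (meson not_le)
  then show ?thesis by metis
qed

text \<open>Unbounded zeros, divided by their norms, accumulate at a direction
  \<open>(x, y)\<close>. It is a point at infinity in the closure of \<open>\<Omega>\<close>, and in
  an affine chart the zeros converge to it, against isolation.\<close>

lemma bounded_zeros:
  assumes b: "b \<in> I"
    and isolated: "\<forall>P\<in>points_at_infinity_in \<Omega> (family_at F b). uniformly_isolated_at_infinity I F P"
  shows "bounded {(x, y) \<in> \<Omega>. eval2 (family_at F b) x y = 0}" (is "bounded ?Z")
proof (rule ccontr)
  assume "\<not> bounded ?Z"
  from unbounded_sequence[OF this] obtain p where "\<forall>k. p k \<in> ?Z \<and> norm (p k) > real (Suc k)" ..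
  then have p: "p k \<in> ?Z" "norm (p k) > real (Suc k)" for k by simp_all
  define R where "R = (\<lambda>k. norm (p k))"
  let ?hom = "homogenization (family_at F b)"
  have Rpos: "R k > 0" for k using p(2)[of k] unfolding R_def by linarith
  have "norm (p k /\<^sub>R R k) = 1" for k using Rpos[of k] by (simp add: R_def)
  then have "p k /\<^sub>R R k \<in> sphere 0 1" for k by simp
  moreover have "compact (sphere (0 :: real \<times> real) 1)" by simp
  ultimately obtain u r where u: "u \<in> sphere 0 1" "strict_mono (r :: nat \<Rightarrow> nat)" "((\<lambda>k. p k /\<^sub>R R k) \<circ> r) \<longlonglongrightarrow> u"
    unfolding compact_def by (metis (no_types, lifting))
  obtain x y where u_eq: "u = (x, y)" by (cases u)
  define X Y S where "X = (\<lambda>k. fst (p (r k)))" and "Y = (\<lambda>k. snd (p (r k)))" and "S = (\<lambda>k. inverse (R (r k)))"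
  have Spos: "S k > 0" for k using Rpos by (simp add: S_def)
  have lim: "(\<lambda>k. S k * X k) \<longlonglongrightarrow> x" "(\<lambda>k. S k * Y k) \<longlonglongrightarrow> y"
    using tendsto_fst[OF u(3)] tendsto_snd[OF u(3)] by (simp_all add: u_eq o_def X_def Y_def S_def)
  have "filterlim (\<lambda>k. real (Suc k)) at_top sequentially"
    using filterlim_compose[OF filterlim_real_sequentially filterlim_Suc] .
  then have "filterlim R at_top sequentially"
    by (rule filterlim_at_top_mono) (use less_imp_le[OF p(2)] in \<open>simp add: R_def del: of_nat_Suc\<close>)
  then have "(\<lambda>k. inverse (R k)) \<longlonglongrightarrow> 0" by (rule tendsto_inverse_0_at_top)
  then have S0: "S \<longlonglongrightarrow> 0" using LIMSEQ_subseq_LIMSEQ[OF _ u(2)] by (simp add: S_def o_def)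
  have XY: "(X k, Y k) \<in> \<Omega>" "eval2 (family_at F b) (X k) (Y k) = 0" for k
    using p(1)[of "r k"] by (auto simp: X_def Y_def case_prod_unfold)
  have hom0: "?hom (t * X k) (t * Y k) t = 0" for t k
    using homogenization_scale[of "family_at F b" t "X k" "Y k" 1] XY(2) by (simp add: homogenization_1)
  have "(\<lambda>k. ?hom (S k * X k) (S k * Y k) (S k)) \<longlonglongrightarrow> ?hom x y 0"
    by (intro tendsto_homogenization lim S0)
  then have "?hom x y 0 = 0" by (simp add: hom0 LIMSEQ_const_iff)
  moreover have xy: "(x, y) \<noteq> (0, 0)" using u(1) by (auto simp: u_eq)
  ultimately have inf: "proj_pt (x, y, 0) \<in> points_at_infinity (family_at F b)"
    unfolding points_at_infinity_def homogenization_0 by blast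
  have "proj_pt (x, y, 0) \<in> RP2 closure_of (affine_embed ` \<Omega>)"
    unfolding in_closure_of
  proof (intro conjI allI impI)
    show "proj_pt (x, y, 0) \<in> topspace RP2" using xy by (auto simp: topspace_RP2 zero_prod_def)
    fix T assume T: "proj_pt (x, y, 0) \<in> T \<and> openin RP2 T"
    then have op: "open {v. v \<noteq> 0 \<and> proj_pt v \<in> T}" by (simp add: openin_RP2 proj_open_def)
    have lm: "(\<lambda>k. (S k * X k, S k * Y k, S k)) \<longlonglongrightarrow> (x, y, 0)" by (intro tendsto_Pair lim S0)
    have mem: "(x, y, 0) \<in> {v. v \<noteq> 0 \<and> proj_pt v \<in> T}" using T xy by (auto simp: zero_prod_def)
    have "\<forall>\<^sub>F k in sequentially. (S k * X k, S k * Y k, S k) \<in> {v. v \<noteq> 0 \<and> proj_pt v \<in> T}"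
      by (rule topological_tendstoD[OF lm op mem])
    then obtain k where k: "proj_pt (S k * X k, S k * Y k, S k) \<in> T"
      using eventually_happens'[OF sequentially_bot] by blast
    have "proj_pt (S k * X k, S k * Y k, S k) = proj_pt (X k, Y k, 1)"
      using proj_pt_scale[of "S k" "(X k, Y k, 1)"] Spos[of k] by simp
    then show "\<exists>q. q \<in> affine_embed ` \<Omega> \<and> q \<in> T"
      using XY(1)[of k] k by (auto simp: affine_embed_def intro!: bexI[of _ "(X k, Y k)"] image_eqI)
  qed
  with inf isolated have "uniformly_isolated_at_infinity I F (proj_pt (x, y, 0))"
    by (auto simp: points_at_infinity_in_def)
  then consider
      (1) x' where "proj_pt (x, y, 0) = proj_pt (x', 1, 0)" "(x', 0) isolated_in {(x, z). ?hom x 1 z = 0}"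
    | (2) y' where "proj_pt (x, y, 0) = proj_pt (1, y', 0)" "(y', 0) isolated_in {(y, z). ?hom 1 y z = 0}"
    using b unfolding uniformly_isolated_at_infinity_def uniformly_isolated_def by blast
  then show False
  proof cases
    case 1
    obtain t where t: "t * y = 1" "x' = t * x" using proj_pt_eqE[OF 1(1)] by auto
    then have "y \<noteq> 0" "t = 1 / y" by (auto simp: eq_divide_eq)
    with t have y: "y \<noteq> 0" "x' = x / y" by simp_all
    have "\<forall>\<^sub>F k in sequentially. S k * Y k \<noteq> 0" by (rule tendsto_imp_eventually_ne[OF lim(2) y(1)])
    then obtain N where N: "\<And>k. k \<ge> N \<Longrightarrow> Y k \<noteq> 0" by (auto simp: eventually_sequentially)
    have "(\<lambda>k. ((S k * X k) / (S k * Y k), S k / (S k * Y k))) \<longlonglongrightarrow> (x / y, 0 / y)"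
      by (intro tendsto_intros lim S0 y)
    then have "(\<lambda>k. (X k / Y k, 1 / Y k)) \<longlonglongrightarrow> (x', 0)"
      using Spos by (simp add: y less_imp_neq[symmetric])
    then have l: "(\<lambda>k. (X (k + N) / Y (k + N), 1 / Y (k + N))) \<longlonglongrightarrow> (x', 0)" by (rule LIMSEQ_ignore_initial_segment)
    have "?hom (X (k + N) / Y (k + N)) 1 (1 / Y (k + N)) = 0" for k
      using hom0[of "1 / Y (k + N)" "k + N"] N[of "k + N"] by simp
    then have "\<forall>\<^sub>F k in sequentially. (X (k + N) / Y (k + N), 1 / Y (k + N)) = (x', 0)"
      by (intro isolated_in_limit[OF 1(2) l]) auto
    \<comment> \<open>The coordinate \<open>1 / Y (k + N)\<close> is nonzero, so the affine zeros
      never equal the point at infinity.\<close>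
    then show False using eventually_happens'[OF sequentially_bot] N by force
  next
    case 2
    obtain t where t: "t * x = 1" "y' = t * y" using proj_pt_eqE[OF 2(1)] by auto
    then have "x \<noteq> 0" "t = 1 / x" by (auto simp: eq_divide_eq)
    with t have x: "x \<noteq> 0" "y' = y / x" by simp_all
    have "\<forall>\<^sub>F k in sequentially. S k * X k \<noteq> 0" by (rule tendsto_imp_eventually_ne[OF lim(1) x(1)])
    then obtain N where N: "\<And>k. k \<ge> N \<Longrightarrow> X k \<noteq> 0" by (auto simp: eventually_sequentially)
    have "(\<lambda>k. ((S k * Y k) / (S k * X k), S k / (S k * X k))) \<longlonglongrightarrow> (y / x, 0 / x)"
      by (intro tendsto_intros lim S0 x)
    then have "(\<lambda>k. (Y k / X k, 1 / X k)) \<longlonglongrightarrow> (y', 0)"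
      using Spos by (simp add: x less_imp_neq[symmetric])
    then have l: "(\<lambda>k. (Y (k + N) / X (k + N), 1 / X (k + N))) \<longlonglongrightarrow> (y', 0)" by (rule LIMSEQ_ignore_initial_segment)
    have "?hom 1 (Y (k + N) / X (k + N)) (1 / X (k + N)) = 0" for k
      using hom0[of "1 / X (k + N)" "k + N"] N[of "k + N"] by simp
    then have "\<forall>\<^sub>F k in sequentially. (Y (k + N) / X (k + N), 1 / X (k + N)) = (y', 0)"
      by (intro isolated_in_limit[OF 2(2) l]) auto
    then show False using eventually_happens'[OF sequentially_bot] N by force
  qed
qed

section \<open>Exchange of variables and connectedness in the parameter\<close>

lemma value_at_swap_vars: "value_at (swap_vars F) b y x = (value_at F b x y :: real)"
proof -
  let ?G = "family_at F b" and ?G' = "family_at (swap_vars F) b"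
  \<comment> \<open>The total degree bounds the exponents of both variables, so both polynomials are
    summed over the same square.\<close>
  define N where "N = total_degree ?G"
  have N: "i \<le> N \<and> j \<le> N" if "coeff (coeff ?G j) i \<noteq> 0" for i j
    using total_degree_ge[OF that] by (simp add: N_def)
  have sw: "coeff (coeff ?G' i) j = coeff (coeff ?G j) i" for i j
    by (simp add: coeff_family_at coeff_swap_vars)
  have "value_at (swap_vars F) b y x = (\<Sum>j\<le>N. \<Sum>i\<le>N. coeff (coeff ?G' j) i * y ^ i * x ^ j)"
    unfolding eval2_family_at[symmetric] by (rule eval2_double_sum) (use N in \<open>auto simp: sw\<close>)
  also have "\<dots> = (\<Sum>i\<le>N. \<Sum>j\<le>N. coeff (coeff ?G' j) i * y ^ i * x ^ j)" by (rule sum.swap)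
  also have "\<dots> = (\<Sum>j\<le>N. \<Sum>i\<le>N. coeff (coeff ?G j) i * x ^ i * y ^ j)"
    by (simp add: sw mult.commute mult.left_commute)
  also have "\<dots> = value_at F b x y"
    unfolding eval2_family_at[symmetric] by (rule eval2_double_sum[symmetric]) (use N in auto)
  finally show ?thesis .
qed

lemma closedin_sequentialI:
  fixes S :: "'a::first_countable_topology set"
  assumes "C \<subseteq> S" "\<And>x l. (\<And>n::nat. x n \<in> C) \<Longrightarrow> x \<longlonglongrightarrow> l \<Longrightarrow> l \<in> S \<Longrightarrow> l \<in> C"
  shows "closedin (top_of_set S) C"
  unfolding closedin_limpt islimpt_sequential using assms by blast

text \<open>A common root \<open>b\<close> would make the linear factor at \<open>b\<close> divide
  the gcd.\<close>

lemma poly_gcd_nonzero: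
  fixes p q :: "real poly"
  assumes "poly (gcd p q) b \<noteq> 0"
  shows "poly p b \<noteq> 0 \<or> poly q b \<noteq> 0"
  using assms by (auto simp: poly_eq_0_iff_dvd)

context curve_family
begin

text \<open>Transfers all results about \<open>D\<close> to \<open>discr_x F\<close>, which is the
  discriminant of the swapped family.\<close>

lemma curve_family_swap: "curve_family (swap_vars F) (prod.swap ` \<Omega>) I"
proof
  have sw: "linear (prod.swap :: real \<times> real \<Rightarrow> _)"
    by (rule linearI) (auto simp: prod.swap_def)
  have vi: "prod.swap ` A = prod.swap -` A" for A :: "(real \<times> real) set" by (force simp: image_iff)
  show "open (prod.swap ` \<Omega>)"
    unfolding vi by (intro open_vimage open_Omega continuous_intros | simp add: prod.swap_def continuous_on_Pair)+
  show "(x, y) \<in> prod.swap ` \<Omega>" if b: "b \<in> I" "(x, y) \<in> closure (prod.swap ` \<Omega>)" "value_at (swap_vars F) b x y = 0" for b x y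
  proof -
    have "closure (prod.swap ` \<Omega>) = prod.swap ` closure \<Omega>"
      using closure_injective_linear_image[OF sw] by simp
    then have "(y, x) \<in> closure \<Omega>" using b(2) by auto
    from zero_in_closure[OF b(1) this] show ?thesis using b(3) by (force simp: value_at_swap_vars image_iff)
  qed
  show "compact {(x, y) \<in> prod.swap ` \<Omega>. value_at (swap_vars F) b x y = 0}" if "b \<in> I" for b
  proof -
    have "compact (prod.swap ` {(x, y) \<in> \<Omega>. value_at F b x y = 0})"
      by (intro compact_continuous_image linear_continuous_on_compose[OF continuous_on_id sw] compact_zeros that)
    also have "prod.swap ` {(x, y) \<in> \<Omega>. value_at F b x y = 0} = {(x, y) \<in> prod.swap ` \<Omega>. value_at (swap_vars F) b x y = 0}"
      by (force simp: value_at_swap_vars image_iff)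
    finally show ?thesis .
  qed
qed

definition positive_at :: "real \<Rightarrow> bool" where
  "positive_at b \<longleftrightarrow> (\<forall>(x, y)\<in>\<Omega>. value_at F b x y > 0)"

lemma positive_limit:
  assumes b: "b1 \<in> I" "b \<longlonglongrightarrow> b1" "\<And>k. b k \<in> I" and pos: "\<And>k. positive_at (b k)"
    and disc: "poly (discriminant (discr_y F)) b1 \<noteq> 0 \<or> poly (discriminant (discr_x F)) b1 \<noteq> 0"
  shows "positive_at b1"
proof -
  have pos': "value_at F (b k) x y > 0" if "(x, y) \<in> \<Omega>" for k x y using pos[of k] that by (auto simp: positive_at_def)
  have "Z b1 = {}"
    using disc
  proof
    assume "poly (discriminant (discr_y F)) b1 \<noteq> 0"
    then show ?thesis using zeros_stay_away[OF b(1,2) pos'] by (simp add: discr_y_def)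
  next
    assume d: "poly (discriminant (discr_x F)) b1 \<noteq> 0"
    interpret sw: curve_family "swap_vars F" "prod.swap ` \<Omega>" I by (rule curve_family_swap)
    have "sw.Z b1 = {}"
      using d pos' by (intro sw.zeros_stay_away[OF b(1,2)]) (auto simp: discr_x_def value_at_swap_vars)
    then show ?thesis by (force simp: Z_def sw.Z_def value_at_swap_vars)
  qed
  moreover have "value_at F b1 x y \<ge> 0" if "(x, y) \<in> \<Omega>" for x y
  proof (rule LIMSEQ_le_const)
    show "(\<lambda>k. value_at F (b k) x y) \<longlonglongrightarrow> value_at F b1 x y" by (intro tendsto_intros b)
  qed (use pos'[OF that] in \<open>auto intro!: exI[of _ 0] less_imp_le\<close>)
  ultimately show ?thesis unfolding positive_at_def by (auto simp: Z_def less_le)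
qed

lemma not_positive_limit:
  assumes conn: "connected \<Omega>" and b: "b1 \<in> I" "b \<longlonglongrightarrow> b1" "\<And>k. b k \<in> I" and npos: "\<And>k. \<not> positive_at (b k)"
    and disc: "poly (discriminant (discr_y F)) b1 \<noteq> 0 \<or> poly (discriminant (discr_x F)) b1 \<noteq> 0"
  shows "\<not> positive_at b1"
proof
  assume pos: "positive_at b1"
  \<comment> \<open>Near \<open>b1\<close> the value at this fixed point stays positive.
    Nonpositivity elsewhere then produces a zero by connectedness of
    \<open>\<Omega>\<close>.\<close>
  obtain p q where pq: "(p, q) \<in> \<Omega>" using npos[of 0] by (auto simp: positive_at_def)
  have "(\<lambda>k. value_at F (b k) p q) \<longlonglongrightarrow> value_at F b1 p q" by (intro tendsto_intros b)
  then have "\<forall>\<^sub>F k in sequentially. value_at F (b k) p q > 0"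
    by (rule order_tendstoD) (use pos pq in \<open>auto simp: positive_at_def\<close>)
  then obtain N where N: "\<And>k. k \<ge> N \<Longrightarrow> value_at F (b k) p q > 0" by (auto simp: eventually_sequentially)
  define c where "c = (\<lambda>k. b (k + N))"
  have c: "c \<longlonglongrightarrow> b1" "\<And>k. c k \<in> I" using LIMSEQ_ignore_initial_segment[OF b(2)] b(3) by (auto simp: c_def)
  have ne: "Z (c k) \<noteq> {}" for k
  proof -
    obtain x y where xy: "(x, y) \<in> \<Omega>" "value_at F (c k) x y \<le> 0"
      using npos[of "k + N"] by (auto simp: positive_at_def c_def not_less)
    have "connected ((\<lambda>s. value_at F (c k) (fst s) (snd s)) ` \<Omega>)"
      by (intro connected_continuous_image conn continuous_intros)
    moreover have "value_at F (c k) x y \<in> (\<lambda>s. value_at F (c k) (fst s) (snd s)) ` \<Omega>" using xy by force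
    moreover have "value_at F (c k) p q \<in> (\<lambda>s. value_at F (c k) (fst s) (snd s)) ` \<Omega>" using pq by force
    ultimately have "0 \<in> (\<lambda>s. value_at F (c k) (fst s) (snd s)) ` \<Omega>"
      by (rule connectedD_interval) (use xy N[of "k + N"] in \<open>auto simp: c_def\<close>)
    then show ?thesis by (force simp: Z_def)
  qed
  have empty: "Z b1 = {}" using pos by (auto simp: Z_def positive_at_def)
  show False
    using disc
  proof
    assume "poly (discriminant (discr_y F)) b1 \<noteq> 0"
    then show ?thesis using no_new_zeros[OF b(1) c empty ne] by (simp add: discr_y_def)
  next
    assume d: "poly (discriminant (discr_x F)) b1 \<noteq> 0"
    interpret sw: curve_family "swap_vars F" "prod.swap ` \<Omega>" I by (rule curve_family_swap)
    have Zs: "sw.Z b = prod.swap ` Z b" for b by (force simp: Z_def sw.Z_def value_at_swap_vars image_iff)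
    show ?thesis
      by (rule sw.no_new_zeros[OF b(1) c]) (use d empty ne in \<open>auto simp: Zs discr_x_def\<close>)
  qed
qed

lemma positive_everywhere:
  assumes conn: "connected \<Omega>" "connected I" and b0: "b0 \<in> I" "positive_at b0"
    and disc: "\<And>b. b \<in> I \<Longrightarrow> poly (discriminant (discr_y F)) b \<noteq> 0 \<or> poly (discriminant (discr_x F)) b \<noteq> 0"
    and b: "b \<in> I"
  shows "positive_at b"
proof -
  define S where "S = {b \<in> I. positive_at b}"
  have "closedin (top_of_set I) S"
  proof (rule closedin_sequentialI)
    fix x l assume "\<And>n::nat. x n \<in> S" "x \<longlonglongrightarrow> l" "l \<in> I"
    then show "l \<in> S" using positive_limit[of l x] disc by (simp add: S_def)
  qed (auto simp: S_def)
  moreover have "closedin (top_of_set I) (I - S)"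
  proof (rule closedin_sequentialI)
    fix x l assume "\<And>n::nat. x n \<in> I - S" "x \<longlonglongrightarrow> l" "l \<in> I"
    then show "l \<in> I - S" using not_positive_limit[OF conn(1), of l x] disc by (simp add: S_def)
  qed auto
  then have "openin (top_of_set I) S"
    unfolding openin_closedin_eq by (auto simp: S_def)
  ultimately have "S = {} \<or> S = I" using conn(2) connected_clopen by blast
  then show ?thesis using b0 b by (auto simp: S_def)
qed

end

theorem proposition5p12:
  fixes F :: "real poly poly poly" and \<Omega> :: "(real \<times> real) set" and I :: "real set"
  assumes "open \<Omega>" and "connected \<Omega>"
    and "formed_by_algebraic_curves (frontier \<Omega>)"
    and "open I" and "is_interval I"
    and i: "\<exists>b\<^sub>0\<in>I. \<forall>(x, y)\<in>\<Omega>. eval2 (family_at F b\<^sub>0) x y > 0"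
    and ii: "\<forall>b\<in>I. poly (double_discriminant F) b \<noteq> 0"
    and iii_const: "\<forall>b\<in>I. \<forall>b'\<in>I.
      points_at_infinity_in \<Omega> (family_at F b) = points_at_infinity_in \<Omega> (family_at F b')"
    and iii_isolated: "\<forall>b\<in>I. \<forall>P\<in>points_at_infinity_in \<Omega> (family_at F b).
      uniformly_isolated_at_infinity I F P"
    and iv: "\<forall>b\<in>I. zero_locus (family_at F b) \<inter> frontier \<Omega> = {}"
  shows "\<forall>b\<in>I. \<forall>(x, y)\<in>\<Omega>. eval2 (family_at F b) x y > 0"
proof -
  have zero: "(x, y) \<in> \<Omega>" if "b \<in> I" "(x, y) \<in> closure \<Omega>" "value_at F b x y = 0" for b x y
  proof -
    have "(x, y) \<in> zero_locus (family_at F b)" using that(3) by (simp add: zero_locus_def eval2_family_at)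
    then have "(x, y) \<notin> frontier \<Omega>" using iv that(1) by blast
    then show ?thesis using that(2) \<open>open \<Omega>\<close> by (simp add: frontier_def interior_open)
  qed
  interpret curve_family F \<Omega> I
  proof
    fix b assume b: "b \<in> I"
    have "closed {p. value_at F b (fst p) (snd p) = (0::real)}" by (intro closed_Collect_eq continuous_intros)
    \<comment> \<open>Zeros in the closure already lie in \<open>\<Omega>\<close>, so the zero set
      in the open set \<open>\<Omega>\<close> is closed in the plane; \<open>bounded_zeros\<close>
      makes it compact.\<close>
    then have "closed (closure \<Omega> \<inter> {p. value_at F b (fst p) (snd p) = 0})" by (intro closed_Int closed_closure)
    also have "closure \<Omega> \<inter> {p. value_at F b (fst p) (snd p) = 0} = {(x, y) \<in> \<Omega>. value_at F b x y = 0}"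
      using zero[OF b] closure_subset[of \<Omega>] by auto
    finally show "compact {(x, y) \<in> \<Omega>. value_at F b x y = 0}"
      using bounded_zeros[OF b, of \<Omega> F] iii_isolated b by (simp add: compact_eq_bounded_closed eval2_family_at)
  qed (use zero \<open>open \<Omega>\<close> in auto)
  obtain b0 where b0: "b0 \<in> I" "positive_at b0" using i by (auto simp: positive_at_def eval2_family_at)
  have "connected I" using \<open>is_interval I\<close> by (simp add: is_interval_connected_1)
  moreover have "poly (discriminant (discr_y F)) b \<noteq> 0 \<or> poly (discriminant (discr_x F)) b \<noteq> 0"
    if "b \<in> I" for b
    using poly_gcd_nonzero[of "discriminant (discr_x F)" "discriminant (discr_y F)" b] ii that
    by (auto simp: double_discriminant_def)
  ultimately have "positive_at b" if "b \<in> I" for b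
    using positive_everywhere[OF \<open>connected \<Omega>\<close> _ b0] that by blast
  then show ?thesis by (simp add: positive_at_def eval2_family_at)
qed

end
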